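(* Let $\mathcal{W}$ be a rational irreducible representation of a finite group $G$, let $e_{\mathcal{W}}$ be the associated central idempotent in $\mathbb{Q}[G]$, and let $V$ be one of the complex irreducible representations of $G$ appearing in the isotypical decomposition of $\mathbb{C}\otimes_{\mathbb{Q}}\mathcal{W}$, with Schur index $m=m_{\mathbb{Q}}(V)$. For any subgroup $H$ of $G$, let $$p_H=\frac{1}{|H|}\sum_{h\in H}h$$ be the central idempotent in $\mathbb{Q}[H]$ corresponding to the trivial representation of $H$. Then $$f_H=p_H\,e_{\mathcal{W}}=e_{\mathcal{W}}\,p_H$$ is an element of the simple algebra $\mathbb{Q}[G]\,e_{\mathcal{W}}$ satisfying: (1) $f_H^2=f_H$; (2) $h\,f_H=f_H=f_H\,h$ for every $h\in H$; (3) $f_H=0$ if and only if $\langle\rho_H,\mathcal{W}\rangle=0$, if and only if $\dim V^H=0$. Furthermore, if $f_H\neq0$, the left ideal $\mathbb{Q}[G]\,f_H$ is a left $\mathbb{Q}[G]$-module affording the representation $\mathcal{W}$ with multiplicity $\frac{\dim V^H}{m}$ (i.e. it is isomorphic to the direct sum of $\frac{\dim V^H}{m}$ copies of $\mathcal{W}$).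
   Context: $\rho_H$ is the representation of $G$ induced by the trivial representation of $H$; $\langle\cdot,\cdot\rangle$ is the usual inner product of characters; $V^H$ is the subspace of $V$ fixed by $H$. $e_{\mathcal{W}}=\frac{\dim V}{|G|}\sum_{g\in G}\operatorname{Trace}_{K/\mathbb{Q}}(\chi_V(g^{-1}))\,g$ is the central idempotent of $\mathbb{Q}[G]$ generating the simple subalgebra associated to $\mathcal{W}$, where $K$ is the field generated over $\mathbb{Q}$ by the values of the character $\chi_V$. *)

theory Defs
  imports
    "Jordan_Normal_Form.VS_Connect"
    "HOL-Algebra.Left_Coset"
    "HOL-Algebra.Embedded_Algebras"
    "HOL-Algebra.Generated_Fields"
begin

section \<open>Matrix representations of a group\<close>

definition is_rep :: "('g, 'b) monoid_scheme \<Rightarrow> nat \<Rightarrow> ('g \<Rightarrow> 'a::field mat) \<Rightarrow> bool" where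
  "is_rep G n \<rho> \<longleftrightarrow>
     (\<forall>g\<in>carrier G. \<rho> g \<in> carrier_mat n n) \<and>
     \<rho> \<one>\<^bsub>G\<^esub> = 1\<^sub>m n \<and>
     (\<forall>g\<in>carrier G. \<forall>h\<in>carrier G. \<rho> (g \<otimes>\<^bsub>G\<^esub> h) = \<rho> g * \<rho> h)"

definition irreducible_rep :: "('g, 'b) monoid_scheme \<Rightarrow> nat \<Rightarrow> ('g \<Rightarrow> 'a::field mat) \<Rightarrow> bool" where
  "irreducible_rep G n \<rho> \<longleftrightarrow>
     is_rep G n \<rho> \<and> n > 0 \<and>
     (\<forall>U. VectorSpace.subspace class_ring U (module_vec TYPE('a) n) \<and>
          (\<forall>g\<in>carrier G. \<forall>u\<in>U. \<rho> g *\<^sub>v u \<in> U) \<longrightarrow>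
          U = {0\<^sub>v n} \<or> U = carrier_vec n)"

text \<open>Matrices of the \<open>G\<close>-equivariant linear maps from \<open>\<rho>\<close> (degree \<open>n\<close>) to \<open>\<sigma>\<close> (degree \<open>m\<close>).\<close>

definition intertwiners ::
  "('g, 'b) monoid_scheme \<Rightarrow> nat \<Rightarrow> ('g \<Rightarrow> 'a::field mat) \<Rightarrow> nat \<Rightarrow> ('g \<Rightarrow> 'a mat) \<Rightarrow> 'a mat set" where
  "intertwiners G n \<rho> m \<sigma> =
     {T \<in> carrier_mat m n. \<forall>g\<in>carrier G. T * \<rho> g = \<sigma> g * T}"

definition equivalent_reps ::
  "('g, 'b) monoid_scheme \<Rightarrow> nat \<Rightarrow> ('g \<Rightarrow> 'a::field mat) \<Rightarrow> ('g \<Rightarrow> 'a mat) \<Rightarrow> bool" where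
  "equivalent_reps G n \<rho> \<sigma> \<longleftrightarrow> (\<exists>T\<in>intertwiners G n \<rho> n \<sigma>. invertible_mat T)"

text \<open>\<open>\<rho>\<close> is isomorphic to a subrepresentation of \<open>\<sigma>\<close>; for irreducible \<open>\<rho>\<close> this says that \<open>\<rho>\<close>
  appears in the isotypical decomposition of \<open>\<sigma>\<close>.\<close>

definition appears_in ::
  "('g, 'b) monoid_scheme \<Rightarrow> nat \<Rightarrow> ('g \<Rightarrow> 'a::field mat) \<Rightarrow> nat \<Rightarrow> ('g \<Rightarrow> 'a mat) \<Rightarrow> bool" where
  "appears_in G n \<rho> m \<sigma> \<longleftrightarrow>
     (\<exists>T\<in>intertwiners G n \<rho> m \<sigma>. inj_on (\<lambda>v. T *\<^sub>v v) (carrier_vec n))"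

definition complexify :: "('g \<Rightarrow> rat mat) \<Rightarrow> 'g \<Rightarrow> complex mat" where
  "complexify \<rho> g = map_mat of_rat (\<rho> g)"

definition fixed_space ::
  "'g set \<Rightarrow> nat \<Rightarrow> ('g \<Rightarrow> 'a::field mat) \<Rightarrow> 'a vec set" where
  "fixed_space H n \<rho> = {v \<in> carrier_vec n. \<forall>h\<in>H. \<rho> h *\<^sub>v v = v}"

definition fixed_dim :: "'g set \<Rightarrow> nat \<Rightarrow> ('g \<Rightarrow> 'a::field mat) \<Rightarrow> nat" where
  "fixed_dim H n \<rho> =
     vectorspace.dim class_ring (module_vec TYPE('a) n\<lparr>carrier := fixed_space H n \<rho>\<rparr>)"


section \<open>Characters and induced representations\<close>

definition character :: "('g \<Rightarrow> 'a::field mat) \<Rightarrow> 'g \<Rightarrow> 'a" where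
  "character \<rho> g = (\<Sum>i<dim_row (\<rho> g). \<rho> g $$ (i, i))"

definition char_inner ::
  "('g, 'b) monoid_scheme \<Rightarrow> ('g \<Rightarrow> complex) \<Rightarrow> ('g \<Rightarrow> complex) \<Rightarrow> complex" where
  "char_inner G \<phi> \<psi> = (\<Sum>g\<in>carrier G. \<phi> g * cnj (\<psi> g)) / of_nat (card (carrier G))"

definition left_transversal :: "('g, 'b) monoid_scheme \<Rightarrow> 'g set \<Rightarrow> 'g list \<Rightarrow> bool" where
  "left_transversal G H ts \<longleftrightarrow>
     set ts \<subseteq> carrier G \<and>
     bij_betw (\<lambda>i. ts ! i <#\<^bsub>G\<^esub> H) {..<length ts} (lcosets\<^bsub>G\<^esub> H)"

text \<open>The representation of \<open>G\<close> induced by a representation \<open>\<sigma>\<close> of \<open>H\<close> of degree \<open>d\<close>: for a left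
  transversal \<open>t\<^sub>0, \<dots>, t\<^sub>k\<^sub>-\<^sub>1\<close> of \<open>H\<close>, the block matrix whose \<open>d \<times> d\<close> block at position \<open>(i, j)\<close> is
  \<open>\<sigma> (t\<^sub>i\<inverse> g t\<^sub>j)\<close>, where \<open>\<sigma>\<close> is extended by \<open>0\<close> outside \<open>H\<close>. The choice of the transversal
  only matters up to equivalence.\<close>

definition induced_rep ::
  "('g, 'b) monoid_scheme \<Rightarrow> 'g set \<Rightarrow> nat \<Rightarrow> ('g \<Rightarrow> 'a::field mat) \<Rightarrow> 'g \<Rightarrow> 'a mat" where
  "induced_rep G H d \<sigma> g =
     (let ts = (SOME ts. left_transversal G H ts); k = length ts
      in mat (k * d) (k * d) (\<lambda>(i, j).
           let x = inv\<^bsub>G\<^esub> (ts ! (i div d)) \<otimes>\<^bsub>G\<^esub> g \<otimes>\<^bsub>G\<^esub> (ts ! (j div d))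
           in if x \<in> H then \<sigma> x $$ (i mod d, j mod d) else 0))"

abbreviation trivial_rep :: "'g \<Rightarrow> 'a::field mat" where
  "trivial_rep \<equiv> (\<lambda>_. 1\<^sub>m 1)"


section \<open>Character fields, traces and Schur indices\<close>

text \<open>Prime fields are contained in every subfield, so over \<open>\<complex>\<close> this is the field generated over
  \<open>\<rat>\<close> by the values of the character.\<close>

definition character_field :: "('g, 'b) monoid_scheme \<Rightarrow> ('g \<Rightarrow> complex mat) \<Rightarrow> complex set" where
  "character_field G \<rho> = generate_field class_ring (character \<rho> ` carrier G)"

interpretation complex_over_rat: vector_space "\<lambda>(q::rat) (z::complex). of_rat q * z"
  by unfold_locales (simp_all add: algebra_simps of_rat_add of_rat_mult)

text \<open>For a number field \<open>K \<subseteq> \<complex>\<close> and \<open>x \<in> K\<close>, the trace over \<open>\<rat>\<close> of the \<open>\<rat>\<close>-linear map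
  \<open>K \<rightarrow> K, b \<mapsto> x b\<close>, computed in some \<open>\<rat>\<close>-basis of \<open>K\<close>.\<close>

definition field_trace :: "complex set \<Rightarrow> complex \<Rightarrow> rat" where
  "field_trace K x =
     (let B = (SOME B. complex_over_rat.independent B \<and> complex_over_rat.span B = K)
      in \<Sum>b\<in>B. complex_over_rat.representation B (x * b) b)"

definition realizable_over ::
  "('g, 'b) monoid_scheme \<Rightarrow> nat \<Rightarrow> ('g \<Rightarrow> complex mat) \<Rightarrow> complex set \<Rightarrow> bool" where
  "realizable_over G n \<rho> L \<longleftrightarrow>
     (\<exists>\<sigma>. is_rep G n \<sigma> \<and> equivalent_reps G n \<rho> \<sigma> \<and>
          (\<forall>g\<in>carrier G. elements_mat (\<sigma> g) \<subseteq> L))"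

text \<open>The Schur index over \<open>\<rat>\<close> is the least degree \<open>[L : K]\<close> of a field of definition \<open>L \<supseteq> K\<close>
  of the representation, where \<open>K\<close> is its character field.\<close>

definition schur_index :: "('g, 'b) monoid_scheme \<Rightarrow> nat \<Rightarrow> ('g \<Rightarrow> complex mat) \<Rightarrow> nat" where
  "schur_index G n \<rho> =
     (LEAST m. \<exists>L. subfield L class_ring \<and> character_field G \<rho> \<subseteq> L \<and>
                   ring.dimension class_ring m (character_field G \<rho>) L \<and>
                   realizable_over G n \<rho> L)"


section \<open>The group algebra and its modules\<close>

text \<open>The group algebra of a finite group: an element \<open>\<Sum>\<^sub>g a\<^sub>g g\<close> is the coefficient function
  \<open>g \<mapsto> a\<^sub>g\<close>, which is \<open>0\<close> outside the carrier.\<close>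

definition group_algebra :: "('g, 'b) monoid_scheme \<Rightarrow> ('g \<Rightarrow> 'a::field) ring" where
  "group_algebra G =
     \<lparr>carrier = {a. \<forall>g. g \<notin> carrier G \<longrightarrow> a g = 0},
      mult = (\<lambda>a b g. if g \<in> carrier G
                      then \<Sum>x\<in>carrier G. a x * b (inv\<^bsub>G\<^esub> x \<otimes>\<^bsub>G\<^esub> g) else 0),
      one = (\<lambda>g. if g = \<one>\<^bsub>G\<^esub> then 1 else 0),
      zero = (\<lambda>_. 0),
      add = (\<lambda>a b g. a g + b g)\<rparr>"

definition group_elem :: "'g \<Rightarrow> 'g \<Rightarrow> 'a::field" where
  "group_elem h g = (if g = h then 1 else 0)"

definition subgroup_average :: "'g set \<Rightarrow> 'g \<Rightarrow> 'a::field" where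
  "subgroup_average H g = (if g \<in> H then 1 / of_nat (card H) else 0)"

definition rational_idempotent ::
  "('g, 'b) monoid_scheme \<Rightarrow> nat \<Rightarrow> ('g \<Rightarrow> complex mat) \<Rightarrow> 'g \<Rightarrow> rat" where
  "rational_idempotent G n \<rho> g =
     (if g \<in> carrier G
      then of_nat n / of_nat (card (carrier G)) *
           field_trace (character_field G \<rho>) (character \<rho> (inv\<^bsub>G\<^esub> g))
      else 0)"

definition left_ideal :: "('r, 'b) ring_scheme \<Rightarrow> 'r \<Rightarrow> 'r set" where
  "left_ideal R f = {a \<otimes>\<^bsub>R\<^esub> f |a. a \<in> carrier R}"

text \<open>Left modules over a noncommutative ring \<open>R\<close> are represented by the library's module records;
  the fields \<open>mult\<close> and \<open>one\<close> of such a record are irrelevant. (The locale \<^locale>\<open>module\<close> itself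
  requires \<open>R\<close> to be commutative.)\<close>

definition left_ideal_module :: "('r, 'b) ring_scheme \<Rightarrow> 'r \<Rightarrow> ('r, 'r) module" where
  "left_ideal_module R f =
     \<lparr>carrier = left_ideal R f, mult = undefined, one = undefined,
      zero = \<zero>\<^bsub>R\<^esub>, add = (\<oplus>\<^bsub>R\<^esub>), smult = (\<otimes>\<^bsub>R\<^esub>)\<rparr>"

text \<open>The module over the group algebra given by a representation:
  \<open>(\<Sum>\<^sub>g a\<^sub>g g) v = \<Sum>\<^sub>g a\<^sub>g \<rho>(g) v\<close>.\<close>

definition rep_module ::
  "('g, 'b) monoid_scheme \<Rightarrow> nat \<Rightarrow> ('g \<Rightarrow> 'a::field mat) \<Rightarrow> ('g \<Rightarrow> 'a, 'a vec) module" where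
  "rep_module G n \<rho> =
     \<lparr>carrier = carrier_vec n, mult = undefined, one = undefined,
      zero = 0\<^sub>v n, add = (+),
      smult = (\<lambda>a v. vec n (\<lambda>i. \<Sum>g\<in>carrier G. a g * (\<rho> g *\<^sub>v v) $ i))\<rparr>"

text \<open>The direct sum of \<open>k\<close> copies of \<open>M\<close>.\<close>

definition module_power :: "nat \<Rightarrow> ('r, 'm) module \<Rightarrow> ('r, nat \<Rightarrow> 'm) module" where
  "module_power k M =
     \<lparr>carrier = {..<k} \<rightarrow>\<^sub>E carrier M, mult = undefined, one = undefined,
      zero = (\<lambda>i\<in>{..<k}. \<zero>\<^bsub>M\<^esub>),
      add = (\<lambda>u v. \<lambda>i\<in>{..<k}. u i \<oplus>\<^bsub>M\<^esub> v i),
      smult = (\<lambda>r v. \<lambda>i\<in>{..<k}. r \<odot>\<^bsub>M\<^esub> v i)\<rparr>"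

definition isomorphic_modules ::
  "('r, 'b) ring_scheme \<Rightarrow> ('r, 'm) module \<Rightarrow> ('r, 'n) module \<Rightarrow> bool" where
  "isomorphic_modules R M N \<longleftrightarrow>
     (\<exists>\<phi>\<in>LinearCombinations.module_hom R M N. bij_betw \<phi> (carrier M) (carrier N))"

end

(* Everything is reduced to linear algebra over the rationals, without Galois theory, semisimplicity
   or the structure theory of division algebras.

   Let chi be the character of V, K its field of values and tr the trace from K to Q. For each element b
   of a Q-basis of K, summing chi(g) times the b-coordinate of chi(g^-1) y over the group gives a functional
   of y that is K-linear; hence the sum of tr(chi(g^-1)) chi(g) over G is |G|. By Schur's lemma e acts
   as 1 on V, hence also on the irreducible W, and e is a central idempotent.

   Choose a nonzero homomorphism S from the complexification of W to V for which the field L of scalars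
   stabilizing the rational form S(Q^d) of V has maximal degree. Maximality forces every L-linear
   endomorphism of S(Q^d) to be a scalar in L, so that vectors of S(Q^d) independent over L stay independent
   over the complex numbers; thus S(Q^d) is a realization of V over L and d = n [L:Q]. Conversely e is a
   rational combination of matrix coefficients of W, so every realization of V over a field L' contains a
   copy of W, and d <= n [L':Q]. Hence d = n m [K:Q] for the Schur index m.

   For the same reason Q[G] f is a sum of copies of W, hence isomorphic to W^k, and k is found by computing
   the trace of right multiplication by f on Q[G]: it is k d, and it is also |G| f(1) = n [K:Q] dim V^H. *)

theory Submission
  imports Defs "Jordan_Normal_Form.Spectral_Radius" "Jordan_Normal_Form.Matrix_Kernel"
begin

section \<open>Matrices over a field\<close>

text \<open>In structural terms \<open>stab S\<close> is a subfield of the division algebra of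
  endomorphisms of \<open>W\<close>, placed inside the complex numbers by the choice of
  \<open>S\<close>, and what is needed is that a maximal subfield is its own centralizer. This is
  obtained directly: an endomorphism \<open>p\<close> commuting with \<open>stab S\<close> acts on
  the homomorphisms sharing the scalars of \<open>S\<close> and has an eigenvector \<open>S'\<close>
  among them; then \<open>stab S'\<close> contains \<open>stab S\<close> as well as the eigenvalue.
  Complex data must also yield rational equations. Expressing chi(g) through the entries of W(g)
  involves complex coefficients that may lie outside K, so the trace of K is extended to a Q-linear
  functional \<open>tr\<close> on all complex numbers, which can be applied to whole identities.
  This makes \<open>e\<close> a rational combination of entries of \<open>W\<close>, and it turns
  "\<open>e\<close> acts as 1 on \<open>V\<close>" into "\<open>e\<close> is idempotent". The order
  of the steps is constrained: K is merely a generated field, and the finiteness of its degree over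
  Q is read off from the splitting field built out of \<open>W\<close>. Hence the trace identity is
  first proved under the assumption that the chosen basis of K is finite.\<close>

definition mtrace :: "'a::comm_monoid_add mat \<Rightarrow> 'a" where
  "mtrace A = (\<Sum>i<dim_row A. A $$ (i, i))"

lemma character_eq_mtrace: "character \<rho> g = mtrace (\<rho> g)"
  by (simp add: character_def mtrace_def)

lemma index_mult_mat_sum:
  assumes "A \<in> carrier_mat r k" "B \<in> carrier_mat k c" "i < r" "j < c"
  shows "(A * B) $$ (i, j) = (\<Sum>l<k. A $$ (i, l) * B $$ (l, j))"
  using assms by (auto simp: scalar_prod_def lessThan_atLeast0 intro!: sum.cong)

lemma index_mult_mat_vec_sum:
  assumes "A \<in> carrier_mat r k" "v \<in> carrier_vec k" "i < r"
  shows "(A *\<^sub>v v) $ i = (\<Sum>l<k. A $$ (i, l) * v $ l)"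
  using assms by (auto simp: scalar_prod_def lessThan_atLeast0 intro!: sum.cong)

lemma mtrace_mult_comm:
  fixes A :: "'a::comm_semiring_0 mat"
  assumes "A \<in> carrier_mat n m" "B \<in> carrier_mat m n"
  shows "mtrace (A * B) = mtrace (B * A)"
proof -
  have "mtrace (A * B) = (\<Sum>i<n. \<Sum>j<m. A $$ (i, j) * B $$ (j, i))"
    using assms by (auto simp: mtrace_def index_mult_mat_sum[OF assms] simp del: index_mult_mat(1) intro!: sum.cong)
  also have "\<dots> = (\<Sum>j<m. \<Sum>i<n. B $$ (j, i) * A $$ (i, j))"
    by (subst sum.swap) (simp add: mult.commute)
  also have "\<dots> = mtrace (B * A)"
    using assms by (auto simp: mtrace_def index_mult_mat_sum[OF assms(2,1)] simp del: index_mult_mat(1) intro!: sum.cong)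
  finally show ?thesis .
qed

lemma mtrace_one: "mtrace (1\<^sub>m n :: 'a::semiring_1 mat) = of_nat n"
  by (simp add: mtrace_def)

lemma mtrace_smult: "mtrace (c \<cdot>\<^sub>m A) = c * mtrace (A :: 'a::semiring_0 mat)" if "A \<in> carrier_mat n n"
  using that by (auto simp: mtrace_def sum_distrib_left intro!: sum.cong)

text \<open>The size is part of the data because a matrix carries its own dimensions; in this way an
  empty sum still has a definite shape.\<close>

definition msum :: "nat \<Rightarrow> nat \<Rightarrow> 'x set \<Rightarrow> ('x \<Rightarrow> 'a::comm_monoid_add mat) \<Rightarrow> 'a mat" where
  "msum r c X F = mat r c (\<lambda>(i, j). \<Sum>x\<in>X. F x $$ (i, j))"

lemma msum_carrier [simp]: "msum r c X F \<in> carrier_mat r c"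
  by (simp add: msum_def)

lemma msum_dim [simp]: "dim_row (msum r c X F) = r" "dim_col (msum r c X F) = c"
  by (simp_all add: msum_def)

lemma msum_index [simp]:
  "i < r \<Longrightarrow> j < c \<Longrightarrow> msum r c X F $$ (i, j) = (\<Sum>x\<in>X. F x $$ (i, j))"
  by (simp add: msum_def)

lemma msum_cong: "(\<And>x. x \<in> X \<Longrightarrow> F x = F' x) \<Longrightarrow> msum r c X F = msum r c X F'"
  by (auto simp: msum_def intro!: cong_mat sum.cong)

lemma msum_reindex: "bij_betw h X Y \<Longrightarrow> msum r c X (\<lambda>x. F (h x)) = msum r c Y F"
  by (auto simp: msum_def intro!: cong_mat sum.reindex_bij_betw)

lemma mult_msum:
  assumes "A \<in> carrier_mat r k" "\<And>x. x \<in> X \<Longrightarrow> F x \<in> carrier_mat k c"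
  shows "A * msum k c X F = msum r c X (\<lambda>x. A * F x)"
proof (rule eq_matI)
  fix i j assume "i < dim_row (msum r c X (\<lambda>x. A * F x))" "j < dim_col (msum r c X (\<lambda>x. A * F x))"
  then have ij: "i < r" "j < c" by auto
  have "(A * msum k c X F) $$ (i, j) = (\<Sum>l<k. \<Sum>x\<in>X. A $$ (i, l) * F x $$ (l, j))"
    using ij assms by (subst index_mult_mat_sum[OF assms(1) msum_carrier]) (auto simp: sum_distrib_left)
  also have "\<dots> = (\<Sum>x\<in>X. (A * F x) $$ (i, j))"
    using ij by (subst sum.swap) (auto intro!: sum.cong simp: index_mult_mat_sum[OF assms])
  finally show "(A * msum k c X F) $$ (i, j) = msum r c X (\<lambda>x. A * F x) $$ (i, j)"
    using ij by simp
qed (use assms in auto)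

lemma msum_mult:
  assumes "B \<in> carrier_mat k c" "\<And>x. x \<in> X \<Longrightarrow> F x \<in> carrier_mat r k"
  shows "msum r k X F * B = msum r c X (\<lambda>x. F x * B)"
proof (rule eq_matI)
  fix i j assume "i < dim_row (msum r c X (\<lambda>x. F x * B))" "j < dim_col (msum r c X (\<lambda>x. F x * B))"
  then have ij: "i < r" "j < c" by auto
  have "(msum r k X F * B) $$ (i, j) = (\<Sum>l<k. \<Sum>x\<in>X. F x $$ (i, l) * B $$ (l, j))"
    using ij assms by (subst index_mult_mat_sum[OF msum_carrier assms(1)]) (auto simp: sum_distrib_right)
  also have "\<dots> = (\<Sum>x\<in>X. (F x * B) $$ (i, j))"
    using ij by (subst sum.swap) (auto intro!: sum.cong simp: index_mult_mat_sum[OF assms(2,1)])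
  finally show "(msum r k X F * B) $$ (i, j) = msum r c X (\<lambda>x. F x * B) $$ (i, j)"
    using ij by simp
qed (use assms in auto)

lemma mtrace_msum:
  assumes "\<And>x. x \<in> X \<Longrightarrow> F x \<in> carrier_mat n n"
  shows "mtrace (msum n n X F) = (\<Sum>x\<in>X. mtrace (F x))"
proof -
  have "mtrace (msum n n X F) = (\<Sum>i<n. \<Sum>x\<in>X. F x $$ (i, i))"
    by (simp add: mtrace_def)
  also have "\<dots> = (\<Sum>x\<in>X. mtrace (F x))"
    using assms by (subst sum.swap) (auto simp: mtrace_def intro!: sum.cong)
  finally show ?thesis .
qed

text \<open>Elementary matrices isolate single entries of the two outer factors. Summed over the
  group, this turns averaged matrices into relations between matrix coefficients.\<close>

lemma mult_mat_unit_mult: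
  fixes A :: "'a::comm_semiring_1 mat"
  assumes "A \<in> carrier_mat r n" "B \<in> carrier_mat d c" "i < n" "j < d" "k < r" "l < c"
  shows "(A * mat n d (\<lambda>(a, b). if a = i \<and> b = j then 1 else 0) * B) $$ (k, l) = A $$ (k, i) * B $$ (j, l)"
proof -
  define E where "E = mat n d (\<lambda>(a, b). if a = i \<and> b = j then 1 else (0::'a))"
  have E: "E \<in> carrier_mat n d" by (simp add: E_def)
  have AE: "(A * E) $$ (k, m) = (if m = j then A $$ (k, i) else 0)" if "m < d" for m
    using assms that unfolding index_mult_mat_sum[OF assms(1) E assms(5) that]
    by (auto simp: E_def if_distrib sum.delta cong: if_cong)
  show ?thesis
    unfolding E_def[symmetric] index_mult_mat_sum[OF mult_carrier_mat[OF assms(1) E] assms(2,5,6)]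
    using assms by (simp add: AE if_distrib[of "\<lambda>x. x * _"] sum.delta cong: if_cong)
qed

lemma sum_nat_pairs: "(\<Sum>a<n * r. F a) = (\<Sum>i<n. \<Sum>j<r. F (i * r + j :: nat))"
proof -
  have "(\<Sum>a = i * r..<i * r + r. F a) = (\<Sum>j<r. F (i * r + j))" for i
    using sum.shift_bounds_nat_ivl[of F 0 "i * r" r] by (simp add: lessThan_atLeast0 add.commute)
  then show ?thesis by (subst sum.nat_group[symmetric]) (auto intro!: sum.cong)
qed

lemma vec_eq_if_diff_zero:
  fixes u v :: "'a::group_add vec"
  assumes "u \<in> carrier_vec n" "v \<in> carrier_vec n" "u - v = 0\<^sub>v n"
  shows "u = v"
proof (rule eq_vecI)
  fix i assume "i < dim_vec v"
  moreover have "(u - v) $ i = 0" if "i < n" using assms(3) that by simp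
  ultimately show "u $ i = v $ i" using assms(1,2) by simp
qed (use assms in simp)

lemma invertible_mat_inverse:
  fixes A :: "'a::semiring_1 mat"
  assumes "A \<in> carrier_mat n n" "invertible_mat A"
  obtains B where "B \<in> carrier_mat n n" "A * B = 1\<^sub>m n" "B * A = 1\<^sub>m n"
proof -
  obtain B where i: "inverts_mat A B" "inverts_mat B A" using assms(2) by (auto simp: invertible_mat_def)
  then have "B \<in> carrier_mat n n"
    using assms(1) unfolding inverts_mat_def by (metis carrier_matD carrier_matI index_mult_mat(2,3) index_one_mat(2,3))
  then show ?thesis using i assms(1) that by (auto simp: inverts_mat_def)
qed

lemma mult_mat_vec_zero: "A \<in> carrier_mat r c \<Longrightarrow> A *\<^sub>v 0\<^sub>v c = 0\<^sub>v r"
  for A :: "'a::semiring_0 mat"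
  by (auto intro!: eq_vecI simp: scalar_prod_def)

lemma col_mult_unit_vec:
  fixes A :: "'a::semiring_1 mat"
  assumes "A \<in> carrier_mat r c" "j < c"
  shows "A *\<^sub>v unit_vec c j = col A j"
  using assms by (intro eq_vecI) (auto simp: unit_vec_def scalar_prod_def if_distrib sum.delta cong: if_cong)

lemma mat_eq_zero_if_kills:
  fixes A :: "'a::semiring_1 mat"
  assumes "A \<in> carrier_mat r c" "\<And>v. v \<in> carrier_vec c \<Longrightarrow> A *\<^sub>v v = 0\<^sub>v r"
  shows "A = 0\<^sub>m r c"
proof (rule mat_col_eqI)
  fix i assume "i < dim_col (0\<^sub>m r c :: 'a mat)"
  then show "col A i = col (0\<^sub>m r c) i"
    using assms(2)[of "unit_vec c i"] assms(1) by (simp add: col_mult_unit_vec)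
qed (use assms in auto)

text \<open>Padding \<open>A\<close> with zero rows gives a square matrix whose transpose kills the
  last unit vector, so its determinant vanishes and it has a kernel vector.\<close>

lemma wide_mat_kernel:
  fixes A :: "'a::field mat"
  assumes "A \<in> carrier_mat r c" "r < c"
  shows "\<exists>v\<in>carrier_vec c. v \<noteq> 0\<^sub>v c \<and> A *\<^sub>v v = 0\<^sub>v r"
proof -
  define B where "B = mat c c (\<lambda>(i, j). if i < r then A $$ (i, j) else 0)"
  have B: "B \<in> carrier_mat c c" "B\<^sup>T \<in> carrier_mat c c" by (auto simp: B_def)
  have "B\<^sup>T *\<^sub>v unit_vec c (c - 1) = 0\<^sub>v c"
    using assms B by (subst col_mult_unit_vec[OF B(2)]) (auto intro!: eq_vecI simp: B_def)
  then have "det B\<^sup>T = 0"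
    using assms by (subst det_0_iff_vec_prod_zero[OF B(2)]) (auto intro!: bexI exI[of _ "unit_vec c (c - 1)"])
  then have "det B = 0" using det_transpose[OF B(1)] by simp
  then obtain v where v: "v \<in> carrier_vec c" "v \<noteq> 0\<^sub>v c" "B *\<^sub>v v = 0\<^sub>v c"
    using det_0_iff_vec_prod_zero[OF B(1)] by blast
  have "(A *\<^sub>v v) $ i = 0" if "i < r" for i
  proof -
    have "(A *\<^sub>v v) $ i = (B *\<^sub>v v) $ i"
      using that assms v B
      by (subst index_mult_mat_vec_sum[OF assms(1) v(1)], simp,
          subst index_mult_mat_vec_sum[OF B(1) v(1)]) (auto simp: B_def)
    then show ?thesis using v that assms by simp
  qed
  then have "A *\<^sub>v v = 0\<^sub>v r" using assms by (intro eq_vecI) auto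
  then show ?thesis using v by blast
qed

text \<open>The bounds on \<open>d\<close>, on lengths of independent families and on numbers of
  copies of \<open>W\<close> all come from this count, applied to matrices assembled from
  coordinates.\<close>

lemma injective_mat_dim_le:
  fixes A :: "'a::field mat"
  assumes "A \<in> carrier_mat r c" "\<And>v. v \<in> carrier_vec c \<Longrightarrow> A *\<^sub>v v = 0\<^sub>v r \<Longrightarrow> v = 0\<^sub>v c"
  shows "c \<le> r"
  using wide_mat_kernel[OF assms(1)] assms(2) by (meson not_le)

lemma injective_square_mat_inverse:
  fixes A :: "'a::field mat"
  assumes A: "A \<in> carrier_mat n n"
    and inj: "\<And>v. v \<in> carrier_vec n \<Longrightarrow> A *\<^sub>v v = 0\<^sub>v n \<Longrightarrow> v = 0\<^sub>v n"
  obtains B where "B \<in> carrier_mat n n" "A * B = 1\<^sub>m n" "B * A = 1\<^sub>m n"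
proof -
  have "det A \<noteq> 0" using det_0_iff_vec_prod_zero[OF A] inj by blast
  then have "A \<in> Units (ring_mat TYPE('a) n ())" by (rule det_non_zero_imp_unit[OF A])
  then show ?thesis using that by (auto simp: Units_def ring_mat_simps)
qed

text \<open>The Gram matrix of the columns is invertible.\<close>

lemma injective_complex_mat_left_inverse:
  fixes T :: "complex mat"
  assumes T: "T \<in> carrier_mat r c"
    and inj: "\<And>v. v \<in> carrier_vec c \<Longrightarrow> T *\<^sub>v v = 0\<^sub>v r \<Longrightarrow> v = 0\<^sub>v c"
  obtains X where "X \<in> carrier_mat c r" "X * T = 1\<^sub>m c"
proof -
  define T' where "T' = mat c r (\<lambda>(i, j). cnj (T $$ (j, i)))"
  have T': "T' \<in> carrier_mat c r" by (simp add: T'_def)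
  have TT: "T' * T \<in> carrier_mat c c" using T T' by auto
  have "v = 0\<^sub>v c" if v: "v \<in> carrier_vec c" and 0: "(T' * T) *\<^sub>v v = 0\<^sub>v c" for v
  proof -
    define w where "w = T *\<^sub>v v"
    have w: "w \<in> carrier_vec r" using T v by (simp add: w_def)
    have T'w: "T' *\<^sub>v w = 0\<^sub>v c" using 0 T T' v by (simp add: w_def)
    have "(\<Sum>j<r. cnj (w $ j) * w $ j) = (\<Sum>j<r. \<Sum>i<c. cnj (T $$ (j, i)) * cnj (v $ i) * w $ j)"
      using T v by (intro sum.cong refl) (auto simp: w_def index_mult_mat_vec_sum[OF T v] sum_distrib_right simp del: index_mult_mat_vec)
    also have "\<dots> = (\<Sum>i<c. cnj (v $ i) * (\<Sum>j<r. T' $$ (i, j) * w $ j))"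
      by (subst sum.swap) (auto simp: T'_def sum_distrib_left intro!: sum.cong)
    also have "\<dots> = (\<Sum>i<c. cnj (v $ i) * (T' *\<^sub>v w) $ i)"
      by (intro sum.cong refl) (auto simp: index_mult_mat_vec_sum[OF T' w])
    also have "\<dots> = 0" by (simp add: T'w)
    finally have "(\<Sum>j<r. complex_of_real ((cmod (w $ j))\<^sup>2)) = 0"
      by (simp only: complex_norm_square mult.commute)
    then have "(\<Sum>j<r. (cmod (w $ j))\<^sup>2) = 0"
      by (simp only: of_real_sum[symmetric] of_real_eq_0_iff)
    then have "\<forall>j<r. w $ j = 0" by (subst (asm) sum_nonneg_eq_0_iff) auto
    then have "w = 0\<^sub>v r" using w by (intro eq_vecI) auto
    then show ?thesis using inj v by (simp add: w_def)
  qed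
  then obtain B where B: "B \<in> carrier_mat c c" "B * (T' * T) = 1\<^sub>m c"
    using injective_square_mat_inverse[OF TT] by metis
  show ?thesis
  proof
    show "B * T' \<in> carrier_mat c r" using B T' by auto
    show "B * T' * T = 1\<^sub>m c" using B T' T by simp
  qed
qed

lemma injectiveI_kernel:
  fixes T :: "'a::ring_1 mat"
  assumes "T \<in> carrier_mat r c" "inj_on (\<lambda>v. T *\<^sub>v v) (carrier_vec c)" "v \<in> carrier_vec c" "T *\<^sub>v v = 0\<^sub>v r"
  shows "v = 0\<^sub>v c"
  using inj_onD[OF assms(2), of v "0\<^sub>v c"] assms mult_mat_vec_zero[OF assms(1)] by simp

section \<open>Representations and Schur's lemma\<close>

locale finite_group = group G for G :: "('g, 'b) monoid_scheme" (structure) +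
  assumes fin [simp]: "finite (carrier G)"
begin

definition ord_G :: nat where "ord_G = card (carrier G)"

lemma ord_G_pos: "ord_G > 0"
  unfolding ord_G_def using fin one_closed by (auto simp: card_gt_0_iff)

lemma bij_mult_left: "h \<in> carrier G \<Longrightarrow> bij_betw (\<lambda>g. h \<otimes> g) (carrier G) (carrier G)"
  by (rule bij_betw_byWitness[of _ "\<lambda>g. inv h \<otimes> g"]) (auto simp: m_assoc[symmetric])

lemma bij_mult_right: "h \<in> carrier G \<Longrightarrow> bij_betw (\<lambda>g. g \<otimes> h) (carrier G) (carrier G)"
  by (rule bij_betw_byWitness[of _ "\<lambda>g. g \<otimes> inv h"]) (auto simp: m_assoc)

lemma bij_inv: "bij_betw (\<lambda>g. inv g) (carrier G) (carrier G)"
  by (rule bij_betw_byWitness[of _ "\<lambda>g. inv g"]) auto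

lemma sum_mult_left: "h \<in> carrier G \<Longrightarrow> (\<Sum>g\<in>carrier G. F (h \<otimes> g)) = sum F (carrier G)"
  by (rule sum.reindex_bij_betw[OF bij_mult_left])

lemma sum_mult_right: "h \<in> carrier G \<Longrightarrow> (\<Sum>g\<in>carrier G. F (g \<otimes> h)) = sum F (carrier G)"
  by (rule sum.reindex_bij_betw[OF bij_mult_right])

lemma sum_inv: "(\<Sum>g\<in>carrier G. F (inv g)) = sum F (carrier G)"
  by (rule sum.reindex_bij_betw[OF bij_inv])

end

lemma is_rep_carrier: "is_rep G n \<rho> \<Longrightarrow> g \<in> carrier G \<Longrightarrow> \<rho> g \<in> carrier_mat n n"
  by (simp add: is_rep_def)

lemma is_rep_one: "is_rep G n \<rho> \<Longrightarrow> \<rho> \<one>\<^bsub>G\<^esub> = 1\<^sub>m n"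
  by (simp add: is_rep_def)

lemma is_rep_mult:
  "is_rep G n \<rho> \<Longrightarrow> g \<in> carrier G \<Longrightarrow> h \<in> carrier G \<Longrightarrow> \<rho> (g \<otimes>\<^bsub>G\<^esub> h) = \<rho> g * \<rho> h"
  by (simp add: is_rep_def)

lemma irreducible_repD:
  assumes "irreducible_rep G n \<rho>"
  shows "is_rep G n \<rho>" "n > 0"
  using assms by (auto simp: irreducible_rep_def)

lemma irreducible_rep_dichotomy:
  fixes \<rho> :: "'g \<Rightarrow> 'a::field mat"
  assumes irr: "irreducible_rep G n \<rho>"
    and U: "U \<subseteq> carrier_vec n" "0\<^sub>v n \<in> U"
    and add: "\<And>u v. u \<in> U \<Longrightarrow> v \<in> U \<Longrightarrow> u + v \<in> U"
    and smult: "\<And>c u. u \<in> U \<Longrightarrow> c \<cdot>\<^sub>v u \<in> U"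
    and inv: "\<And>g u. g \<in> carrier G \<Longrightarrow> u \<in> U \<Longrightarrow> \<rho> g *\<^sub>v u \<in> U"
  shows "U = {0\<^sub>v n} \<or> U = carrier_vec n"
proof -
  interpret vec_space "TYPE('a)" n .
  have "VectorSpace.subspace class_ring U V"
    using U add smult
    by (auto simp: VectorSpace.subspace_def submodule_def module_vec_simps module_axioms vectorspace_axioms)
  then show ?thesis using irr inv unfolding irreducible_rep_def by blast
qed

text \<open>The kernel of \<open>S\<close> is an invariant subspace, and it is not the whole space
  because \<open>S\<close> is nonzero.\<close>

lemma irreducible_rep_injective:
  fixes \<rho> :: "'g \<Rightarrow> 'a::field mat"
  assumes irr: "irreducible_rep G n \<rho>"
    and S: "S \<in> carrier_mat r n" "S \<noteq> 0\<^sub>m r n"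
    and comm: "\<And>g. g \<in> carrier G \<Longrightarrow> S * \<rho> g = \<sigma> g * S"
    and \<sigma>: "\<And>g. g \<in> carrier G \<Longrightarrow> \<sigma> g \<in> carrier_mat r r"
    and v: "v \<in> carrier_vec n" "S *\<^sub>v v = 0\<^sub>v r"
  shows "v = 0\<^sub>v n"
proof -
  define U where "U = {v \<in> carrier_vec n. S *\<^sub>v v = 0\<^sub>v r}"
  note rep = irreducible_repD[OF irr]
  have "U = {0\<^sub>v n} \<or> U = carrier_vec n"
  proof (rule irreducible_rep_dichotomy[OF irr])
    fix g u assume gu: "g \<in> carrier G" "u \<in> U"
    have \<rho>g: "\<rho> g \<in> carrier_mat n n" and u: "u \<in> carrier_vec n"
      using gu is_rep_carrier[OF rep(1)] by (auto simp: U_def)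
    have "S *\<^sub>v (\<rho> g *\<^sub>v u) = (S * \<rho> g) *\<^sub>v u"
      by (rule assoc_mult_mat_vec[symmetric, OF S(1) \<rho>g u])
    also have "\<dots> = \<sigma> g *\<^sub>v (S *\<^sub>v u)"
      unfolding comm[OF gu(1)] by (rule assoc_mult_mat_vec) (use gu S \<sigma> in \<open>auto simp: U_def\<close>)
    also have "\<dots> = 0\<^sub>v r" using gu \<sigma> by (auto simp: U_def mult_mat_vec_zero)
    finally show "\<rho> g *\<^sub>v u \<in> U"
      using mult_mat_vec_carrier[OF \<rho>g u] by (auto simp: U_def)
  next
    fix u v assume "u \<in> U" "v \<in> U" then show "u + v \<in> U"
      using S by (auto simp: U_def mult_add_distrib_mat_vec)
  next
    fix c u assume "u \<in> U" then show "c \<cdot>\<^sub>v u \<in> U"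
      using S by (auto simp: U_def mult_mat_vec intro!: eq_vecI)
  qed (use S in \<open>auto simp: U_def mult_mat_vec_zero\<close>)
  moreover have "U \<noteq> carrier_vec n"
    using mat_eq_zero_if_kills[OF S(1)] S(2) by (auto simp: U_def)
  ultimately show ?thesis using v by (auto simp: U_def)
qed

text \<open>The image is invariant and nonzero, hence everything; preimages of the unit vectors are
  the columns of the right inverse.\<close>

lemma irreducible_rep_surjective:
  fixes \<rho> :: "'g \<Rightarrow> 'a::field mat"
  assumes irr: "irreducible_rep G n \<rho>"
    and S: "S \<in> carrier_mat n r" "S \<noteq> 0\<^sub>m n r"
    and comm: "\<And>g. g \<in> carrier G \<Longrightarrow> S * \<sigma> g = \<rho> g * S"
    and \<sigma>: "\<And>g. g \<in> carrier G \<Longrightarrow> \<sigma> g \<in> carrier_mat r r"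
  obtains X where "X \<in> carrier_mat r n" "S * X = 1\<^sub>m n"
proof -
  define U where "U = (\<lambda>x. S *\<^sub>v x) ` carrier_vec r"
  note rep = irreducible_repD[OF irr]
  have "U = {0\<^sub>v n} \<or> U = carrier_vec n"
  proof (rule irreducible_rep_dichotomy[OF irr])
    fix g u assume gu: "g \<in> carrier G" "u \<in> U"
    then obtain x where x: "x \<in> carrier_vec r" "u = S *\<^sub>v x" by (auto simp: U_def)
    have "\<rho> g *\<^sub>v u = (\<rho> g * S) *\<^sub>v x"
      unfolding x(2) by (rule assoc_mult_mat_vec[symmetric, OF is_rep_carrier[OF rep(1) gu(1)] S(1) x(1)])
    also have "\<dots> = S *\<^sub>v (\<sigma> g *\<^sub>v x)"
      unfolding comm[OF gu(1), symmetric] by (rule assoc_mult_mat_vec[OF S(1) \<sigma>[OF gu(1)] x(1)])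
    finally show "\<rho> g *\<^sub>v u \<in> U"
      unfolding U_def using mult_mat_vec_carrier[OF \<sigma>[OF gu(1)] x(1)] by simp
  next
    fix u v assume "u \<in> U" "v \<in> U" then show "u + v \<in> U"
      using S by (auto simp: U_def mult_add_distrib_mat_vec[symmetric])
  next
    fix c u assume "u \<in> U" then show "c \<cdot>\<^sub>v u \<in> U"
      using S by (auto simp: U_def mult_mat_vec[symmetric])
  next
    have "S *\<^sub>v 0\<^sub>v r = 0\<^sub>v n" using S(1) by (rule mult_mat_vec_zero)
    then show "0\<^sub>v n \<in> U" unfolding U_def by (intro image_eqI[of _ _ "0\<^sub>v r"]) auto
  qed (use S in \<open>auto simp: U_def\<close>)
  moreover have "U \<noteq> {0\<^sub>v n}"
    using mat_eq_zero_if_kills[OF S(1)] S(2) by (auto simp: U_def)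
  ultimately have U_eq: "U = carrier_vec n" by simp
  have "\<exists>x. x \<in> carrier_vec r \<and> S *\<^sub>v x = unit_vec n i" for i
  proof -
    have "unit_vec n i \<in> U" unfolding U_eq by simp
    then show ?thesis unfolding U_def by auto
  qed
  then have "\<exists>x. \<forall>i. x i \<in> carrier_vec r \<and> S *\<^sub>v x i = unit_vec n i" by (intro choice allI)
  then obtain x where x: "\<And>i. x i \<in> carrier_vec r" "\<And>i. S *\<^sub>v x i = unit_vec n i" by auto
  define X where "X = mat r n (\<lambda>(i, j). x j $ i)"
  have col: "col X j = x j" if "j < n" for j
    using that x(1)[of j] by (auto simp: X_def)
  have "S * X = 1\<^sub>m n"
  proof (rule mat_col_eqI)
    fix j assume "j < dim_col (1\<^sub>m n)"
    then have j: "j < n" by simp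
    have "col (S * X) j = S *\<^sub>v col X j"
      using S j by (auto simp: X_def intro!: eq_vecI)
    then show "col (S * X) j = col (1\<^sub>m n) j" using j col x by simp
  qed (use S in \<open>auto simp: X_def\<close>)
  then show ?thesis using that[of X] by (auto simp: X_def)
qed

text \<open>An eigenvalue \<open>c\<close> of \<open>T\<close> exists over the complex numbers. Then
  \<open>T - c\<close> still commutes with the group but has a nonzero kernel, so it must
  vanish.\<close>

lemma schur_scalar:
  fixes \<rho> :: "'g \<Rightarrow> complex mat"
  assumes irr: "irreducible_rep G n \<rho>"
    and T: "T \<in> carrier_mat n n"
    and comm: "\<And>g. g \<in> carrier G \<Longrightarrow> T * \<rho> g = \<rho> g * T"
  obtains c where "T = c \<cdot>\<^sub>m 1\<^sub>m n"
proof -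
  note rep = irreducible_repD[OF irr]
  obtain c where "c \<in> spectrum T" using spectrum_non_empty[OF T rep(2)] by blast
  then obtain v where v: "v \<in> carrier_vec n" "v \<noteq> 0\<^sub>v n" "T *\<^sub>v v = c \<cdot>\<^sub>v v"
    using T by (auto simp: spectrum_def eigenvalue_def eigenvector_def)
  define S where "S = T - c \<cdot>\<^sub>m 1\<^sub>m n"
  have S: "S \<in> carrier_mat n n" using T by (auto simp: S_def)
  have Sv: "S *\<^sub>v v = 0\<^sub>v n"
    using T v unfolding S_def
    by (subst minus_mult_distrib_mat_vec[OF T]) (auto intro!: eq_vecI)
  have S_comm: "S * \<rho> g = \<rho> g * S" if "g \<in> carrier G" for g
  proof -
    note g = is_rep_carrier[OF rep(1) that]
    have "S * \<rho> g = T * \<rho> g - c \<cdot>\<^sub>m 1\<^sub>m n * \<rho> g"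
      unfolding S_def by (rule minus_mult_distrib_mat) (use T g in auto)
    also have "\<dots> = \<rho> g * T - \<rho> g * (c \<cdot>\<^sub>m 1\<^sub>m n)"
      using g by (simp add: comm[OF that] mult_smult_assoc_mat[of _ n n] mult_smult_distrib[OF g one_carrier_mat])
    also have "\<dots> = \<rho> g * S"
      unfolding S_def by (rule mult_minus_distrib_mat[symmetric]) (use T g in auto)
    finally show ?thesis .
  qed
  have "S = 0\<^sub>m n n"
  proof (rule ccontr)
    assume "S \<noteq> 0\<^sub>m n n"
    then have "v = 0\<^sub>v n"
      by (rule irreducible_rep_injective[OF irr S _ S_comm is_rep_carrier[OF rep(1)] v(1) Sv])
    then show False using v(2) by simp
  qed
  then have "S $$ (i, j) = 0" if "i < n" "j < n" for i j using that by simp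
  then have "T = c \<cdot>\<^sub>m 1\<^sub>m n"
    using T unfolding S_def by (intro eq_matI) auto
  then show ?thesis by (rule that)
qed

section \<open>Characters and the trace of the character field\<close>

context finite_group
begin

lemma rep_mult_inv:
  assumes "is_rep G n \<rho>" "g \<in> carrier G"
  shows "\<rho> g * \<rho> (inv g) = 1\<^sub>m n" "\<rho> (inv g) * \<rho> g = 1\<^sub>m n"
  using is_rep_mult[OF assms(1,2), of "inv g"] is_rep_mult[OF assms(1) _ assms(2), of "inv g"]
    is_rep_one[OF assms(1)] assms(2) by simp_all

text \<open>Replacing g by h g in the sum carries \<open>\<rho> h\<close> to the other side as
  \<open>\<sigma> h\<close>. The lemma makes equivariant maps out of arbitrary matrices:
  endomorphisms of \<open>V\<close>, maps from \<open>W\<close> back to \<open>V\<close>, and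
  embeddings of \<open>W\<close> into a realization of \<open>V\<close>.\<close>

lemma average_intertwines:
  assumes \<rho>: "is_rep G n \<rho>" and \<sigma>: "is_rep G m \<sigma>" and X: "X \<in> carrier_mat m n" and h: "h \<in> carrier G"
  shows "msum m n (carrier G) (\<lambda>g. \<sigma> g * X * \<rho> (inv g)) * \<rho> h =
    \<sigma> h * msum m n (carrier G) (\<lambda>g. \<sigma> g * X * \<rho> (inv g))"
proof -
  note c = is_rep_carrier[OF \<rho>] is_rep_carrier[OF \<sigma>]
  have car: "\<sigma> g * X * \<rho> (inv g) \<in> carrier_mat m n" if "g \<in> carrier G" for g
    by (intro mult_carrier_mat[of _ m n] mult_carrier_mat[of _ m m] c X inv_closed that)
  have "msum m n (carrier G) (\<lambda>g. \<sigma> g * X * \<rho> (inv g)) * \<rho> h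
      = msum m n (carrier G) (\<lambda>g. \<sigma> g * X * \<rho> (inv g) * \<rho> h)"
    by (rule msum_mult) (use c(1)[OF h] car in auto)
  also have "\<dots> = msum m n (carrier G) (\<lambda>g. \<sigma> (h \<otimes> g) * X * \<rho> (inv (h \<otimes> g)) * \<rho> h)"
    by (rule msum_reindex[OF bij_mult_left[OF h], symmetric])
  also have "\<dots> = msum m n (carrier G) (\<lambda>g. \<sigma> h * (\<sigma> g * X * \<rho> (inv g)))"
  proof (rule msum_cong)
    fix g assume g: "g \<in> carrier G"
    have 1: "\<rho> (inv (h \<otimes> g)) = \<rho> (inv g) * \<rho> (inv h)"
      using g h by (simp add: inv_mult_group is_rep_mult[OF \<rho>])
    have 2: "\<rho> (inv (h \<otimes> g)) * \<rho> h = \<rho> (inv g)"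
    proof -
      have "\<rho> (inv (h \<otimes> g)) * \<rho> h = \<rho> (inv g) * (\<rho> (inv h) * \<rho> h)"
        unfolding 1 by (rule assoc_mult_mat[of _ n n _ n _ n]) (intro c inv_closed g h)+
      then show ?thesis
        using c(1)[OF inv_closed[OF g]] by (simp add: rep_mult_inv[OF \<rho> h])
    qed
    have 3: "\<sigma> (h \<otimes> g) * X = \<sigma> h * (\<sigma> g * X)"
      unfolding is_rep_mult[OF \<sigma> h g] by (rule assoc_mult_mat[of _ m m _ m _ n]) (intro c X g h)+
    have "\<sigma> (h \<otimes> g) * X * \<rho> (inv (h \<otimes> g)) * \<rho> h = \<sigma> (h \<otimes> g) * X * (\<rho> (inv (h \<otimes> g)) * \<rho> h)"
      by (rule assoc_mult_mat[of _ m n _ n _ n])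
        (intro mult_carrier_mat[of _ m m] c X inv_closed m_closed g h)+
    also have "\<dots> = \<sigma> h * (\<sigma> g * X * \<rho> (inv g))"
      unfolding 2 unfolding 3
      by (rule assoc_mult_mat[of _ m m _ n _ n]) (intro mult_carrier_mat[of _ m m] c X inv_closed g h)+
    finally show "\<sigma> (h \<otimes> g) * X * \<rho> (inv (h \<otimes> g)) * \<rho> h = \<sigma> h * (\<sigma> g * X * \<rho> (inv g))" .
  qed
  also have "\<dots> = \<sigma> h * msum m n (carrier G) (\<lambda>g. \<sigma> g * X * \<rho> (inv g))"
    by (rule mult_msum[symmetric]) (use c(2)[OF h] car in auto)
  finally show ?thesis .
qed

lemma character_conj:
  fixes \<rho> :: "'g \<Rightarrow> 'a::field mat"
  assumes \<rho>: "is_rep G n \<rho>" and "g \<in> carrier G" "h \<in> carrier G"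
  shows "character \<rho> (g \<otimes> h) = character \<rho> (h \<otimes> g)"
  unfolding character_eq_mtrace
  using assms by (simp add: is_rep_mult[OF \<rho>] mtrace_mult_comm[OF is_rep_carrier[OF \<rho>] is_rep_carrier[OF \<rho>]])

end

locale complex_irrep = finite_group G for G :: "('g, 'b) monoid_scheme" (structure) +
  fixes n :: nat and V :: "'g \<Rightarrow> complex mat"
  assumes irr: "irreducible_rep G n V"
begin

lemma rep: "is_rep G n V" and n_pos: "n > 0"
  using irreducible_repD[OF irr] by auto

lemmas V_carrier = is_rep_carrier[OF rep]

abbreviation \<chi> where "\<chi> \<equiv> character V"

lemma scalar_eq_trace:
  assumes "T \<in> carrier_mat n n" "\<And>g. g \<in> carrier G \<Longrightarrow> T * V g = V g * T"
  shows "T = (mtrace T / of_nat n) \<cdot>\<^sub>m 1\<^sub>m n"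
proof -
  obtain c where c: "T = c \<cdot>\<^sub>m 1\<^sub>m n" using schur_scalar[OF irr assms] by blast
  have "mtrace T = c * of_nat n" unfolding c by (simp add: mtrace_smult[of _ n] mtrace_one)
  then show ?thesis using c n_pos by simp
qed

lemma average_scalar:
  assumes X: "X \<in> carrier_mat n n"
  shows "msum n n (carrier G) (\<lambda>g. V g * X * V (inv g)) = (of_nat ord_G * mtrace X / of_nat n) \<cdot>\<^sub>m 1\<^sub>m n"
proof -
  have car: "V g * X * V (inv g) \<in> carrier_mat n n" if "g \<in> carrier G" for g
    using V_carrier[OF that] V_carrier[OF inv_closed[OF that]] X by auto
  have "mtrace (V g * X * V (inv g)) = mtrace X" if g: "g \<in> carrier G" for g
  proof -
    note c = V_carrier[OF g] V_carrier[OF inv_closed[OF g]]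
    have "mtrace (V g * X * V (inv g)) = mtrace (V (inv g) * (V g * X))"
      by (rule mtrace_mult_comm[of _ n n]) (use c X in auto)
    also have "V (inv g) * (V g * X) = V (inv g) * V g * X"
      by (rule assoc_mult_mat[symmetric, of _ n n _ n _ n]) (use c X in auto)
    finally show ?thesis using X by (simp add: rep_mult_inv[OF rep g])
  qed
  then have "mtrace (msum n n (carrier G) (\<lambda>g. V g * X * V (inv g))) = of_nat ord_G * mtrace X"
    using car by (simp add: mtrace_msum ord_G_def)
  then show ?thesis
    using scalar_eq_trace[OF msum_carrier average_intertwines[OF rep rep X]] by metis
qed

text \<open>The class sum of \<open>c\<close> acts on \<open>V\<close> as the scalar of its central
  character; multiplying by \<open>V g\<close> and taking traces gives the identity. It is the sole
  source of linearity over the character field in \<open>trace_character_inner\<close>.\<close>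

lemma class_sum:
  assumes c: "c \<in> carrier G" and g: "g \<in> carrier G"
  shows "of_nat n * (\<Sum>t\<in>carrier G. \<chi> (t \<otimes> c \<otimes> inv t \<otimes> g)) = of_nat ord_G * \<chi> c * \<chi> g"
proof -
  have car: "V t * V c * V (inv t) \<in> carrier_mat n n" if "t \<in> carrier G" for t
    using V_carrier[OF that] V_carrier[OF inv_closed[OF that]] V_carrier[OF c] by auto
  have "(\<Sum>t\<in>carrier G. \<chi> (t \<otimes> c \<otimes> inv t \<otimes> g)) = (\<Sum>t\<in>carrier G. mtrace (V t * V c * V (inv t) * V g))"
    using c g by (intro sum.cong refl) (simp add: character_eq_mtrace is_rep_mult[OF rep])
  also have "\<dots> = mtrace (msum n n (carrier G) (\<lambda>t. V t * V c * V (inv t)) * V g)"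
    using car V_carrier[OF g] by (subst msum_mult[of _ n n]) (auto intro!: mtrace_msum[symmetric] mult_carrier_mat[OF car])
  also have "\<dots> = of_nat ord_G * \<chi> c / of_nat n * \<chi> g"
    using V_carrier[OF g] by (simp add: average_scalar[OF V_carrier[OF c]] mult_smult_assoc_mat[of _ n n]
        mtrace_smult[of _ n] character_eq_mtrace)
  finally show ?thesis using n_pos by simp
qed

text \<open>Schur orthogonality: the (i, j) entry of the average of the elementary matrix
  \<open>E i j\<close> is the sum of products of the i-th and j-th diagonal entries, while the
  average itself is a scalar proportional to the trace of \<open>E i j\<close>.\<close>

lemma character_norm: "(\<Sum>g\<in>carrier G. \<chi> g * \<chi> (inv g)) = of_nat ord_G"
proof -
  define E where "E i j = mat n n (\<lambda>(a, b). if a = i \<and> b = j then 1 else (0::complex))" for i j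
  have E: "E i j \<in> carrier_mat n n" for i j by (simp add: E_def)
  have trE: "mtrace (E i j) = (if i = j then 1 else 0)" if "i < n" "j < n" for i j
    using that by (auto simp: mtrace_def E_def sum.delta)
  have entry: "(V g * E i j * V (inv g)) $$ (i, j) = V g $$ (i, i) * V (inv g) $$ (j, j)"
    if g: "g \<in> carrier G" and ij: "i < n" "j < n" for g i j
  proof -
    show ?thesis
      unfolding E_def by (rule mult_mat_unit_mult[OF V_carrier[OF g] V_carrier[OF inv_closed[OF g]] ij ij])
  qed
  have "(\<Sum>g\<in>carrier G. \<chi> g * \<chi> (inv g))
      = (\<Sum>g\<in>carrier G. \<Sum>i<n. \<Sum>j<n. V g $$ (i, i) * V (inv g) $$ (j, j))"
    using carrier_matD(1)[OF V_carrier] inv_closed by (intro sum.cong refl) (simp add: character_def sum_product)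
  also have "\<dots> = (\<Sum>i<n. \<Sum>j<n. \<Sum>g\<in>carrier G. V g $$ (i, i) * V (inv g) $$ (j, j))"
    by (subst sum.swap, rule sum.cong[OF refl], subst sum.swap, rule refl)
  also have "\<dots> = (\<Sum>i<n. \<Sum>j<n. (msum n n (carrier G) (\<lambda>g. V g * E i j * V (inv g))) $$ (i, j))"
    by (intro sum.cong refl) (simp add: entry)
  also have "\<dots> = (\<Sum>i<n. \<Sum>j<n. if i = j then of_nat ord_G / of_nat n else 0)"
    by (intro sum.cong refl) (auto simp: average_scalar[OF E] trE)
  also have "\<dots> = of_nat ord_G" using n_pos by (simp add: sum.delta)
  finally show ?thesis .
qed

section \<open>The character field and a rational-linear extension of its trace\<close>

definition K where "K = character_field G V"

lemma chi_in_K: "g \<in> carrier G \<Longrightarrow> \<chi> g \<in> K"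
  by (auto simp: K_def character_field_def intro: generate_field.incl)

lemma K_induct [consumes 1, case_names one incl minus inverse add mult]:
  assumes "x \<in> K" "P 1" "\<And>g. g \<in> carrier G \<Longrightarrow> P (\<chi> g)"
    "\<And>x. x \<in> K \<Longrightarrow> P x \<Longrightarrow> P (- x)" "\<And>x. x \<in> K \<Longrightarrow> P x \<Longrightarrow> x \<noteq> 0 \<Longrightarrow> P (inverse x)"
    "\<And>x y. P x \<Longrightarrow> P y \<Longrightarrow> P (x + y)" "\<And>x y. P x \<Longrightarrow> P y \<Longrightarrow> P (x * y)"
  shows "P x"
  using assms(1) unfolding K_def character_field_def
proof (induction rule: generate_field.induct)
  case one then show ?case using assms(2) by simp
next
  case (incl h) then show ?case using assms(3) by auto
next
  case (a_inv h) then show ?case using assms(4)[of h] by (simp add: class_ring_simps K_def character_field_def)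
next
  case (m_inv h) then show ?case using assms(5)[of h] by (simp add: class_ring_simps K_def character_field_def)
next
  case (eng_add h1 h2) then show ?case using assms(6) by simp
next
  case (eng_mult h1 h2) then show ?case using assms(7) by simp
qed

lemma K_subfield: "subfield K class_ring"
  unfolding K_def character_field_def by (rule field.generate_field_is_subfield[OF class_field]) simp

lemma K_closed:
  shows "1 \<in> K" "0 \<in> K" "x \<in> K \<Longrightarrow> - x \<in> K" "x \<in> K \<Longrightarrow> inverse x \<in> K"
    "x \<in> K \<Longrightarrow> y \<in> K \<Longrightarrow> x + y \<in> K" "x \<in> K \<Longrightarrow> y \<in> K \<Longrightarrow> x * y \<in> K"
proof -
  show one: "1 \<in> K" using generate_field.one[of class_ring "\<chi> ` carrier G"] by (simp add: K_def character_field_def)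
  show uminus: "x \<in> K \<Longrightarrow> - x \<in> K" for x
    using generate_field.a_inv[of x class_ring "\<chi> ` carrier G"] by (simp add: K_def character_field_def class_ring_simps)
  show add: "x \<in> K \<Longrightarrow> y \<in> K \<Longrightarrow> x + y \<in> K" for x y
    using generate_field.eng_add[of x class_ring "\<chi> ` carrier G" y] by (simp add: K_def character_field_def)
  show "x \<in> K \<Longrightarrow> y \<in> K \<Longrightarrow> x * y \<in> K"
    using generate_field.eng_mult[of x class_ring "\<chi> ` carrier G" y] by (simp add: K_def character_field_def)
  show zero: "0 \<in> K" using add[OF one uminus[OF one]] by simp
  show "x \<in> K \<Longrightarrow> inverse x \<in> K"
    using zero generate_field.m_inv[of x class_ring "\<chi> ` carrier G"]
    by (cases "x = 0") (simp_all add: K_def character_field_def class_ring_simps)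
qed

lemma of_nat_in_K: "of_nat k \<in> K"
  by (induction k) (auto intro: K_closed)

lemma of_int_in_K: "of_int k \<in> K"
  using of_nat_in_K K_closed(3) by (cases k) (auto simp del: of_nat_Suc)

lemma of_rat_in_K: "of_rat q \<in> K"
proof (cases q)
  case (Fract a b)
  then have "(of_rat q :: complex) = of_int a * inverse (of_int b)" by (simp add: of_rat_rat divide_inverse)
  then show ?thesis using of_int_in_K K_closed by simp
qed

lemma K_subspace: "complex_over_rat.subspace K"
  by (auto simp: complex_over_rat.subspace_def intro: K_closed of_rat_in_K)

text \<open>The choice is literally the one made inside \<open>field_trace\<close>, so that both
  traces are computed in the same basis.\<close>

definition KB where
  "KB = (SOME B. complex_over_rat.independent B \<and> complex_over_rat.span B = K)"

lemma KB: "complex_over_rat.independent KB" "complex_over_rat.span KB = K"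
proof -
  obtain B where "B \<subseteq> K" "complex_over_rat.independent B" "K \<subseteq> complex_over_rat.span B"
    using complex_over_rat.maximal_independent_subset[of K] by blast
  then have "complex_over_rat.independent B \<and> complex_over_rat.span B = K"
    using K_subspace complex_over_rat.span_subspace by blast
  then show "complex_over_rat.independent KB" "complex_over_rat.span KB = K"
    unfolding KB_def by (metis (mono_tags, lifting) someI_ex)+
qed

lemma KB_subset: "KB \<subseteq> K"
  using complex_over_rat.span_superset KB(2) by blast

text \<open>Coordinates with respect to a \<open>\<rat>\<close>-basis of \<open>\<complex>\<close> extending \<open>KB\<close>; this extends the trace of
  \<open>K\<close> to a \<open>\<rat>\<close>-linear functional on \<open>\<complex>\<close>.\<close>

definition coord :: "complex \<Rightarrow> complex \<Rightarrow> rat" where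
  "coord b x = complex_over_rat.representation (complex_over_rat.extend_basis KB) x b"

text \<open>At this point \<open>KB\<close> could still be infinite, and then the sum is 0 by
  convention. Rational linearity holds in either case; \<open>finite_KB\<close> later shows that
  this default does not occur.\<close>

definition tr :: "complex \<Rightarrow> rat" where
  "tr x = (\<Sum>b\<in>KB. coord b (x * b))"

lemma coord_add: "coord b (x + y) = coord b x + coord b y"
  and coord_scale: "coord b (of_rat q * x) = q * coord b x"
  and coord_sum: "coord b (\<Sum>i\<in>I. F i) = (\<Sum>i\<in>I. coord b (F i))"
  and coord_minus: "coord b (- x) = - coord b x"
  using complex_over_rat.independent_extend_basis[OF KB(1)] complex_over_rat.span_extend_basis[OF KB(1)]
  by (simp_all add: coord_def complex_over_rat.representation_add complex_over_rat.representation_scale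
      complex_over_rat.representation_sum complex_over_rat.representation_neg)

lemma coord_scale_nat: "coord b (of_nat k * x) = of_nat k * coord b x"
  using coord_scale[of b "of_nat k" x] by simp

lemma coord_K: "x \<in> K \<Longrightarrow> coord b x = complex_over_rat.representation KB x b"
  unfolding coord_def using KB complex_over_rat.extend_basis_superset[OF KB(1)]
  by (subst complex_over_rat.representation_extend[OF complex_over_rat.independent_extend_basis[OF KB(1)], of _ KB]) auto

lemma tr_sum: "tr (\<Sum>i\<in>I. F i) = (\<Sum>i\<in>I. tr (F i))"
  unfolding tr_def by (subst sum.swap) (simp add: sum_distrib_right coord_sum)

lemma tr_scale: "tr (of_rat q * x) = q * tr x"
  unfolding tr_def by (simp add: mult.assoc coord_scale sum_distrib_left)

lemma tr_eq_field_trace: "x \<in> K \<Longrightarrow> field_trace (character_field G V) x = tr x"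
  using KB_subset unfolding field_trace_def tr_def K_def[symmetric] KB_def[symmetric] Let_def
  by (intro sum.cong refl) (auto simp: coord_K K_closed)

lemma tr_one: "finite KB \<Longrightarrow> tr 1 = of_nat (card KB)"
  using KB_subset by (simp add: tr_def coord_K subset_iff complex_over_rat.representation_basis[OF KB(1)])

text \<open>The functionals \<open>y \<mapsto> \<Sum>\<^sub>g \<chi>(g) coord b (\<chi>(g\<^sup>-\<^sup>1) y)\<close> turn out to be \<open>K\<close>-linear, hence are determined
  by their value at \<open>1\<close>. This replaces the argument that distinct Galois conjugates of \<open>V\<close> are
  orthogonal.\<close>

lemma trace_character_inner:
  assumes fin_KB: "finite KB"
  shows "(\<Sum>g\<in>carrier G. of_rat (tr (\<chi> (inv g))) * \<chi> g) = of_nat ord_G"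
proof -
  define \<phi> where "\<phi> b y = (\<Sum>g\<in>carrier G. \<chi> g * of_rat (coord b (\<chi> (inv g) * y)))" for b y
  have add: "\<phi> b (x + y) = \<phi> b x + \<phi> b y" for b x y
    by (simp add: \<phi>_def distrib_left coord_add of_rat_add sum.distrib)
  have minus: "\<phi> b (- y) = - \<phi> b y" for b y
    by (simp add: \<phi>_def coord_minus of_rat_minus sum_negf)
  have gen: "\<phi> b (\<chi> c * y) = \<chi> c * \<phi> b y" if c: "c \<in> carrier G" for b c y
  proof -
    \<comment> \<open>The factor \<open>ord_G\<close> makes room for \<open>class_sum\<close>, which
      is applied twice: here at \<open>g\<close>, and backwards at \<open>inv g\<close> once the
      class sum has moved into the coordinate.\<close>
    have "of_nat ord_G * (\<chi> c * \<phi> b y) =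
        (\<Sum>g\<in>carrier G. of_nat ord_G * \<chi> c * \<chi> g * of_rat (coord b (\<chi> (inv g) * y)))"
      by (simp add: \<phi>_def sum_distrib_left mult_ac)
    also have "\<dots> = (\<Sum>g\<in>carrier G. of_nat n * (\<Sum>t\<in>carrier G. \<chi> (t \<otimes> c \<otimes> inv t \<otimes> g)) * of_rat (coord b (\<chi> (inv g) * y)))"
      using c by (intro sum.cong refl) (simp add: class_sum)
    also have "\<dots> = of_nat n * (\<Sum>t\<in>carrier G. \<Sum>g\<in>carrier G. \<chi> (t \<otimes> c \<otimes> inv t \<otimes> g) * of_rat (coord b (\<chi> (inv g) * y)))"
      by (subst sum.swap) (simp add: sum_distrib_left sum_distrib_right mult_ac)
    also have "(\<Sum>t\<in>carrier G. \<Sum>g\<in>carrier G. \<chi> (t \<otimes> c \<otimes> inv t \<otimes> g) * of_rat (coord b (\<chi> (inv g) * y)))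
        = (\<Sum>t\<in>carrier G. \<Sum>g\<in>carrier G. \<chi> g * of_rat (coord b (\<chi> (t \<otimes> c \<otimes> inv t \<otimes> inv g) * y)))"
    proof (rule sum.cong[OF refl])
      fix t assume t: "t \<in> carrier G"
      have bij: "bij_betw (\<lambda>u. inv u) (carrier G) (carrier G)" by (rule bij_inv)
      define u where "u = t \<otimes> c \<otimes> inv t"
      have u: "u \<in> carrier G" using c t by (simp add: u_def)
      \<comment> \<open>Translation by the inverse of the conjugate \<open>u\<close> of
        \<open>c\<close> frees the outer character from \<open>u\<close> and puts \<open>u\<close>
        into the argument of the inner one.\<close>
      have "(\<Sum>g\<in>carrier G. \<chi> (u \<otimes> g) * of_rat (coord b (\<chi> (inv g) * y)))
          = (\<Sum>g\<in>carrier G. \<chi> (u \<otimes> (inv u \<otimes> g)) * of_rat (coord b (\<chi> (inv (inv u \<otimes> g)) * y)))"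
        by (rule sum_mult_left[OF inv_closed[OF u], symmetric])
      also have "\<dots> = (\<Sum>g\<in>carrier G. \<chi> g * of_rat (coord b (\<chi> (u \<otimes> inv g) * y)))"
        using u by (intro sum.cong refl)
          (simp add: m_assoc[symmetric] inv_mult_group character_conj[OF rep, of _ u])
      finally show "(\<Sum>g\<in>carrier G. \<chi> (t \<otimes> c \<otimes> inv t \<otimes> g) * of_rat (coord b (\<chi> (inv g) * y)))
        = (\<Sum>g\<in>carrier G. \<chi> g * of_rat (coord b (\<chi> (t \<otimes> c \<otimes> inv t \<otimes> inv g) * y)))"
        unfolding u_def .
    qed
    also have "of_nat n * \<dots> = (\<Sum>g\<in>carrier G. \<chi> g * of_rat (coord b (of_nat n * (\<Sum>t\<in>carrier G. \<chi> (t \<otimes> c \<otimes> inv t \<otimes> inv g)) * y)))"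
    proof -
      have "coord b (of_nat n * (\<Sum>t\<in>carrier G. F t) * y) = of_nat n * (\<Sum>t\<in>carrier G. coord b (F t * y))" for F
        by (simp add: mult.assoc coord_scale_nat sum_distrib_right coord_sum)
      note r = this
      show ?thesis
        unfolding r by (subst sum.swap) (simp add: of_rat_mult of_rat_sum sum_distrib_left mult_ac)
    qed
    also have "\<dots> = (\<Sum>g\<in>carrier G. \<chi> g * of_rat (coord b (of_nat ord_G * (\<chi> (inv g) * (\<chi> c * y)))))"
      using c by (intro sum.cong refl) (simp add: class_sum mult_ac)
    also have "\<dots> = of_nat ord_G * \<phi> b (\<chi> c * y)"
      unfolding coord_scale_nat \<phi>_def by (simp add: of_rat_mult sum_distrib_left mult_ac)
    finally show ?thesis using ord_G_pos by simp
  qed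
  have lin: "\<forall>y. \<phi> b (x * y) = x * \<phi> b y" if "x \<in> K" for x b
    using that
  proof (induction rule: K_induct)
    \<comment> \<open>Linearity for \<open>x\<close>, applied to \<open>inverse x * y\<close>, is
      solved for the value at \<open>inverse x * y\<close>.\<close>
    case (inverse x)
    then have "x * \<phi> b (inverse x * y) = \<phi> b y" for y by (metis mult.assoc mult.left_neutral right_inverse)
    then show ?case using inverse by (metis mult.assoc mult.left_neutral left_inverse)
  qed (use minus add gen in \<open>simp_all add: distrib_right mult.assoc\<close>)
  have "(\<Sum>g\<in>carrier G. of_rat (tr (\<chi> (inv g))) * \<chi> g) = (\<Sum>b\<in>KB. \<phi> b b)"
    unfolding \<phi>_def tr_def by (subst sum.swap) (simp add: of_rat_sum sum_distrib_left mult_ac)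
  \<comment> \<open>Linearity over K replaces \<open>\<phi> b b\<close> by
    \<open>b * \<phi> b 1\<close>; summing over the basis then reassembles
    \<open>\<chi> (inv g)\<close> from its coordinates.\<close>
  also have "\<dots> = (\<Sum>b\<in>KB. b * \<phi> b 1)"
    using lin KB_subset by (intro sum.cong refl) (metis mult.right_neutral subsetD)
  also have "\<dots> = (\<Sum>g\<in>carrier G. \<chi> g * (\<Sum>b\<in>KB. of_rat (coord b (\<chi> (inv g))) * b))"
    unfolding \<phi>_def by (simp add: sum_distrib_left mult_ac) (subst sum.swap, rule refl)
  also have "\<dots> = (\<Sum>g\<in>carrier G. \<chi> g * \<chi> (inv g))"
    using KB chi_in_K fin_KB
    by (intro sum.cong refl arg_cong2[of _ _ _ _ "(*)"]) (simp add: coord_K complex_over_rat.sum_representation_eq)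
  also have "\<dots> = of_nat ord_G" by (rule character_norm)
  finally show ?thesis .
qed

end

section \<open>The rational representation and its complex constituent\<close>

text \<open>By Cayley-Hamilton, multiplying \<open>S\<close> successively by the factors P - c, with
  c running through the eigenvalues, eventually gives 0, and the last nonzero matrix is an
  eigenvector. The predicate \<open>Q\<close> stands for a P-stable space of matrices in which the
  eigenvector has to stay.\<close>

lemma right_eigenvector_exists:
  fixes P :: "complex mat"
  assumes P: "P \<in> carrier_mat d d" and S: "S \<in> carrier_mat n d" "S \<noteq> 0\<^sub>m n d" "Q S"
    and Q: "\<And>S' c. S' \<in> carrier_mat n d \<Longrightarrow> Q S' \<Longrightarrow> Q (S' * P - c \<cdot>\<^sub>m S')"
  shows "\<exists>S' c. S' \<in> carrier_mat n d \<and> S' \<noteq> 0\<^sub>m n d \<and> Q S' \<and> S' * P = c \<cdot>\<^sub>m S'"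
proof -
  obtain as where "char_poly P = (\<Prod>a\<leftarrow>as. [:- a, 1:])" using char_poly_factorized[OF P] by blast
  then obtain B where B: "B \<in> carrier_mat d d" "upper_triangular B" "similar_mat P B"
    using schur_decomposition_exists[OF P] by blast
  then obtain U R where UR: "similar_mat_wit P B U R" by (auto simp: similar_mat_def)
  have U: "U \<in> carrier_mat d d" and R: "R \<in> carrier_mat d d" and inv: "U * R = 1\<^sub>m d" "R * U = 1\<^sub>m d"
    and PB: "P = U * B * R"
    using similar_mat_witD2[OF P UR] by auto
  have PU: "P * U = U * B"
  proof -
    have "P * U = U * B * (R * U)" unfolding PB by (rule assoc_mult_mat) (use U R B in auto)
    then show ?thesis using U B inv by simp
  qed
  \<comment> \<open>In the triangularizing basis \<open>U\<close>, each factor kills at least one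
    more leading column; the induction is on the number \<open>m\<close> of columns that may still
    be nonzero.\<close>
  define Z where "Z j S' \<longleftrightarrow> (\<forall>k<n. \<forall>l<j. l < d \<longrightarrow> (S' * U) $$ (k, l) = 0)" for j S'
  have step: "\<exists>S' c. S' \<in> carrier_mat n d \<and> S' \<noteq> 0\<^sub>m n d \<and> Q S' \<and> S' * P = c \<cdot>\<^sub>m S'"
    if "S' \<in> carrier_mat n d" "S' \<noteq> 0\<^sub>m n d" "Q S'" "Z (d - m) S'" "m \<le> d" for m S'
    using that
  proof (induction m arbitrary: S')
    case 0
    have "S' * U = 0\<^sub>m n d" using 0 U by (intro eq_matI) (auto simp: Z_def simp del: index_mult_mat(1))
    moreover have "S' * U * R = S'" using 0 U R inv by simp
    ultimately have "S' = 0\<^sub>m n d" using R by simp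
    then show ?case using 0 by simp
  next
    case (Suc m)
    define j where "j = d - Suc m"
    have j: "j < d" "d - m = Suc j" using Suc.prems by (auto simp: j_def)
    define S1 where "S1 = S' * P - B $$ (j, j) \<cdot>\<^sub>m S'"
    have S1: "S1 \<in> carrier_mat n d" using Suc.prems P by (auto simp: S1_def)
    show ?case
    proof (cases "S1 = 0\<^sub>m n d")
      case True
      have "S' * P = B $$ (j, j) \<cdot>\<^sub>m S'"
      proof (rule eq_matI)
        fix a b assume ab: "a < dim_row (B $$ (j, j) \<cdot>\<^sub>m S')" "b < dim_col (B $$ (j, j) \<cdot>\<^sub>m S')"
        then have "S1 $$ (a, b) = 0" using True Suc.prems by simp
        then show "(S' * P) $$ (a, b) = (B $$ (j, j) \<cdot>\<^sub>m S') $$ (a, b)"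
          using ab Suc.prems P by (simp add: S1_def del: index_mult_mat(1))
      qed (use Suc.prems P in auto)
      then show ?thesis using Suc.prems by blast
    next
      case False
      define M where "M = S' * U"
      have M: "M \<in> carrier_mat n d" using Suc.prems U by (auto simp: M_def)
      have "S1 * U = S' * P * U - (B $$ (j, j) \<cdot>\<^sub>m S') * U"
        unfolding S1_def by (rule minus_mult_distrib_mat) (use Suc.prems P U in auto)
      also have "S' * P * U = S' * (U * B)" using Suc.prems P U by (simp add: PU)
      also have "\<dots> = M * B" using Suc.prems U B by (simp add: M_def)
      also have "(B $$ (j, j) \<cdot>\<^sub>m S') * U = B $$ (j, j) \<cdot>\<^sub>m M"
        unfolding M_def using Suc.prems U by (intro mult_smult_assoc_mat) auto
      finally have S1U: "S1 * U = M * B - B $$ (j, j) \<cdot>\<^sub>m M" .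
      have zero: "(S1 * U) $$ (k, l) = 0" if k: "k < n" and l: "l < Suc j" for k l
      proof -
        have ld: "l < d" using l j by simp
        have z: "M $$ (k, i) = 0" if "i < j" for i
          using Suc.prems(4) that k j unfolding Z_def M_def j_def[symmetric] by auto
        have "(M * B) $$ (k, l) = (\<Sum>i<d. M $$ (k, i) * B $$ (i, l))"
          by (rule index_mult_mat_sum[OF M B(1) k ld])
        \<comment> \<open>Indices below \<open>j\<close> drop out because those columns of
          \<open>M\<close> vanish, indices above \<open>j\<close> because \<open>B\<close> is
          triangular and \<open>l\<close> is at most \<open>j\<close>.\<close>
        also have "\<dots> = (\<Sum>i\<in>{j}. M $$ (k, i) * B $$ (i, l))"
        proof (intro sum.mono_neutral_right ballI)
          fix i assume i: "i \<in> {..<d} - {j}"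
          show "M $$ (k, i) * B $$ (i, l) = 0"
          proof (cases "i < j")
            case True then show ?thesis using z by simp
          next
            case False
            then have "B $$ (i, l) = 0" using i l B(1) by (intro upper_triangularD[OF B(2)]) auto
            then show ?thesis by simp
          qed
        qed (use j in auto)
        finally have e: "(M * B) $$ (k, l) = M $$ (k, j) * B $$ (j, l)" by simp
        have "(S1 * U) $$ (k, l) = (M * B) $$ (k, l) - B $$ (j, j) * M $$ (k, l)"
          unfolding S1U using k ld M B(1) by (simp del: index_mult_mat(1))
        also have "\<dots> = 0"
        proof (cases "l = j")
          case True then show ?thesis unfolding e by simp
        next
          case False
          then have "B $$ (j, l) = 0" using j l B(1) by (intro upper_triangularD[OF B(2)]) auto
          then show ?thesis unfolding e using False l z by simp
        qed
        finally show ?thesis .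
      qed
      have "Z (d - m) S1" unfolding Z_def j(2) using zero by blast
      moreover have "Q S1" unfolding S1_def by (rule Q) (use Suc.prems in auto)
      ultimately show ?thesis using Suc.IH[OF S1 False] Suc.prems(5) by simp
    qed
  qed
  show ?thesis by (rule step[of S d]) (use S in \<open>auto simp: Z_def\<close>)
qed

abbreviation (input) cmat :: "rat mat \<Rightarrow> complex mat" where "cmat \<equiv> map_mat of_rat"
abbreviation (input) cvec :: "rat vec \<Rightarrow> complex vec" where "cvec \<equiv> map_vec of_rat"

lemma is_rep_complexify: "is_rep G n \<rho> \<Longrightarrow> is_rep G n (complexify \<rho>)"
  unfolding is_rep_def complexify_def
  by (auto simp: of_rat_hom.mat_hom_mult[of _ n n _ n] of_rat_hom.mat_hom_one)

locale rational_irrep = complex_irrep G n V for G :: "('g, 'b) monoid_scheme" (structure) and n V +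
  fixes d :: nat and W :: "'g \<Rightarrow> rat mat"
  assumes W_irr: "irreducible_rep G d W"
    and V_in_W: "appears_in G n V d (complexify W)"
begin

lemma W_rep: "is_rep G d W" and d_pos: "d > 0"
  using irreducible_repD[OF W_irr] by auto

lemmas W_carrier = is_rep_carrier[OF W_rep]

abbreviation WC where "WC \<equiv> complexify W"

lemma WC_rep: "is_rep G d WC"
  by (rule is_rep_complexify[OF W_rep])

lemmas WC_carrier = is_rep_carrier[OF WC_rep]

definition T where
  "T = (SOME T. T \<in> intertwiners G n V d WC \<and> inj_on (\<lambda>v. T *\<^sub>v v) (carrier_vec n))"

lemma T: "T \<in> carrier_mat d n" "g \<in> carrier G \<Longrightarrow> T * V g = WC g * T"
  and T_inj: "inj_on (\<lambda>v. T *\<^sub>v v) (carrier_vec n)"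
proof -
  have "T \<in> intertwiners G n V d WC \<and> inj_on (\<lambda>v. T *\<^sub>v v) (carrier_vec n)"
    unfolding T_def by (rule someI_ex) (use V_in_W in \<open>simp add: appears_in_def Bex_def\<close>)
  then show "T \<in> carrier_mat d n" "g \<in> carrier G \<Longrightarrow> T * V g = WC g * T"
    "inj_on (\<lambda>v. T *\<^sub>v v) (carrier_vec n)"
    by (auto simp: intertwiners_def)
qed

text \<open>A merely linear left inverse of the embedding \<open>T\<close>; averaging it in
  \<open>S0\<close> produces an equivariant map from the complexification of \<open>W\<close> to
  \<open>V\<close>.\<close>

definition T' where "T' = (SOME X. X \<in> carrier_mat n d \<and> X * T = 1\<^sub>m n)"

lemma T': "T' \<in> carrier_mat n d" "T' * T = 1\<^sub>m n"
proof -
  obtain X where "X \<in> carrier_mat n d" "X * T = 1\<^sub>m n"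
  proof (rule injective_complex_mat_left_inverse[OF T(1)])
    show "v = 0\<^sub>v n" if "v \<in> carrier_vec n" "T *\<^sub>v v = 0\<^sub>v d" for v
      by (rule injectiveI_kernel[OF T(1) T_inj that])
  qed
  then have "T' \<in> carrier_mat n d \<and> T' * T = 1\<^sub>m n"
    unfolding T'_def by (intro someI[of "\<lambda>X. X \<in> carrier_mat n d \<and> X * T = 1\<^sub>m n" X]) simp
  then show "T' \<in> carrier_mat n d" "T' * T = 1\<^sub>m n" by auto
qed

text \<open>Since \<open>T'\<close> is a left inverse of \<open>T\<close>, chi(g) is the trace of
  W(g) times \<open>T * T'\<close>, a combination of entries of W(g) with complex coefficients.
  Applying \<open>tr\<close> makes the coefficients rational; as they need not lie in K, the
  extension of the trace to all complex numbers is used here.\<close>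

lemma tr_character_coefficients:
  obtains q where "\<And>g. g \<in> carrier G \<Longrightarrow> tr (\<chi> g) = (\<Sum>i<d. \<Sum>j<d. q i j * W g $$ (i, j))"
proof
  fix g assume g: "g \<in> carrier G"
  note c = T(1) T'(1) V_carrier[OF g] WC_carrier[OF g]
  have "\<chi> g = mtrace (T' * T * V g)" unfolding T'(2) using c by (simp add: character_eq_mtrace)
  also have "T' * T * V g = T' * (WC g * T)" using c by (simp add: T(2)[OF g])
  also have "\<dots> = T' * WC g * T" using c by simp
  also have "mtrace \<dots> = mtrace (T * (T' * WC g))"
    by (rule mtrace_mult_comm[of _ n d]) (use c in auto)
  also have "T * (T' * WC g) = T * T' * WC g" using c by simp
  also have "mtrace \<dots> = mtrace (WC g * (T * T'))"
    by (rule mtrace_mult_comm[of _ d d]) (use c in auto)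
  also have "\<dots> = (\<Sum>i<d. \<Sum>j<d. WC g $$ (i, j) * (T * T') $$ (j, i))"
    unfolding mtrace_def using c
    by (intro sum.cong) (auto simp: index_mult_mat_sum[of "WC g" d d "T * T'" d] simp del: index_mult_mat(1))
  also have "\<dots> = (\<Sum>i<d. \<Sum>j<d. of_rat (W g $$ (i, j)) * (T * T') $$ (j, i))"
    using W_carrier[OF g] by (intro sum.cong) (auto simp: complexify_def)
  finally show "tr (\<chi> g) = (\<Sum>i<d. \<Sum>j<d. tr ((T * T') $$ (j, i)) * W g $$ (i, j))"
    by (simp add: tr_sum tr_scale mult.commute del: index_mult_mat(1))
qed

definition S0 where "S0 = msum n d (carrier G) (\<lambda>g. V g * T' * WC (inv g))"

lemma S0: "S0 \<in> carrier_mat n d" "g \<in> carrier G \<Longrightarrow> S0 * WC g = V g * S0" "S0 \<noteq> 0\<^sub>m n d"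
proof -
  show "S0 \<in> carrier_mat n d" by (simp add: S0_def)
  show "g \<in> carrier G \<Longrightarrow> S0 * WC g = V g * S0"
    unfolding S0_def by (rule average_intertwines[OF WC_rep rep T'(1)])
  have car: "V g * T' * WC (inv g) \<in> carrier_mat n d" if "g \<in> carrier G" for g
    by (intro mult_carrier_mat[of _ n d] mult_carrier_mat[of _ n n] V_carrier WC_carrier T' inv_closed that)
  \<comment> \<open>Equivariance of \<open>T\<close> turns every summand into
    \<open>V g * V (inv g)\<close>, so the product is \<open>ord_G\<close> times the identity; this
    shows that \<open>S0\<close> is nonzero.\<close>
  have "S0 * T = msum n n (carrier G) (\<lambda>g. V g * T' * WC (inv g) * T)"
    unfolding S0_def by (rule msum_mult) (use T car in auto)
  also have "\<dots> = msum n n (carrier G) (\<lambda>g. 1\<^sub>m n)"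
  proof (rule msum_cong)
    fix g assume g: "g \<in> carrier G"
    note c = T(1) T'(1) V_carrier[OF g] V_carrier[OF inv_closed[OF g]] WC_carrier[OF inv_closed[OF g]]
    have 1: "V g * T' * T = V g"
    proof -
      have "V g * T' * T = V g * (T' * T)" by (rule assoc_mult_mat) (use c in auto)
      then show ?thesis using c by (simp only: T'(2)) simp
    qed
    have VT': "V g * T' \<in> carrier_mat n d" using c by auto
    have "V g * T' * WC (inv g) * T = V g * T' * (WC (inv g) * T)"
      by (rule assoc_mult_mat[OF VT' c(5) c(1)])
    also have "WC (inv g) * T = T * V (inv g)" using g by (simp add: T(2))
    also have "V g * T' * (T * V (inv g)) = V g * T' * T * V (inv g)"
      by (rule assoc_mult_mat[symmetric, OF VT' c(1) c(4)])
    also have "\<dots> = 1\<^sub>m n" unfolding 1 by (rule rep_mult_inv[OF rep g])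
    finally show "V g * T' * WC (inv g) * T = 1\<^sub>m n" .
  qed
  finally have eq: "S0 * T = msum n n (carrier G) (\<lambda>g. 1\<^sub>m n)" .
  show "S0 \<noteq> 0\<^sub>m n d"
  proof
    assume "S0 = 0\<^sub>m n d"
    then have "S0 * T = 0\<^sub>m n n" using T(1) by simp
    then have "(0\<^sub>m n n :: complex mat) $$ (0, 0) = msum n n (carrier G) (\<lambda>g. 1\<^sub>m n) $$ (0, 0)"
      unfolding eq by simp
    then show False using n_pos ord_G_pos by (simp add: ord_G_def)
  qed
qed

end

section \<open>Scalars stabilizing a rational form\<close>

lemma cvec_add: "dim_vec u = dim_vec v \<Longrightarrow> cvec (u + v) = cvec u + cvec v"
  by (intro eq_vecI) (auto simp: of_rat_add)

lemma cvec_smult: "cvec (q \<cdot>\<^sub>v v) = of_rat q \<cdot>\<^sub>v cvec v"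
  by (intro eq_vecI) (auto simp: of_rat_mult)

lemma mult_mat_vec_as_sum_cols:
  fixes A :: "'a::comm_semiring_1 mat"
  assumes "A \<in> carrier_mat r c" "B \<in> carrier_mat k r" "i < k" "v \<in> carrier_vec c"
  shows "(B *\<^sub>v (A *\<^sub>v v)) $ i = (\<Sum>j<c. v $ j * (B *\<^sub>v col A j) $ i)"
proof -
  have c: "col A j \<in> carrier_vec r" for j using assms(1) by (simp add: carrier_vecI)
  have "(B *\<^sub>v (A *\<^sub>v v)) $ i = (\<Sum>l<r. \<Sum>j<c. B $$ (i, l) * (A $$ (l, j) * v $ j))"
    using assms by (subst index_mult_mat_vec_sum[OF assms(2) mult_mat_vec_carrier[OF assms(1,4)] assms(3)])
      (auto simp: index_mult_mat_vec_sum[OF assms(1,4)] sum_distrib_left simp del: index_mult_mat_vec)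
  also have "\<dots> = (\<Sum>j<c. v $ j * (\<Sum>l<r. B $$ (i, l) * A $$ (l, j)))"
    by (subst sum.swap) (simp add: sum_distrib_left mult_ac)
  also have "\<dots> = (\<Sum>j<c. v $ j * (B *\<^sub>v col A j) $ i)"
    using assms by (intro sum.cong refl) (auto simp: index_mult_mat_vec_sum[OF assms(2) c assms(3)] simp del: index_mult_mat_vec)
  finally show ?thesis .
qed

lemma rat_independent_list:
  assumes "distinct bs" "complex_over_rat.independent (set bs)"
    and "(\<Sum>j<length bs. of_rat (v j) * bs ! j) = 0" "j < length bs"
  shows "v j = 0"
proof -
  have bij: "bij_betw (\<lambda>j. bs ! j) {..<length bs} (set bs)" using bij_betw_nth assms(1) by blast
  define u where "u b = v (the_inv_into {..<length bs} (\<lambda>j. bs ! j) b)" for b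
  have u: "u (bs ! j) = v j" if "j < length bs" for j
    using that bij by (simp add: u_def the_inv_into_f_f bij_betw_def)
  have "(\<Sum>b\<in>set bs. of_rat (u b) * b) = (\<Sum>j<length bs. of_rat (u (bs ! j)) * bs ! j)"
    by (rule sum.reindex_bij_betw[OF bij, symmetric])
  also have "\<dots> = 0" using assms(3) by (simp add: u)
  finally have "u (bs ! j) = 0"
    using complex_over_rat.independentD[OF assms(2) finite_set subset_refl] assms(4) nth_mem by blast
  then show ?thesis by (simp add: u assms(4))
qed

context rational_irrep
begin

definition nonzero_hom :: "complex mat \<Rightarrow> bool" where
  "nonzero_hom S \<longleftrightarrow> S \<in> carrier_mat n d \<and> S \<noteq> 0\<^sub>m n d \<and> (\<forall>g\<in>carrier G. S * WC g = V g * S)"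

lemma nonzero_homD:
  assumes "nonzero_hom S"
  shows "S \<in> carrier_mat n d" "S \<noteq> 0\<^sub>m n d" "\<And>g. g \<in> carrier G \<Longrightarrow> S * WC g = V g * S"
  using assms by (auto simp: nonzero_hom_def)

definition rimage :: "complex mat \<Rightarrow> rat vec \<Rightarrow> complex vec" where
  "rimage S w = S *\<^sub>v cvec w"

lemma rimage_carrier: "S \<in> carrier_mat r d \<Longrightarrow> w \<in> carrier_vec d \<Longrightarrow> rimage S w \<in> carrier_vec r"
  by (auto simp: rimage_def)

lemma rimage_dim [simp]: "dim_vec (rimage S w) = dim_row S"
  by (simp add: rimage_def)

lemma rimage_add:
  "S \<in> carrier_mat r d \<Longrightarrow> u \<in> carrier_vec d \<Longrightarrow> v \<in> carrier_vec d \<Longrightarrow>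
    rimage S (u + v) = rimage S u + rimage S v"
  by (simp add: rimage_def cvec_add mult_add_distrib_mat_vec)

lemma rimage_smult:
  "S \<in> carrier_mat r d \<Longrightarrow> u \<in> carrier_vec d \<Longrightarrow> rimage S (q \<cdot>\<^sub>v u) = of_rat q \<cdot>\<^sub>v rimage S u"
  by (simp add: rimage_def cvec_smult mult_mat_vec)

lemma rimage_zero: "S \<in> carrier_mat r d \<Longrightarrow> rimage S (0\<^sub>v d) = 0\<^sub>v r"
  by (simp add: rimage_def of_rat_hom.vec_hom_zero mult_mat_vec_zero)

lemma rimage_unit: "S \<in> carrier_mat r d \<Longrightarrow> j < d \<Longrightarrow> rimage S (unit_vec d j) = col S j"
proof -
  assume S: "S \<in> carrier_mat r d" "j < d"
  have "cvec (unit_vec d j) = unit_vec d j" using S by (intro eq_vecI) (auto simp: unit_vec_def)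
  then show ?thesis using S by (simp add: rimage_def col_mult_unit_vec)
qed

lemma rimage_mult:
  assumes "S \<in> carrier_mat r d" "y \<in> carrier_mat d d" "w \<in> carrier_vec d" "M \<in> carrier_mat r r"
    and "S * cmat y = M * S"
  shows "rimage S (y *\<^sub>v w) = M *\<^sub>v rimage S w"
proof -
  have "rimage S (y *\<^sub>v w) = S *\<^sub>v (cmat y *\<^sub>v cvec w)"
    using assms by (simp add: rimage_def of_rat_hom.mult_mat_vec_hom)
  also have "\<dots> = (S * cmat y) *\<^sub>v cvec w" using assms by (intro assoc_mult_mat_vec[symmetric]) auto
  also have "\<dots> = M *\<^sub>v rimage S w" unfolding assms(5) rimage_def using assms by (intro assoc_mult_mat_vec) auto
  finally show ?thesis .
qed

lemma rimage_scalar: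
  assumes "S \<in> carrier_mat r d" "y \<in> carrier_mat d d" "w \<in> carrier_vec d" "S * cmat y = c \<cdot>\<^sub>m S"
  shows "rimage S (y *\<^sub>v w) = c \<cdot>\<^sub>v rimage S w"
proof -
  have "rimage S (y *\<^sub>v w) = S *\<^sub>v (cmat y *\<^sub>v cvec w)"
    using assms by (simp add: rimage_def of_rat_hom.mult_mat_vec_hom)
  also have "\<dots> = (c \<cdot>\<^sub>m S) *\<^sub>v cvec w"
    unfolding assms(4)[symmetric] using assms by (intro assoc_mult_mat_vec[symmetric]) auto
  also have "\<dots> = c \<cdot>\<^sub>v rimage S w"
    using assms by (intro eq_vecI) (auto simp: rimage_def)
  finally show ?thesis .
qed

text \<open>The complex kernel of \<open>S\<close> may well be large, but its rational vectors form
  a \<open>W\<close>-invariant subspace. This is applied both to \<open>V\<close> and to its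
  realizations over smaller fields.\<close>

lemma W_dichotomy_mat:
  assumes S: "S \<in> carrier_mat r d" "S \<noteq> 0\<^sub>m r d"
    and M: "\<And>g. g \<in> carrier G \<Longrightarrow> M g \<in> carrier_mat r r" "\<And>g. g \<in> carrier G \<Longrightarrow> S * WC g = M g * S"
    and w: "w \<in> carrier_vec d" "rimage S w = 0\<^sub>v r"
  shows "w = 0\<^sub>v d"
proof -
  define U where "U = {w \<in> carrier_vec d. rimage S w = 0\<^sub>v r}"
  have "U = {0\<^sub>v d} \<or> U = carrier_vec d"
  proof (rule irreducible_rep_dichotomy[OF W_irr])
    show "0\<^sub>v d \<in> U" by (simp add: U_def rimage_zero[OF S(1)])
  next
    fix g u assume gu: "g \<in> carrier G" "u \<in> U"
    then have "rimage S (W g *\<^sub>v u) = M g *\<^sub>v rimage S u"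
      using S M W_carrier[OF gu(1)] by (intro rimage_mult) (auto simp: U_def complexify_def)
    then show "W g *\<^sub>v u \<in> U"
      using gu mult_mat_vec_carrier[OF W_carrier[OF gu(1)]] mult_mat_vec_zero[OF M(1)[OF gu(1)]] by (auto simp: U_def)
  next
    fix u v assume "u \<in> U" "v \<in> U" then show "u + v \<in> U" by (auto simp: U_def rimage_add[OF S(1)])
  next
    fix c u assume "u \<in> U" then show "c \<cdot>\<^sub>v u \<in> U" by (auto simp: U_def rimage_smult[OF S(1)])
  qed (auto simp: U_def)
  moreover have "U \<noteq> carrier_vec d"
  proof
    assume "U = carrier_vec d"
    then have "unit_vec d j \<in> U" for j by simp
    then have "col S j = 0\<^sub>v r" if "j < d" for j
      using that rimage_unit[OF S(1)] by (auto simp: U_def)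
    then have "S = 0\<^sub>m r d" using S(1) by (intro mat_col_eqI) auto
    then show False using S(2) by simp
  qed
  ultimately show ?thesis using w by (auto simp: U_def)
qed

lemma rimage_injective:
  "nonzero_hom S \<Longrightarrow> w \<in> carrier_vec d \<Longrightarrow> rimage S w = 0\<^sub>v n \<Longrightarrow> w = 0\<^sub>v d"
  by (rule W_dichotomy_mat[of S n V]) (auto dest: nonzero_homD V_carrier)

lemma rimage_unit_nonzero:
  assumes "nonzero_hom S"
  obtains i where "i < n" "rimage S (unit_vec d 0) $ i \<noteq> 0"
proof -
  have "rimage S (unit_vec d 0) \<noteq> 0\<^sub>v n"
    using rimage_injective[OF assms, of "unit_vec d 0"] d_pos by auto
  then show ?thesis
    using that rimage_carrier[OF nonzero_homD(1)[OF assms] unit_vec_carrier]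
    by (metis carrier_vecD eq_vecI index_zero_vec)
qed

text \<open>The scalars stabilizing the \<open>\<rat>\<close>-subspace \<open>S(\<rat>\<^sup>d)\<close> of \<open>\<complex>\<^sup>n\<close>; they act on \<open>\<rat>\<^sup>d\<close> as a subfield of the
  commutant of \<open>W\<close>.\<close>

definition stab :: "complex mat \<Rightarrow> complex set" where
  "stab S = {c. \<exists>y\<in>carrier_mat d d. S * cmat y = c \<cdot>\<^sub>m S}"

text \<open>Evaluation at a fixed nonzero rational vector embeds \<open>stab S\<close> into Q^d: the
  vectors \<open>y b\<close> applied to \<open>e\<close> have images b times S(e), so a rational
  relation among them is one among the scalars b.\<close>

lemma stab_bounded:
  assumes S: "nonzero_hom S" and B: "finite B" "complex_over_rat.independent B" "B \<subseteq> stab S"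
  shows "card B \<le> d"
proof -
  note Sc = nonzero_homD(1)[OF S]
  obtain bs where bs: "set bs = B" "distinct bs" using finite_distinct_list[OF B(1)] by blast
  have "\<forall>b\<in>B. \<exists>y. y \<in> carrier_mat d d \<and> S * cmat y = b \<cdot>\<^sub>m S" using B(3) by (auto simp: stab_def)
  then obtain y where y: "\<And>b. b \<in> B \<Longrightarrow> y b \<in> carrier_mat d d" "\<And>b. b \<in> B \<Longrightarrow> S * cmat (y b) = b \<cdot>\<^sub>m S"
    by metis
  define e where "e = (unit_vec d 0 :: rat vec)"
  have e: "e \<in> carrier_vec d" by (simp add: e_def)
  obtain i where i: "i < n" "rimage S e $ i \<noteq> 0" unfolding e_def by (rule rimage_unit_nonzero[OF S])
  define A where "A = mat d (length bs) (\<lambda>(k, j). (y (bs ! j) *\<^sub>v e) $ k)"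
  have A: "A \<in> carrier_mat d (length bs)" by (simp add: A_def)
  have colA: "col A j = y (bs ! j) *\<^sub>v e" if "j < length bs" for j
  proof -
    have "y (bs ! j) \<in> carrier_mat d d" using that y bs by auto
    then show ?thesis using that by (intro eq_vecI) (auto simp: A_def simp del: index_mult_mat_vec)
  qed
  have "length bs \<le> d"
  proof (rule injective_mat_dim_le[OF A])
    fix v assume v: "v \<in> carrier_vec (length bs)" and Av: "A *\<^sub>v v = 0\<^sub>v d"
    have "0 = (S *\<^sub>v (cmat A *\<^sub>v cvec v)) $ i"
      using A v Sc i by (simp add: of_rat_hom.mult_mat_vec_hom[symmetric, OF A v] Av of_rat_hom.vec_hom_zero mult_mat_vec_zero)
    also have "\<dots> = (\<Sum>j<length bs. cvec v $ j * (S *\<^sub>v col (cmat A) j) $ i)"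
      by (rule mult_mat_vec_as_sum_cols) (use A v Sc i in auto)
    also have "\<dots> = (\<Sum>j<length bs. of_rat (v $ j) * (bs ! j * rimage S e $ i))"
    proof (intro sum.cong refl)
      fix j assume j: "j \<in> {..<length bs}"
      then have b: "bs ! j \<in> B" using bs by auto
      have "S *\<^sub>v col (cmat A) j = rimage S (y (bs ! j) *\<^sub>v e)"
        using j A by (simp add: rimage_def col_map_mat colA)
      also have "\<dots> = bs ! j \<cdot>\<^sub>v rimage S e" by (rule rimage_scalar[OF Sc y(1)[OF b] e y(2)[OF b]])
      finally show "cvec v $ j * (S *\<^sub>v col (cmat A) j) $ i = of_rat (v $ j) * (bs ! j * rimage S e $ i)"
        using j v i Sc by simp
    qed
    also have "\<dots> = (\<Sum>j<length bs. of_rat (v $ j) * bs ! j) * rimage S e $ i"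
      by (simp add: sum_distrib_left sum_distrib_right mult_ac)
    finally have 0: "(\<Sum>j<length bs. of_rat (v $ j) * bs ! j) = 0" using i by simp
    have "v $ j = 0" if "j < length bs" for j
      by (rule rat_independent_list[OF bs(2) _ 0 that]) (simp add: bs(1) B(2))
    then show "v = 0\<^sub>v (length bs)" using v by (intro eq_vecI) auto
  qed
  then show ?thesis using bs distinct_card by fastforce
qed

lemma stab_closed:
  assumes S: "nonzero_hom S"
  shows stab_rat: "of_rat q \<in> stab S"
    and stab_add: "a \<in> stab S \<Longrightarrow> b \<in> stab S \<Longrightarrow> a + b \<in> stab S"
    and stab_mult: "a \<in> stab S \<Longrightarrow> b \<in> stab S \<Longrightarrow> a * b \<in> stab S"
    and stab_uminus: "a \<in> stab S \<Longrightarrow> - a \<in> stab S"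
    and stab_inverse: "a \<in> stab S \<Longrightarrow> inverse a \<in> stab S"
proof -
  note Sc = nonzero_homD(1)[OF S]
  show rat: "of_rat q \<in> stab S" for q
  proof -
    have "cmat (q \<cdot>\<^sub>m 1\<^sub>m d) = of_rat q \<cdot>\<^sub>m 1\<^sub>m d" by (intro eq_matI) auto
    then have "S * cmat (q \<cdot>\<^sub>m 1\<^sub>m d) = of_rat q \<cdot>\<^sub>m S" using Sc by (simp add: mult_smult_distrib[OF Sc one_carrier_mat])
    then show ?thesis unfolding stab_def by (intro CollectI bexI[of _ "q \<cdot>\<^sub>m 1\<^sub>m d"]) auto
  qed
  show mult: "a * b \<in> stab S" if ab: "a \<in> stab S" "b \<in> stab S" for a b
  proof -
    obtain x y where xy: "x \<in> carrier_mat d d" "y \<in> carrier_mat d d" "S * cmat x = a \<cdot>\<^sub>m S" "S * cmat y = b \<cdot>\<^sub>m S"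
      using ab by (auto simp: stab_def)
    have "S * cmat (x * y) = S * cmat x * cmat y"
      unfolding of_rat_hom.mat_hom_mult[OF xy(1,2)] using Sc xy(1,2) by (intro assoc_mult_mat[symmetric]) auto
    also have "\<dots> = a \<cdot>\<^sub>m (S * cmat y)" unfolding xy(3) using Sc xy(2) by (intro mult_smult_assoc_mat) auto
    also have "\<dots> = (a * b) \<cdot>\<^sub>m S" unfolding xy(4) by (intro eq_matI) auto
    finally show ?thesis using xy by (auto simp: stab_def intro!: bexI[of _ "x * y"])
  qed
  show "a + b \<in> stab S" if ab: "a \<in> stab S" "b \<in> stab S" for a b
  proof -
    obtain x y where xy: "x \<in> carrier_mat d d" "y \<in> carrier_mat d d" "S * cmat x = a \<cdot>\<^sub>m S" "S * cmat y = b \<cdot>\<^sub>m S"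
      using ab by (auto simp: stab_def)
    have "cmat (x + y) = cmat x + cmat y" using xy by (intro eq_matI) (auto simp: of_rat_add)
    then have "S * cmat (x + y) = S * cmat x + S * cmat y"
      using Sc xy by (simp add: mult_add_distrib_mat[of _ n d])
    also have "\<dots> = (a + b) \<cdot>\<^sub>m S" unfolding xy by (intro eq_matI) (auto simp: distrib_right)
    finally show ?thesis using xy by (auto simp: stab_def intro!: bexI[of _ "x + y"])
  qed
  show "- a \<in> stab S" if "a \<in> stab S" for a
    using mult[OF rat[of "-1"] that] by simp
  show "inverse a \<in> stab S" if a: "a \<in> stab S" for a
  proof (cases "a = 0")
    case False
    obtain y where y: "y \<in> carrier_mat d d" "S * cmat y = a \<cdot>\<^sub>m S" using a by (auto simp: stab_def)
    \<comment> \<open>Under the injective map \<open>rimage S\<close> the matrix \<open>y\<close>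
      becomes multiplication by \<open>a\<close>, which is nonzero; hence \<open>y\<close> is
      injective and therefore invertible over Q.\<close>
    obtain z where z: "z \<in> carrier_mat d d" "y * z = 1\<^sub>m d"
    proof (rule injective_square_mat_inverse[OF y(1)])
      fix v :: "rat vec" assume v: "v \<in> carrier_vec d" "y *\<^sub>v v = 0\<^sub>v d"
      have "a \<cdot>\<^sub>v rimage S v = rimage S (0\<^sub>v d)" using rimage_scalar[OF Sc y(1) v(1) y(2)] v(2) by simp
      also have "\<dots> = 0\<^sub>v n" by (rule rimage_zero[OF Sc])
      finally have "rimage S v $ i = 0" if "i < n" for i
        using False that rimage_carrier[OF Sc v(1)] by (metis carrier_vecD index_smult_vec(1) index_zero_vec(1) mult_eq_0_iff)
      then have "rimage S v = 0\<^sub>v n" using Sc by (intro eq_vecI) auto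
      then show "v = 0\<^sub>v d" using rimage_injective[OF S v(1)] by simp
    qed
    have "S = S * cmat (y * z)" using Sc z by (simp add: of_rat_hom.mat_hom_one)
    also have "\<dots> = S * cmat y * cmat z"
      unfolding of_rat_hom.mat_hom_mult[OF y(1) z(1)] using Sc y(1) z(1) by (intro assoc_mult_mat[symmetric]) auto
    also have "\<dots> = a \<cdot>\<^sub>m (S * cmat z)" unfolding y(2) using Sc z(1) by (intro mult_smult_assoc_mat) auto
    finally have e: "S = a \<cdot>\<^sub>m (S * cmat z)" .
    have "S * cmat z = inverse a \<cdot>\<^sub>m S"
      by (subst (2) e) (use False Sc z in \<open>auto simp del: index_mult_mat(1)\<close>)
    then show ?thesis using z(1) by (auto simp: stab_def)
  qed (use a in simp)
qed

lemma stab_subspace: "nonzero_hom S \<Longrightarrow> complex_over_rat.subspace (stab S)"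
  using stab_rat[of S 0] stab_rat by (auto simp: complex_over_rat.subspace_def intro: stab_add stab_mult)

text \<open>What is maximized is the size of a rationally independent set inside some
  \<open>stab S\<close>, which \<open>stab_bounded\<close> limits by \<open>d\<close>. A largest
  such set must span every stabilizer that contains it, which gives both the basis of
  \<open>stab S\<close> and its maximality under inclusion.\<close>

lemma maximal_stab_exists:
  obtains S B where "nonzero_hom S" "finite B" "complex_over_rat.independent B" "complex_over_rat.span B = stab S"
    "\<And>S'. nonzero_hom S' \<Longrightarrow> stab S \<subseteq> stab S' \<Longrightarrow> stab S' \<subseteq> stab S"
proof -
  define P where "P k \<longleftrightarrow> (\<exists>S B. nonzero_hom S \<and> finite B \<and> complex_over_rat.independent B \<and> B \<subseteq> stab S \<and> card B = k)" for k
  have "nonzero_hom S0" using S0 by (simp add: nonzero_hom_def)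
  then have "P 0" unfolding P_def by (intro exI[of _ S0] exI[of _ "{}"]) (simp add: complex_over_rat.independent_empty)
  moreover have "k \<le> d" if "P k" for k using that stab_bounded unfolding P_def by blast
  ultimately obtain k where k: "P k" "\<And>k'. P k' \<Longrightarrow> k' \<le> k" using ex_has_greatest_nat[of P 0 "\<lambda>k. k" "Suc d"] by (auto simp: less_Suc_eq_le)
  then obtain S B where SB: "nonzero_hom S" "finite B" "complex_over_rat.independent B" "B \<subseteq> stab S" "card B = k"
    unfolding P_def by blast
  have max: "stab S' \<subseteq> complex_over_rat.span B" if S': "nonzero_hom S'" "B \<subseteq> stab S'" for S'
  proof
    fix x assume x: "x \<in> stab S'"
    show "x \<in> complex_over_rat.span B"
    proof (rule ccontr)
      assume nx: "x \<notin> complex_over_rat.span B"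
      then have "complex_over_rat.independent (insert x B)" "x \<notin> B"
        using SB(3) complex_over_rat.independent_insertI complex_over_rat.span_base by blast+
      then have "P (Suc k)"
        unfolding P_def using SB x S' by (intro exI[of _ S'] exI[of _ "insert x B"]) auto
      then show False using k(2)[of "Suc k"] by simp
    qed
  qed
  have "complex_over_rat.span B = stab S"
    using max[OF SB(1,4)] complex_over_rat.span_minimal[OF SB(4) stab_subspace[OF SB(1)]] by blast
  then show ?thesis using SB max complex_over_rat.span_superset by (intro that[of S B]) auto
qed

end

section \<open>A splitting field of minimal degree\<close>

lemma mat_eq_if_agree:
  fixes A :: "'a::semiring_1 mat"
  assumes "A \<in> carrier_mat r c" "B \<in> carrier_mat r c" "\<And>v. v \<in> carrier_vec c \<Longrightarrow> A *\<^sub>v v = B *\<^sub>v v"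
  shows "A = B"
proof (rule mat_col_eqI)
  fix i assume "i < dim_col B"
  then show "col A i = col B i"
    using assms(3)[of "unit_vec c i"] assms(1,2) by (simp add: col_mult_unit_vec)
qed (use assms in auto)

context rational_irrep
begin

definition relation :: "complex mat \<Rightarrow> nat set \<Rightarrow> (nat \<Rightarrow> complex) \<Rightarrow> (nat \<Rightarrow> rat vec) \<Rightarrow> bool" where
  "relation S I c w \<longleftrightarrow> (\<forall>i\<in>I. w i \<in> carrier_vec d) \<and> (\<forall>k<n. (\<Sum>i\<in>I. c i * rimage S (w i) $ k) = 0)"

text \<open>For N = S(Q^d) and L = \<open>stab S\<close>, this is a basis of N over L that is at the
  same time a basis of C^n over C.\<close>

definition image_basis :: "complex mat \<Rightarrow> (nat \<Rightarrow> rat vec) \<Rightarrow> bool" where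
  "image_basis S b \<longleftrightarrow> (\<forall>i<n. b i \<in> carrier_vec d) \<and> (\<forall>c. relation S {..<n} c b \<longrightarrow> (\<forall>i<n. c i = 0)) \<and>
    (\<forall>w\<in>carrier_vec d. \<exists>l. (\<forall>i<n. l i \<in> stab S) \<and> (\<forall>k<n. rimage S w $ k = (\<Sum>i<n. l i * rimage S (b i) $ k)))"

context
  fixes S :: "complex mat"
  assumes S: "nonzero_hom S"
    and max: "\<And>S'. nonzero_hom S' \<Longrightarrow> stab S \<subseteq> stab S' \<Longrightarrow> stab S' \<subseteq> stab S"
begin

private lemmas Sc = nonzero_homD(1)[OF S]

lemma W_covered: "g \<in> carrier G \<Longrightarrow> S * cmat (W g) = V g * S"
  using nonzero_homD(3)[OF S] by (simp add: complexify_def)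

lemma scalar_covered: "S * cmat y = c \<cdot>\<^sub>m S \<Longrightarrow> S * cmat y = (c \<cdot>\<^sub>m 1\<^sub>m n) * S"
  using Sc by (simp add: mult_smult_assoc_mat[OF one_carrier_mat Sc])

text \<open>An element of the commutant of \<open>W\<close> commuting with the subfield \<open>stab S\<close> has an eigenvector among the
  homomorphisms with the same scalars, so by maximality its eigenvalue is already in \<open>stab S\<close>.\<close>

lemma commuting_mat_is_scalar:
  assumes p: "p \<in> carrier_mat d d"
    and comm: "\<And>A M. A \<in> carrier_mat d d \<Longrightarrow> M \<in> carrier_mat n n \<Longrightarrow> S * cmat A = M * S \<Longrightarrow> p * A = A * p"
  shows "\<exists>c. S * cmat p = c \<cdot>\<^sub>m S"
proof -
  \<comment> \<open>\<open>Q S'\<close> asks \<open>S'\<close> to respect every pair (A, M) that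
    \<open>S\<close> respects. The pairs of \<open>W g\<close> with \<open>V g\<close> make
    \<open>S'\<close> equivariant, and the pairs of rational matrices with scalars give that
    \<open>stab S\<close> is contained in \<open>stab S'\<close>.\<close>
  define Q where "Q S' \<longleftrightarrow> (\<forall>A\<in>carrier_mat d d. \<forall>M\<in>carrier_mat n n. S * cmat A = M * S \<longrightarrow> S' * cmat A = M * S')" for S'
  have P: "cmat p \<in> carrier_mat d d" using p by simp
  have "\<exists>S' c. S' \<in> carrier_mat n d \<and> S' \<noteq> 0\<^sub>m n d \<and> Q S' \<and> S' * cmat p = c \<cdot>\<^sub>m S'"
  proof (rule right_eigenvector_exists[OF P Sc nonzero_homD(2)[OF S]])
    show "Q S" by (simp add: Q_def)
    fix S' c assume S': "S' \<in> carrier_mat n d" "Q S'"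
    show "Q (S' * cmat p - c \<cdot>\<^sub>m S')"
      unfolding Q_def
    proof (intro ballI impI)
      fix A :: "rat mat" and M assume A: "A \<in> carrier_mat d d" and M: "M \<in> carrier_mat n n" and e: "S * cmat A = M * S"
      have S'A: "S' * cmat A = M * S'" using S'(2) A M e by (simp add: Q_def)
      have cA: "cmat A \<in> carrier_mat d d" using A by simp
      have Sp: "S' * cmat p \<in> carrier_mat n d" using S' P by simp
      have "cmat p * cmat A = cmat A * cmat p"
        unfolding of_rat_hom.mat_hom_mult[OF p A, symmetric] of_rat_hom.mat_hom_mult[OF A p, symmetric] comm[OF A M e] ..
      then have "S' * cmat p * cmat A = S' * (cmat A * cmat p)"
        using S'(1) P cA by simp
      also have "\<dots> = S' * cmat A * cmat p" by (rule assoc_mult_mat[symmetric, OF S'(1) cA P])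
      also have "\<dots> = M * (S' * cmat p)" unfolding S'A by (rule assoc_mult_mat[OF M S'(1) P])
      finally have 1: "S' * cmat p * cmat A = M * (S' * cmat p)" .
      have "(S' * cmat p - c \<cdot>\<^sub>m S') * cmat A = S' * cmat p * cmat A - (c \<cdot>\<^sub>m S') * cmat A"
        by (rule minus_mult_distrib_mat[OF Sp _ cA]) (use S' in simp)
      also have "(c \<cdot>\<^sub>m S') * cmat A = M * (c \<cdot>\<^sub>m S')"
        by (simp only: mult_smult_assoc_mat[OF S'(1) cA] mult_smult_distrib[OF M S'(1)] S'A)
      also have "S' * cmat p * cmat A - M * (c \<cdot>\<^sub>m S') = M * (S' * cmat p - c \<cdot>\<^sub>m S')"
        unfolding 1 by (rule mult_minus_distrib_mat[symmetric, OF M Sp]) (use S' in simp)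
      finally show "(S' * cmat p - c \<cdot>\<^sub>m S') * cmat A = M * (S' * cmat p - c \<cdot>\<^sub>m S')" .
    qed
  qed
  then obtain S' c where S': "S' \<in> carrier_mat n d" "S' \<noteq> 0\<^sub>m n d" "Q S'" "S' * cmat p = c \<cdot>\<^sub>m S'" by blast
  have "S' * WC g = V g * S'" if g: "g \<in> carrier G" for g
    using S'(3) W_covered[OF g] W_carrier[OF g] V_carrier[OF g] unfolding Q_def by (auto simp: complexify_def)
  then have hom: "nonzero_hom S'" using S' by (simp add: nonzero_hom_def)
  have scalar: "S' * cmat y = c' \<cdot>\<^sub>m S'" if y: "y \<in> carrier_mat d d" "S * cmat y = c' \<cdot>\<^sub>m S" for y c'
  proof -
    have "S' * cmat y = (c' \<cdot>\<^sub>m 1\<^sub>m n) * S'"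
      using S'(3) y(1) scalar_covered[OF y(2)] unfolding Q_def by simp
    then show ?thesis using S'(1) by (simp add: mult_smult_assoc_mat[OF one_carrier_mat S'(1)])
  qed
  then have "stab S \<subseteq> stab S'" unfolding stab_def by blast
  then have "stab S' \<subseteq> stab S" by (rule max[OF hom])
  moreover have "c \<in> stab S'" using S'(4) p by (auto simp: stab_def)
  \<comment> \<open>By maximality \<open>c\<close> is realized by some \<open>y\<close> already for
    \<open>S\<close>. Under the injective map \<open>rimage S'\<close> both \<open>p\<close> and
    \<open>y\<close> become multiplication by \<open>c\<close>, so they coincide.\<close>
  ultimately obtain y where y: "y \<in> carrier_mat d d" "S * cmat y = c \<cdot>\<^sub>m S" by (auto simp: stab_def)
  have "p *\<^sub>v w = y *\<^sub>v w" if w: "w \<in> carrier_vec d" for w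
  proof -
    have pw: "p *\<^sub>v w \<in> carrier_vec d" "y *\<^sub>v w \<in> carrier_vec d" using p y w by auto
    have "rimage S' (p *\<^sub>v w - y *\<^sub>v w) = rimage S' (p *\<^sub>v w + (-1) \<cdot>\<^sub>v (y *\<^sub>v w))"
      using pw by (intro arg_cong[of _ _ "rimage S'"] eq_vecI) auto
    also have "\<dots> = c \<cdot>\<^sub>v rimage S' w + of_rat (-1) \<cdot>\<^sub>v (c \<cdot>\<^sub>v rimage S' w)"
      using pw by (simp add: rimage_add[OF S'(1)] rimage_smult[OF S'(1)] rimage_scalar[OF S'(1) p w S'(4)]
          rimage_scalar[OF S'(1) y(1) w scalar[OF y]])
    also have "\<dots> = 0\<^sub>v n" using S'(1) by (intro eq_vecI) auto
    finally have "p *\<^sub>v w - y *\<^sub>v w = 0\<^sub>v d" using rimage_injective[OF hom] pw by simp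
    then show ?thesis by (rule vec_eq_if_diff_zero[OF pw])
  qed
  then have "p = y" using mat_eq_if_agree[OF p y(1)] by blast
  then show ?thesis using y by blast
qed

text \<open>Complex linearity of \<open>M\<close> lets it pass through the coefficients. Taking
  \<open>W g\<close> for \<open>A\<close> makes the relations with fixed coefficients a
  representation of the group; general pairs serve to show that certain endomorphisms
  commute.\<close>

lemma relation_covered:
  assumes "relation S I c w" "A \<in> carrier_mat d d" "M \<in> carrier_mat n n" "S * cmat A = M * S"
  shows "relation S I c (\<lambda>i. A *\<^sub>v w i)"
proof -
  have "(\<Sum>i\<in>I. c i * rimage S (A *\<^sub>v w i) $ k) = 0" if k: "k < n" for k
  proof -
    have w: "w i \<in> carrier_vec d" if "i \<in> I" for i using assms(1) that by (simp add: relation_def)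
    have "(\<Sum>i\<in>I. c i * rimage S (A *\<^sub>v w i) $ k) = (\<Sum>i\<in>I. \<Sum>l<n. M $$ (k, l) * (c i * rimage S (w i) $ l))"
      using w k by (intro sum.cong refl)
        (simp add: rimage_mult[OF Sc assms(2) _ assms(3,4)] index_mult_mat_vec_sum[OF assms(3) rimage_carrier[OF Sc]]
          sum_distrib_left mult_ac del: index_mult_mat_vec)
    also have "\<dots> = (\<Sum>l<n. M $$ (k, l) * (\<Sum>i\<in>I. c i * rimage S (w i) $ l))"
      by (subst sum.swap) (simp add: sum_distrib_left)
    also have "\<dots> = 0" using assms(1) by (simp add: relation_def)
    finally show ?thesis .
  qed
  then show ?thesis using assms by (auto simp: relation_def)
qed

lemma relation_add: "relation S I c u \<Longrightarrow> relation S I c v \<Longrightarrow> relation S I c (\<lambda>i. u i + v i)"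
  using Sc by (simp add: relation_def rimage_add[OF Sc] distrib_left sum.distrib)

lemma relation_smult: "relation S I c u \<Longrightarrow> relation S I c (\<lambda>i. q \<cdot>\<^sub>v u i)"
proof -
  assume u: "relation S I c u"
  have "(\<Sum>i\<in>I. c i * rimage S (q \<cdot>\<^sub>v u i) $ k) = of_rat q * (\<Sum>i\<in>I. c i * rimage S (u i) $ k)" if "k < n" for k
    unfolding sum_distrib_left using u that Sc
    by (intro sum.cong refl) (simp add: relation_def rimage_smult[OF Sc])
  then show ?thesis using u by (auto simp: relation_def)
qed

lemma relation_zero: "relation S I c (\<lambda>i. 0\<^sub>v d)"
proof -
  show ?thesis by (simp add: relation_def rimage_zero[OF Sc])
qed

text \<open>Injectivity of \<open>N \<otimes>\<^sub>L \<complex> \<rightarrow> \<complex>\<^sup>n\<close> for \<open>N = S(\<rat>\<^sup>d)\<close> and \<open>L = stab S\<close>: the relations with coefficients \<open>c\<close> form a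
  representation which, by induction, is the graph over one coordinate of endomorphisms of \<open>N\<close>, and these are
  scalars in \<open>L\<close>.\<close>

lemma relation_coefficients_dependent:
  assumes "finite I" "relation S I c w" "\<exists>i\<in>I. w i \<noteq> 0\<^sub>v d"
  shows "\<exists>l. (\<forall>i\<in>I. l i \<in> stab S) \<and> (\<exists>i\<in>I. l i \<noteq> 0) \<and> (\<Sum>i\<in>I. c i * l i) = 0"
  using assms
proof (induction I arbitrary: w rule: finite_psubset_induct)
  case (psubset I)
  obtain i0 where i0: "i0 \<in> I" "w i0 \<noteq> 0\<^sub>v d" using psubset.prems by blast
  show ?case
  proof (rule ccontr)
    assume "\<not> ?case"
    then have indep: "l i = 0" if "\<forall>i\<in>I. l i \<in> stab S" "(\<Sum>i\<in>I. c i * l i) = 0" "i \<in> I" for l i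
      using that by blast
    \<comment> \<open>A relation vanishing at \<open>i0\<close> lives on a smaller index set, where
      the induction hypothesis would give a dependence of the coefficients; extended by 0 at
      \<open>i0\<close>, it contradicts \<open>indep\<close>.\<close>
    have vanish: "u i = 0\<^sub>v d" if u: "relation S I c u" "u i0 = 0\<^sub>v d" and i: "i \<in> I" for u i
    proof (rule ccontr)
      assume ne: "u i \<noteq> 0\<^sub>v d"
      define J where "J = I - {i0}"
      have J: "J \<subset> I" "i \<in> J" "finite J" using i0 i ne u(2) psubset.hyps by (auto simp: J_def)
      have z: "rimage S (u i0) = 0\<^sub>v n"
        by (simp add: u(2) rimage_zero[OF Sc])
      have "relation S J c u"
        using u i0 z psubset.hyps by (simp add: relation_def J_def sum_diff1)
      then obtain l where l: "\<forall>i\<in>J. l i \<in> stab S" "\<exists>i\<in>J. l i \<noteq> 0" "(\<Sum>i\<in>J. c i * l i) = 0"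
        using psubset.IH[OF J(1)] J(2) ne by blast
      define l' where "l' i = (if i = i0 then 0 else l i)" for i
      have "0 \<in> stab S" using stab_rat[OF S, of 0] by simp
      then have "\<forall>i\<in>I. l' i \<in> stab S" using l(1) by (auto simp: l'_def J_def)
      moreover have "(\<Sum>i\<in>I. c i * l' i) = (\<Sum>i\<in>J. c i * l i)"
        using psubset.hyps by (intro sum.mono_neutral_cong_right) (auto simp: l'_def J_def)
      ultimately have "\<forall>i\<in>I. l' i = 0" using indep l(3) by simp
      moreover obtain i where "i \<in> J" "l i \<noteq> 0" using l(2) by blast
      ultimately show False by (auto simp: l'_def J_def)
    qed
    \<comment> \<open>The projection of the space of relations to coordinate \<open>i0\<close> is
      \<open>W\<close>-invariant and contains the nonzero vector \<open>w i0\<close>, so it is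
      surjective.\<close>
    define U where "U = {u i0 | u. relation S I c u}"
    have "U = {0\<^sub>v d} \<or> U = carrier_vec d"
    proof (rule irreducible_rep_dichotomy[OF W_irr])
      show "U \<subseteq> carrier_vec d" using i0 by (auto simp: U_def relation_def)
      show "0\<^sub>v d \<in> U" unfolding U_def using relation_zero by (intro CollectI exI[of _ "\<lambda>i. 0\<^sub>v d"]) simp
      show "u + v \<in> U" if uv: "u \<in> U" "v \<in> U" for u v
      proof -
        obtain u' v' where "relation S I c u'" "relation S I c v'" "u = u' i0" "v = v' i0" using uv by (auto simp: U_def)
        then show ?thesis unfolding U_def using relation_add by (intro CollectI exI[of _ "\<lambda>i. u' i + v' i"]) simp
      qed
      show "q \<cdot>\<^sub>v u \<in> U" if u: "u \<in> U" for q u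
      proof -
        obtain u' where "relation S I c u'" "u = u' i0" using u by (auto simp: U_def)
        then show ?thesis unfolding U_def using relation_smult by (intro CollectI exI[of _ "\<lambda>i. q \<cdot>\<^sub>v u' i"]) simp
      qed
      show "W g *\<^sub>v u \<in> U" if g: "g \<in> carrier G" and u: "u \<in> U" for g u
      proof -
        obtain u' where "relation S I c u'" "u = u' i0" using u by (auto simp: U_def)
        then show ?thesis
          unfolding U_def using relation_covered[OF _ W_carrier[OF g] V_carrier[OF g] W_covered[OF g]]
          by (intro CollectI exI[of _ "\<lambda>i. W g *\<^sub>v u' i"]) simp
      qed
    qed
    moreover have "w i0 \<in> U" using psubset.prems by (auto simp: U_def)
    ultimately have U: "U = carrier_vec d" using i0 by auto
    have "\<forall>a. \<exists>u. relation S I c u \<and> u i0 = unit_vec d a"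
    proof
      fix a have "unit_vec d a \<in> U" unfolding U by simp
      then show "\<exists>u. relation S I c u \<and> u i0 = unit_vec d a" unfolding U_def by force
    qed
    then obtain b where b: "\<And>a. relation S I c (b a)" "\<And>a. b a i0 = unit_vec d a" by metis
    \<comment> \<open>Its columns are the i-th entries of relations whose entry at \<open>i0\<close>
      is a unit vector: \<open>p i\<close> is the linear map expressing entry i through entry
      \<open>i0\<close>.\<close>
    define p where "p i = mat d d (\<lambda>(k, a). b a i $ k)" for i
    have p: "p i \<in> carrier_mat d d" for i by (simp add: p_def)
    have b_car: "b a i \<in> carrier_vec d" if "i \<in> I" for a i using b(1) that by (simp add: relation_def)
    have p_rel: "relation S I c (\<lambda>i. p i *\<^sub>v x)" if x: "x \<in> carrier_vec d" for x
    proof -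
      have "(\<Sum>i\<in>I. c i * rimage S (p i *\<^sub>v x) $ k) = 0" if k: "k < n" for k
      proof -
        have "rimage S (p i *\<^sub>v x) $ k = (\<Sum>a<d. of_rat (x $ a) * rimage S (b a i) $ k)" if i: "i \<in> I" for i
        proof -
          have "rimage S (p i *\<^sub>v x) $ k = (S *\<^sub>v (cmat (p i) *\<^sub>v cvec x)) $ k"
            by (simp add: rimage_def of_rat_hom.mult_mat_vec_hom[OF p x])
          also have "\<dots> = (\<Sum>a<d. cvec x $ a * (S *\<^sub>v col (cmat (p i)) a) $ k)"
            by (rule mult_mat_vec_as_sum_cols) (use p Sc k x in auto)
          also have "\<dots> = (\<Sum>a<d. of_rat (x $ a) * rimage S (b a i) $ k)"
          proof (intro sum.cong refl)
            fix a assume a: "a \<in> {..<d}"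
            have "col (cmat (p i)) a = cvec (b a i)"
              using a b_car[OF i, of a] by (intro eq_vecI) (auto simp: p_def)
            then show "cvec x $ a * (S *\<^sub>v col (cmat (p i)) a) $ k = of_rat (x $ a) * rimage S (b a i) $ k"
              using a x by (simp add: rimage_def)
          qed
          finally show ?thesis .
        qed
        then have "(\<Sum>i\<in>I. c i * rimage S (p i *\<^sub>v x) $ k)
            = (\<Sum>i\<in>I. \<Sum>a<d. of_rat (x $ a) * (c i * rimage S (b a i) $ k))"
          by (simp add: sum_distrib_left mult_ac)
        also have "\<dots> = (\<Sum>a<d. of_rat (x $ a) * (\<Sum>i\<in>I. c i * rimage S (b a i) $ k))"
          by (subst sum.swap) (simp add: sum_distrib_left)
        also have "\<dots> = 0" using b(1) k by (simp add: relation_def)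
        finally show ?thesis .
      qed
      then show ?thesis using mult_mat_vec_carrier[OF p x] by (simp add: relation_def)
    qed
    have "p i0 = 1\<^sub>m d" by (intro eq_matI) (auto simp: p_def b(2))
    then have p_i0: "p i0 *\<^sub>v x = x" if "x \<in> carrier_vec d" for x using that by simp
    have graph: "u i = p i *\<^sub>v u i0" if u: "relation S I c u" and i: "i \<in> I" for u i
    proof -
      have ui: "u i \<in> carrier_vec d" "u i0 \<in> carrier_vec d" using u i i0 by (auto simp: relation_def)
      have pu: "p i *\<^sub>v u i0 \<in> carrier_vec d" by (rule mult_mat_vec_carrier[OF p ui(2)])
      have r: "relation S I c (\<lambda>i. u i + (-1) \<cdot>\<^sub>v (p i *\<^sub>v u i0))"
        by (intro relation_add relation_smult u p_rel ui)
      have "u i0 + (-1) \<cdot>\<^sub>v (p i0 *\<^sub>v u i0) = 0\<^sub>v d"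
        unfolding p_i0[OF ui(2)] using ui by (intro eq_vecI) auto
      then have "u i + (-1) \<cdot>\<^sub>v (p i *\<^sub>v u i0) = 0\<^sub>v d"
        using vanish[OF r _ i] by simp
      then have "(u i + (-1) \<cdot>\<^sub>v (p i *\<^sub>v u i0)) $ k = 0" if "k < d" for k using that by simp
      then show ?thesis using ui pu p[of i] by (intro eq_vecI) (auto simp del: index_mult_mat_vec)
    qed
    have "\<exists>c. S * cmat (p i) = c \<cdot>\<^sub>m S" if i: "i \<in> I" for i
    proof (rule commuting_mat_is_scalar[OF p])
      fix A :: "rat mat" and M assume A: "A \<in> carrier_mat d d" "M \<in> carrier_mat n n" "S * cmat A = M * S"
      \<comment> \<open>Applying \<open>A\<close> to a relation gives another relation, and
        comparing its entries at \<open>i\<close> and at \<open>i0\<close> through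
        \<open>graph\<close> is exactly the commutation.\<close>
      show "p i * A = A * p i"
      proof (rule mat_eq_if_agree[of _ d d])
        fix x :: "rat vec" assume x: "x \<in> carrier_vec d"
        have "A *\<^sub>v (p i *\<^sub>v x) = p i *\<^sub>v (A *\<^sub>v (p i0 *\<^sub>v x))"
          by (rule graph[OF relation_covered[OF p_rel[OF x] A] i])
        then show "p i * A *\<^sub>v x = A * p i *\<^sub>v x"
          by (simp only: p_i0[OF x] assoc_mult_mat_vec[OF p A(1) x] assoc_mult_mat_vec[OF A(1) p x])
      qed (rule mult_carrier_mat[OF p A(1)], rule mult_carrier_mat[OF A(1) p])
    qed
    then obtain l where l: "\<And>i. i \<in> I \<Longrightarrow> S * cmat (p i) = l i \<cdot>\<^sub>m S" by metis
    \<comment> \<open>Once every \<open>p i\<close> is a scalar \<open>l i\<close>, evaluating one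
      relation at a vector with nonzero image gives a dependence of the coefficients in which
      \<open>l i0\<close> is 1, contrary to \<open>indep\<close>.\<close>
    define e where "e = (unit_vec d 0 :: rat vec)"
    have e: "e \<in> carrier_vec d" by (simp add: e_def)
    obtain k where k: "k < n" "rimage S e $ k \<noteq> 0" unfolding e_def by (rule rimage_unit_nonzero[OF S])
    have le: "rimage S (p i *\<^sub>v e) = l i \<cdot>\<^sub>v rimage S e" if "i \<in> I" for i
      by (rule rimage_scalar[OF Sc p e l[OF that]])
    have "(\<Sum>i\<in>I. c i * l i) * rimage S e $ k = (\<Sum>i\<in>I. c i * rimage S (p i *\<^sub>v e) $ k)"
      using k Sc by (simp add: le sum_distrib_left sum_distrib_right mult_ac)
    also have "\<dots> = 0" using p_rel[OF e] k by (simp add: relation_def)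
    finally have "(\<Sum>i\<in>I. c i * l i) = 0" using k by simp
    moreover have "\<forall>i\<in>I. l i \<in> stab S" using l p by (auto simp: stab_def)
    ultimately have "l i0 = 0" using indep i0 by blast
    moreover have "rimage S e $ k = l i0 * rimage S e $ k"
      using arg_cong[OF le[OF i0(1)], of "\<lambda>v. v $ k"] k Sc by (simp add: p_i0[OF e])
    ultimately show False using k by simp
  qed
qed

text \<open>Elimination: a dependence of the coefficients over \<open>stab S\<close> expresses one
  coefficient through the others, and substituting it leaves a shorter relation with modified
  vectors. Undoing the modification turns a dependence over \<open>stab S\<close> of the new vectors
  into one of the old.\<close>

lemma relation_vectors_dependent:
  assumes "finite I" "relation S I c w" "\<exists>i\<in>I. c i \<noteq> 0"
  shows "\<exists>l. (\<forall>i\<in>I. l i \<in> stab S) \<and> (\<exists>i\<in>I. l i \<noteq> 0) \<and> relation S I l w"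
  using assms
proof (induction I arbitrary: w rule: finite_psubset_induct)
  case (psubset I)
  have w: "w i \<in> carrier_vec d" if "i \<in> I" for i using psubset.prems(1) that by (simp add: relation_def)
  have one: "1 \<in> stab S" using stab_rat[OF S, of 1] by simp
  show ?case
  proof (cases "\<exists>i\<in>I. w i \<noteq> 0\<^sub>v d")
    case False
    then show ?thesis
      using one psubset.prems by (intro exI[of _ "\<lambda>_. 1"]) (auto simp: relation_def rimage_zero[OF Sc])
  next
    case True
    then obtain l k where l: "\<forall>i\<in>I. l i \<in> stab S" "(\<Sum>i\<in>I. c i * l i) = 0" and k: "k \<in> I" "l k \<noteq> 0"
      using relation_coefficients_dependent[OF psubset.hyps psubset.prems(1)] by blast
    define r where "r i = l i / l k" for i
    have r: "r i \<in> stab S" if "i \<in> I" for i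
      using l k that by (simp add: r_def divide_inverse stab_mult[OF S] stab_inverse[OF S])
    have "\<forall>i\<in>I. \<exists>y. y \<in> carrier_mat d d \<and> S * cmat y = r i \<cdot>\<^sub>m S" using r by (auto simp: stab_def)
    then obtain y where y: "\<And>i. i \<in> I \<Longrightarrow> y i \<in> carrier_mat d d" "\<And>i. i \<in> I \<Longrightarrow> S * cmat (y i) = r i \<cdot>\<^sub>m S"
      by metis
    define J where "J = I - {k}"
    have J: "J \<subset> I" "finite J" "I = insert k J" "k \<notin> J" using k psubset.hyps by (auto simp: J_def)
    have "(\<Sum>i\<in>I. c i * r i) = 0" using l(2) by (simp add: r_def sum_divide_distrib[symmetric])
    then have ck: "c k = - (\<Sum>i\<in>J. c i * r i)"
      using k J by (simp add: r_def eq_neg_iff_add_eq_0)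
    \<comment> \<open>Since \<open>y i\<close> realizes the scalar \<open>r i\<close>, the image of
      \<open>v i\<close> is that of \<open>w i\<close> minus \<open>r i\<close> times that of
      \<open>w k\<close>. The formula for \<open>c k\<close> is what makes the \<open>v i\<close>
      satisfy a relation with the remaining coefficients.\<close>
    define v where "v i = w i + (-1) \<cdot>\<^sub>v (y i *\<^sub>v w k)" for i
    have yw: "y i *\<^sub>v w k \<in> carrier_vec d" if "i \<in> J" for i
      using y(1)[of i] w[OF k(1)] that J by simp
    have v: "v i \<in> carrier_vec d" "\<And>m. m < n \<Longrightarrow> rimage S (v i) $ m = rimage S (w i) $ m - r i * rimage S (w k) $ m" if "i \<in> J" for i
    proof -
      have i: "i \<in> I" using that J by auto
      show "v i \<in> carrier_vec d" using yw[OF that] w[OF i] by (simp add: v_def)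
      show "rimage S (v i) $ m = rimage S (w i) $ m - r i * rimage S (w k) $ m" if "m < n" for m
        using yw[OF \<open>i \<in> J\<close>] w[OF i] w[OF k(1)] that Sc
        by (simp add: v_def rimage_add[OF Sc] rimage_smult[OF Sc] rimage_scalar[OF Sc y(1)[OF i] w[OF k(1)] y(2)[OF i]])
    qed
    have sum_v: "(\<Sum>i\<in>J. a i * rimage S (v i) $ m) = (\<Sum>i\<in>J. a i * rimage S (w i) $ m) - (\<Sum>i\<in>J. a i * r i) * rimage S (w k) $ m"
      if "m < n" for a m
      using that by (simp add: v right_diff_distrib sum_subtractf sum_distrib_left sum_distrib_right mult_ac)
    have "relation S J c v"
      unfolding relation_def using psubset.prems(1) J
      by (auto simp: relation_def v(1) sum_v ck)
    moreover have "\<exists>i\<in>J. c i \<noteq> 0"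
    proof (rule ccontr)
      assume zero: "\<not> (\<exists>i\<in>J. c i \<noteq> 0)"
      then have "c k = 0" by (simp add: ck)
      then show False using zero psubset.prems(2) J by auto
    qed
    ultimately obtain a where a: "\<forall>i\<in>J. a i \<in> stab S" "\<exists>i\<in>J. a i \<noteq> 0" "relation S J a v"
      using psubset.IH[OF J(1)] by blast
    define a' where "a' i = (if i = k then - (\<Sum>i\<in>J. a i * r i) else a i)" for i
    have "(\<Sum>i\<in>J. a i * r i) \<in> stab S"
      using a(1) r J by (intro complex_over_rat.subspace_sum[OF stab_subspace[OF S]] stab_mult[OF S]) auto
    then have "\<forall>i\<in>I. a' i \<in> stab S" using a(1) J by (auto simp: a'_def stab_uminus[OF S])
    moreover have "\<exists>i\<in>I. a' i \<noteq> 0" using a(2) J by (auto simp: a'_def)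
    moreover have "relation S I a' w"
    proof -
      have "(\<Sum>i\<in>I. a' i * rimage S (w i) $ m) = 0" if m: "m < n" for m
      proof -
        have "(\<Sum>i\<in>J. a' i * rimage S (w i) $ m) = (\<Sum>i\<in>J. a i * rimage S (w i) $ m)"
          using J by (intro sum.cong) (auto simp: a'_def)
        then have "(\<Sum>i\<in>I. a' i * rimage S (w i) $ m) = (\<Sum>i\<in>J. a i * rimage S (v i) $ m)"
          using J(2,4) unfolding J(3) sum_v[OF m] by (simp add: a'_def)
        then show ?thesis using a(3) m by (simp add: relation_def)
      qed
      then show ?thesis using w by (simp add: relation_def)
    qed
    ultimately show ?thesis by blast
  qed
qed

text \<open>A longest family of rational vectors with complex-independent images is taken. Any
  further vector then satisfies a complex relation with it, and
  \<open>relation_vectors_dependent\<close> supplies coefficients in \<open>stab S\<close>.\<close>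

lemma image_basis_exists: "\<exists>b. image_basis S b"
proof -
  define indep where "indep t b \<longleftrightarrow> (\<forall>i<t. b i \<in> carrier_vec d) \<and> (\<forall>c. relation S {..<t} c b \<longrightarrow> (\<forall>i<t. c i = 0))" for t b
  have mat_rel: "(mat n t (\<lambda>(k, i). rimage S (b i) $ k) *\<^sub>v v) $ k = (\<Sum>i<t. v $ i * rimage S (b i) $ k)"
    if "v \<in> carrier_vec t" "k < n" for t b v k
    using that by (subst index_mult_mat_vec_sum[of _ n t]) (auto simp: mult.commute)
  have bound: "t \<le> n" if ind: "indep t b" for t b
  proof (rule injective_mat_dim_le)
    show "mat n t (\<lambda>(k, i). rimage S (b i) $ k) \<in> carrier_mat n t" by simp
    fix v :: "complex vec" assume v: "v \<in> carrier_vec t" "mat n t (\<lambda>(k, i). rimage S (b i) $ k) *\<^sub>v v = 0\<^sub>v n"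
    have "(\<Sum>i<t. v $ i * rimage S (b i) $ k) = 0" if "k < n" for k
      unfolding mat_rel[OF v(1) that, symmetric] v(2) using that by simp
    moreover have "\<forall>i\<in>{..<t}. b i \<in> carrier_vec d" using ind unfolding indep_def by blast
    ultimately have "relation S {..<t} (\<lambda>i. v $ i) b" unfolding relation_def by blast
    then have "\<forall>i<t. v $ i = 0" using ind unfolding indep_def by blast
    then show "v = 0\<^sub>v t" using v(1) by (intro eq_vecI) simp_all
  qed
  have "indep 0 (\<lambda>_. 0\<^sub>v d)" by (simp add: indep_def)
  then obtain t where t: "\<exists>b. indep t b" "\<And>t'. \<exists>b. indep t' b \<Longrightarrow> t' \<le> t"
    using ex_has_greatest_nat[of "\<lambda>t. \<exists>b. indep t b" 0 "\<lambda>t. t" "Suc n"] bound by (auto simp: less_Suc_eq_le)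
  then obtain b where b: "indep t b" by blast
  have coeff: "\<exists>l. (\<forall>i<t. l i \<in> stab S) \<and> (\<forall>k<n. rimage S w $ k = (\<Sum>i<t. l i * rimage S (b i) $ k))"
    if w: "w \<in> carrier_vec d" for w
  proof -
    define b' where "b' = b(t := w)"
    have b'_t: "relation S {..<t} l b' = relation S {..<t} l b" for l
      unfolding relation_def b'_def by (auto cong: sum.cong_simp)
    have "\<not> indep (Suc t) b'" using t(2)[of "Suc t"] by auto
    moreover have "\<forall>i<t. b i \<in> carrier_vec d" using b unfolding indep_def by blast
    then have "\<forall>i<Suc t. b' i \<in> carrier_vec d" using w by (simp add: b'_def less_Suc_eq)
    ultimately obtain c where "relation S {..<Suc t} c b'" "\<exists>i\<in>{..<Suc t}. c i \<noteq> 0"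
      unfolding indep_def by blast
    then obtain l where l: "\<forall>i\<in>{..<Suc t}. l i \<in> stab S" "\<exists>i\<in>{..<Suc t}. l i \<noteq> 0" "relation S {..<Suc t} l b'"
      using relation_vectors_dependent[of "{..<Suc t}" c b'] by blast
    have rel: "(\<Sum>i<t. l i * rimage S (b i) $ k) + l t * rimage S w $ k = 0" if "k < n" for k
      using l(3) that by (simp add: relation_def b'_def)
    have lt: "l t \<noteq> 0"
    proof
      assume 0: "l t = 0"
      moreover have "\<forall>i\<in>{..<t}. b i \<in> carrier_vec d" using b unfolding indep_def by blast
      ultimately have "relation S {..<t} l b" using rel unfolding relation_def by simp
      then have "\<forall>i<t. l i = 0" using b unfolding indep_def by blast
      then show False using l(2) 0 by (auto simp: less_Suc_eq)
    qed
    show ?thesis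
    proof (intro exI[of _ "\<lambda>i. - (l i / l t)"] conjI allI impI)
      fix i assume "i < t"
      then show "- (l i / l t) \<in> stab S"
        using l(1) by (auto simp: divide_inverse intro!: stab_uminus[OF S] stab_mult[OF S] stab_inverse[OF S])
    next
      fix k assume "k < n"
      have "l t * rimage S w $ k = - (\<Sum>i<t. l i * rimage S (b i) $ k)"
        using rel[OF \<open>k < n\<close>] by (simp add: eq_neg_iff_add_eq_0 add.commute)
      then have "rimage S w $ k = - (\<Sum>i<t. l i * rimage S (b i) $ k) / l t"
        using lt by (metis nonzero_mult_div_cancel_left)
      then show "rimage S w $ k = (\<Sum>i<t. - (l i / l t) * rimage S (b i) $ k)"
        by (simp add: sum_divide_distrib sum_negf)
    qed
  qed
  \<comment> \<open>\<open>S\<close> has a right inverse by irreducibility of \<open>V\<close>, and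
    its columns are combinations of the \<open>t\<close> chosen vectors, so the identity of size
    \<open>n\<close> factors through dimension \<open>t\<close>.\<close>
  have "n \<le> t"
  proof -
    obtain X where X: "X \<in> carrier_mat d n" "S * X = 1\<^sub>m n"
      using irreducible_rep_surjective[OF irr nonzero_homD[OF S] WC_carrier] by blast
    have "\<forall>a. \<exists>l. a < d \<longrightarrow> (\<forall>k<n. S $$ (k, a) = (\<Sum>i<t. l i * rimage S (b i) $ k))"
    proof
      fix a
      show "\<exists>l. a < d \<longrightarrow> (\<forall>k<n. S $$ (k, a) = (\<Sum>i<t. l i * rimage S (b i) $ k))"
      proof (cases "a < d")
        case True
        obtain l where "\<forall>k<n. rimage S (unit_vec d a) $ k = (\<Sum>i<t. l i * rimage S (b i) $ k)"
          using coeff[OF unit_vec_carrier] by blast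
        then show ?thesis using True Sc rimage_unit[OF Sc True] by (intro exI[of _ l]) auto
      qed simp
    qed
    then obtain l where l: "\<And>a k. a < d \<Longrightarrow> k < n \<Longrightarrow> S $$ (k, a) = (\<Sum>i<t. l a i * rimage S (b i) $ k)" by metis
    define Y where "Y = mat t d (\<lambda>(i, a). l a i)"
    define B where "B = mat n t (\<lambda>(k, i). rimage S (b i) $ k)"
    have car: "Y \<in> carrier_mat t d" "B \<in> carrier_mat n t" by (auto simp: Y_def B_def)
    have "S = B * Y"
    proof (rule eq_matI)
      fix k a assume "k < dim_row (B * Y)" "a < dim_col (B * Y)"
      then have ka: "k < n" "a < d" using car by auto
      show "S $$ (k, a) = (B * Y) $$ (k, a)"
        unfolding index_mult_mat_sum[OF car(2,1) ka] using ka by (simp add: l B_def Y_def mult.commute)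
    qed (use Sc car in auto)
    then have BYX: "B * (Y * X) = 1\<^sub>m n" using X car by simp
    have YX: "Y * X \<in> carrier_mat t n" using car X by auto
    show ?thesis
    proof (rule injective_mat_dim_le[OF YX])
      fix v assume v: "v \<in> carrier_vec n" "Y * X *\<^sub>v v = 0\<^sub>v t"
      have "v = B * (Y * X) *\<^sub>v v" using v by (simp add: BYX)
      also have "\<dots> = B *\<^sub>v (Y * X *\<^sub>v v)" by (rule assoc_mult_mat_vec[OF car(2) YX v(1)])
      also have "\<dots> = 0\<^sub>v n" unfolding v(2) by (rule mult_mat_vec_zero[OF car(2)])
      finally show "v = 0\<^sub>v n" .
    qed
  qed
  then have "t = n" using bound[OF b] by simp
  then show ?thesis using b coeff unfolding image_basis_def indep_def by blast
qed

lemma stab_subfield: "subfield (stab S) class_ring"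
proof (rule field.subfieldI'[OF class_field])
  show "subring (stab S) class_ring"
    by (rule ring.subringI[OF class_ring.ring_axioms]) (use stab_rat[OF S, of 1] in \<open>auto simp: class_ring_simps intro: stab_closed[OF S]\<close>)
  show "inv\<^bsub>class_ring\<^esub> k \<in> stab S" if "k \<in> stab S - {\<zero>\<^bsub>class_ring\<^esub>}" for k
    using that by (simp add: class_ring_simps stab_inverse[OF S])
qed

text \<open>In a basis \<open>S (b i)\<close> the group moves basis vectors to images of the
  rational vectors \<open>W g\<close> times \<open>b i\<close>, whose coordinates lie in
  \<open>stab S\<close>.\<close>

lemma realizable_over_stab: "realizable_over G n V (stab S)"
proof -
  obtain b where "image_basis S b" using image_basis_exists by blast
  then have b: "\<And>i. i < n \<Longrightarrow> b i \<in> carrier_vec d"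
    and indep: "\<And>c. relation S {..<n} c b \<Longrightarrow> \<forall>i<n. c i = 0"
    and coeff: "\<And>w. w \<in> carrier_vec d \<Longrightarrow>
      \<exists>l. (\<forall>i<n. l i \<in> stab S) \<and> (\<forall>k<n. rimage S w $ k = (\<Sum>i<n. l i * rimage S (b i) $ k))"
    by (auto simp: image_basis_def)
  define B where "B = mat n n (\<lambda>(k, i). rimage S (b i) $ k)"
  have B: "B \<in> carrier_mat n n" by (simp add: B_def)
  obtain C where C: "C \<in> carrier_mat n n" "B * C = 1\<^sub>m n" "C * B = 1\<^sub>m n"
  proof (rule injective_square_mat_inverse[OF B])
    fix v assume v: "v \<in> carrier_vec n" "B *\<^sub>v v = 0\<^sub>v n"
    have "(\<Sum>i<n. v $ i * rimage S (b i) $ k) = (B *\<^sub>v v) $ k" if "k < n" for k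
      unfolding index_mult_mat_vec_sum[OF B v(1) that] using that by (simp add: B_def mult.commute)
    then have "relation S {..<n} (\<lambda>i. v $ i) b" using b v by (simp add: relation_def)
    then show "v = 0\<^sub>v n" using indep v by (intro eq_vecI) auto
  qed
  have colB: "col B i = rimage S (b i)" if "i < n" for i
    using that Sc by (intro eq_vecI) (auto simp: B_def)
  define \<sigma> where "\<sigma> g = C * V g * B" for g
  have \<sigma>_car: "\<sigma> g \<in> carrier_mat n n" if "g \<in> carrier G" for g using C B V_carrier[OF that] by (auto simp: \<sigma>_def)
  have CV: "C * V g = \<sigma> g * C" if g: "g \<in> carrier G" for g
  proof -
    have CVg: "C * V g \<in> carrier_mat n n" using C V_carrier[OF g] by auto
    have "\<sigma> g * C = C * V g * (B * C)" unfolding \<sigma>_def by (rule assoc_mult_mat[OF CVg B C(1)])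
    then show ?thesis unfolding C(2) right_mult_one_mat[OF CVg] by simp
  qed
  have rep': "is_rep G n \<sigma>"
    unfolding is_rep_def
  proof (intro conjI ballI)
    show "\<sigma> \<one> = 1\<^sub>m n" using B C by (simp add: \<sigma>_def is_rep_one[OF rep])
    fix g h assume g: "g \<in> carrier G" and h: "h \<in> carrier G"
    have VhB: "V h * B \<in> carrier_mat n n" using V_carrier[OF h] B by auto
    have "\<sigma> (g \<otimes> h) = C * V g * (V h * B)"
      unfolding \<sigma>_def is_rep_mult[OF rep g h] assoc_mult_mat[OF C(1) V_carrier[OF g] V_carrier[OF h], symmetric]
      by (rule assoc_mult_mat[OF mult_carrier_mat[OF C(1) V_carrier[OF g]] V_carrier[OF h] B])
    also have "\<dots> = \<sigma> g * (C * (V h * B))"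
      unfolding CV[OF g] by (rule assoc_mult_mat[OF \<sigma>_car[OF g] C(1) VhB])
    also have "C * (V h * B) = \<sigma> h" unfolding \<sigma>_def by (rule assoc_mult_mat[symmetric, OF C(1) V_carrier[OF h] B])
    finally show "\<sigma> (g \<otimes> h) = \<sigma> g * \<sigma> h" .
  qed (rule \<sigma>_car)
  have "C \<in> intertwiners G n V n \<sigma>" using C CV by (auto simp: intertwiners_def)
  moreover have "invertible_mat C"
    unfolding invertible_mat_def inverts_mat_def using B C by (auto intro!: exI[of _ B])
  ultimately have equiv: "equivalent_reps G n V \<sigma>" by (auto simp: equivalent_reps_def)
  have "elements_mat (\<sigma> g) \<subseteq> stab S" if g: "g \<in> carrier G" for g
  proof
    fix x assume "x \<in> elements_mat (\<sigma> g)"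
    then obtain j i where ij: "j < n" "i < n" "x = \<sigma> g $$ (j, i)"
      using \<sigma>_car[OF g] by (auto dest!: elements_matD)
    have "W g *\<^sub>v b i \<in> carrier_vec d" by (rule mult_mat_vec_carrier[OF W_carrier[OF g] b[OF ij(2)]])
    then obtain l where l: "\<And>j. j < n \<Longrightarrow> l j \<in> stab S"
      "\<And>k. k < n \<Longrightarrow> rimage S (W g *\<^sub>v b i) $ k = (\<Sum>j<n. l j * rimage S (b j) $ k)"
      using coeff by blast
    have "V g *\<^sub>v rimage S (b i) = B *\<^sub>v vec n l"
    proof (rule eq_vecI)
      fix k assume "k < dim_vec (B *\<^sub>v vec n l)"
      then have k: "k < n" using B by simp
      have "(B *\<^sub>v vec n l) $ k = (\<Sum>j<n. l j * rimage S (b j) $ k)"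
        unfolding index_mult_mat_vec_sum[OF B vec_carrier k] using k by (simp add: B_def mult.commute)
      also have "\<dots> = (V g *\<^sub>v rimage S (b i)) $ k"
        using l(2)[OF k] rimage_mult[OF Sc W_carrier[OF g] b[OF ij(2)] V_carrier[OF g] W_covered[OF g]] by simp
      finally show "(V g *\<^sub>v rimage S (b i)) $ k = (B *\<^sub>v vec n l) $ k" by simp
    qed (use B V_carrier[OF g] in auto)
    then have "C *\<^sub>v (V g *\<^sub>v col B i) = C *\<^sub>v (B *\<^sub>v vec n l)" using colB[OF ij(2)] by simp
    also have "\<dots> = vec n l"
      using assoc_mult_mat_vec[OF C(1) B vec_carrier, of l] by (simp add: C(3))
    finally have e: "C *\<^sub>v (V g *\<^sub>v col B i) = vec n l" .
    have "col (\<sigma> g) i = C * V g *\<^sub>v col B i"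
      unfolding \<sigma>_def by (rule col_mult2[OF mult_carrier_mat[OF C(1) V_carrier[OF g]] B ij(2)])
    also have "\<dots> = C *\<^sub>v (V g *\<^sub>v col B i)"
      by (rule assoc_mult_mat_vec[OF C(1) V_carrier[OF g]]) (use B ij in auto)
    finally have "col (\<sigma> g) i $ j = l j" using e ij by simp
    then have "x = l j" using ij \<sigma>_car[OF g] by auto
    then show "x \<in> stab S" using l(1) ij by simp
  qed
  then show ?thesis unfolding realizable_over_def using rep' equiv by blast
qed

text \<open>Products of a rational basis of \<open>stab S\<close> with an \<open>image_basis\<close>
  are rationally independent, as in the tower law. They lie in S(Q^d), and their preimages
  \<open>y j\<close> applied to \<open>b i\<close> form the columns of the injective matrix
  \<open>A\<close>, column i r + j belonging to the pair (i, j).\<close>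

lemma stab_dimension_bound:
  assumes B: "finite B" "complex_over_rat.independent B" "complex_over_rat.span B = stab S"
  shows "n * card B \<le> d"
proof -
  obtain b where "image_basis S b" using image_basis_exists by blast
  then have b: "\<And>i. i < n \<Longrightarrow> b i \<in> carrier_vec d"
    and indep: "\<And>c. relation S {..<n} c b \<Longrightarrow> \<forall>i<n. c i = 0"
    by (auto simp: image_basis_def)
  obtain bs where bs: "set bs = B" "distinct bs" using finite_distinct_list[OF B(1)] by blast
  define r where "r = length bs"
  have r: "r = card B" using distinct_card[OF bs(2)] bs(1) by (simp add: r_def)
  have B_stab: "bs ! j \<in> stab S" if "j < r" for j
    using that bs B(3) complex_over_rat.span_superset[of B] by (auto simp: r_def)
  then have "\<forall>j. \<exists>y. j < r \<longrightarrow> y \<in> carrier_mat d d \<and> S * cmat y = bs ! j \<cdot>\<^sub>m S" by (auto simp: stab_def)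
  then obtain y where y: "\<And>j. j < r \<Longrightarrow> y j \<in> carrier_mat d d" "\<And>j. j < r \<Longrightarrow> S * cmat (y j) = bs ! j \<cdot>\<^sub>m S" by metis
  define A where "A = mat d (n * r) (\<lambda>(k, a). (y (a mod r) *\<^sub>v b (a div r)) $ k)"
  have A: "A \<in> carrier_mat d (n * r)" by (simp add: A_def)
  have idx: "a div r < n" "a mod r < r" if "a < n * r" for a
  proof -
    show "a div r < n" using that by (rule less_mult_imp_div_less)
    have "r > 0" using that by (cases r) auto
    then show "a mod r < r" by simp
  qed
  have colA: "col A a = y (a mod r) *\<^sub>v b (a div r)" if a: "a < n * r" for a
    using a y(1)[OF idx(2)[OF a]] by (intro eq_vecI) (auto simp: A_def simp del: index_mult_mat_vec)
  have "n * r \<le> d"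
  proof (rule injective_mat_dim_le[OF A])
    fix v assume v: "v \<in> carrier_vec (n * r)" "A *\<^sub>v v = 0\<^sub>v d"
    define c where "c i = (\<Sum>j<r. of_rat (v $ (i * r + j)) * bs ! j)" for i
    have "(\<Sum>i<n. c i * rimage S (b i) $ k) = 0" if k: "k < n" for k
    proof -
      have "0 = (S *\<^sub>v (cmat A *\<^sub>v cvec v)) $ k"
        using A v Sc k by (simp add: of_rat_hom.mult_mat_vec_hom[symmetric, OF A v(1)] of_rat_hom.vec_hom_zero mult_mat_vec_zero)
      also have "\<dots> = (\<Sum>a<n * r. cvec v $ a * (S *\<^sub>v col (cmat A) a) $ k)"
        by (rule mult_mat_vec_as_sum_cols) (use A v Sc k in auto)
      also have "\<dots> = (\<Sum>a<n * r. of_rat (v $ a) * (bs ! (a mod r) * rimage S (b (a div r)) $ k))"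
      proof (intro sum.cong refl)
        fix a assume "a \<in> {..<n * r}"
        then have a: "a < n * r" by simp
        have "S *\<^sub>v col (cmat A) a = rimage S (y (a mod r) *\<^sub>v b (a div r))"
          using a A by (simp add: rimage_def col_map_mat colA)
        also have "\<dots> = bs ! (a mod r) \<cdot>\<^sub>v rimage S (b (a div r))"
          by (rule rimage_scalar[OF Sc y(1)[OF idx(2)[OF a]] b[OF idx(1)[OF a]] y(2)[OF idx(2)[OF a]]])
        finally show "cvec v $ a * (S *\<^sub>v col (cmat A) a) $ k = of_rat (v $ a) * (bs ! (a mod r) * rimage S (b (a div r)) $ k)"
          using a v k Sc by simp
      qed
      also have "\<dots> = (\<Sum>i<n. \<Sum>j<r. of_rat (v $ (i * r + j)) * (bs ! j * rimage S (b i) $ k))"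
        by (rule sum_nat_pairs[THEN trans]) simp
      finally show ?thesis by (simp add: c_def sum_distrib_left sum_distrib_right mult_ac)
    qed
    then have "relation S {..<n} c b" using b by (simp add: relation_def)
    then have c0: "c i = 0" if "i < n" for i using indep that by blast
    have zero: "v $ (i * r + j) = 0" if i: "i < n" and j: "j < r" for i j
      using c0[OF i] j by (intro rat_independent_list[OF bs(2), where v = "\<lambda>j. v $ (i * r + j)"])
        (simp_all add: c_def bs(1) B(2) r_def)
    have "v $ a = 0" if "a < n * r" for a using zero[OF idx[OF that]] by (simp add: div_mult_mod_eq)
    then show "v = 0\<^sub>v (n * r)" using v by (intro eq_vecI) auto
  qed
  then show ?thesis by (simp add: r)
qed

end

theorem splitting_field_exists:
  obtains L B where "subfield L class_ring" "realizable_over G n V L" "finite B" "complex_over_rat.independent B"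
    "complex_over_rat.span B = L" "n * card B \<le> d"
proof -
  obtain S B where S: "nonzero_hom S" and B: "finite B" "complex_over_rat.independent B" "complex_over_rat.span B = stab S"
    and max: "\<And>S'. nonzero_hom S' \<Longrightarrow> stab S \<subseteq> stab S' \<Longrightarrow> stab S' \<subseteq> stab S"
    by (rule maximal_stab_exists) blast
  show ?thesis
    by (rule that[OF stab_subfield[OF S max] realizable_over_stab[OF S max] B stab_dimension_bound[OF S max B]])
qed

end

section \<open>The action of the central idempotent\<close>

lemmas ring_complex = class_ring.ring_axioms[where 'a = complex]

lemma complex_line_extension_iff:
  "x \<in> ring.line_extension class_ring K u E \<longleftrightarrow> (\<exists>k\<in>K. \<exists>v\<in>E. x = k * u + (v :: complex))"
  using ring.line_extension_mem_iff[OF ring_complex] by simp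

text \<open>The Schur index measures degrees by lists over subfields of the ring of complex numbers,
  the field trace by bases of a vector space over Q. The two are combined in the degree
  formula.\<close>

lemma Span_rat_eq_span:
  "ring.Span class_ring (range of_rat) Us = complex_over_rat.span (set Us)"
proof (induction Us)
  case Nil then show ?case by (simp add: ring.Span.simps[OF ring_complex])
next
  case (Cons u Us)
  have "ring.Span class_ring (range of_rat) (u # Us)
      = ring.line_extension class_ring (range of_rat) u (complex_over_rat.span (set Us))"
    using Cons by (simp add: ring.Span.simps[OF ring_complex])
  also have "\<dots> = complex_over_rat.span (set (u # Us))"
    unfolding list.set complex_over_rat.span_insert
  proof (intro equalityI subsetI)
    fix x assume "x \<in> {x. \<exists>k. x - of_rat k * u \<in> complex_over_rat.span (set Us)}"
    then obtain k where "x - of_rat k * u \<in> complex_over_rat.span (set Us)" by blast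
    then show "x \<in> ring.line_extension class_ring (range of_rat) u (complex_over_rat.span (set Us))"
      unfolding complex_line_extension_iff by (intro bexI[of _ "of_rat k"] bexI[of _ "x - of_rat k * u"]) auto
  next
    fix x assume "x \<in> ring.line_extension class_ring (range of_rat) u (complex_over_rat.span (set Us))"
    then obtain k v where "v \<in> complex_over_rat.span (set Us)" "x = of_rat k * u + v"
      by (auto simp: complex_line_extension_iff)
    then show "x \<in> {x. \<exists>k. x - of_rat k * u \<in> complex_over_rat.span (set Us)}" by (intro CollectI exI[of _ k]) simp
  qed
  finally show ?case .
qed

lemma independent_over_rat:
  "distinct Us \<Longrightarrow> complex_over_rat.independent (set Us) \<Longrightarrow> ring.independent class_ring (range of_rat) Us"
proof (induction Us)
  case Nil then show ?case by (simp add: ring.li_Nil[OF ring_complex])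
next
  case (Cons u Us)
  then have "complex_over_rat.independent (set Us)" "u \<notin> complex_over_rat.span (set Us)"
    using complex_over_rat.independent_insert[of u "set Us"] by auto
  then show ?case
    using Cons by (intro ring.li_Cons[OF ring_complex]) (auto simp: Span_rat_eq_span)
qed

lemma rat_subfield: "subfield (range of_rat :: complex set) class_ring"
proof (rule field.subfieldI'[OF class_field])
  show "subring (range of_rat :: complex set) class_ring"
  proof (rule ring.subringI[OF ring_complex])
    show "\<ominus>\<^bsub>class_ring\<^esub> h \<in> range of_rat" if "h \<in> range of_rat" for h :: complex
      using that by (auto simp: class_ring_simps of_rat_minus[symmetric])
    show "\<one>\<^bsub>class_ring\<^esub> \<in> (range of_rat :: complex set)"
      by (auto intro!: image_eqI[of _ _ 1])
  qed (auto simp: of_rat_mult[symmetric] of_rat_add[symmetric])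
  show "inv\<^bsub>class_ring\<^esub> k \<in> range of_rat" if "k \<in> range of_rat - {\<zero>\<^bsub>class_ring\<^esub>}" for k :: complex
    using that by (auto simp: class_ring_simps of_rat_inverse[symmetric])
qed

lemma dimension_over_rat:
  assumes "finite B" "complex_over_rat.independent B"
  shows "ring.dimension class_ring (card B) (range of_rat) (complex_over_rat.span B)"
proof -
  obtain bs where bs: "set bs = B" "distinct bs" using finite_distinct_list[OF assms(1)] by blast
  show ?thesis
    using ring.dimensionI[OF ring_complex rat_subfield, of bs] bs assms(2)
      independent_over_rat[of bs] Span_rat_eq_span[of bs] distinct_card[OF bs(2)] by simp
qed

lemma subfield_closed:
  assumes "subfield L (class_ring :: complex ring)"
  shows "0 \<in> L" "1 \<in> L" "x \<in> L \<Longrightarrow> y \<in> L \<Longrightarrow> x + y \<in> L" "x \<in> L \<Longrightarrow> y \<in> L \<Longrightarrow> x * y \<in> L"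
    "(\<And>i. i \<in> I \<Longrightarrow> F i \<in> L) \<Longrightarrow> sum F I \<in> L"
proof -
  note s = subringE[OF subfieldE(1)[OF assms]]
  show zero: "0 \<in> L" and "1 \<in> L" using s(2,3) by simp_all
  show add: "x \<in> L \<Longrightarrow> y \<in> L \<Longrightarrow> x + y \<in> L" for x y using s(7)[of x y] by simp
  show "x \<in> L \<Longrightarrow> y \<in> L \<Longrightarrow> x * y \<in> L" using s(6)[of x y] by simp
  show "(\<And>i. i \<in> I \<Longrightarrow> F i \<in> L) \<Longrightarrow> sum F I \<in> L"
    by (induction I rule: infinite_finite_induct) (auto intro: zero add)
qed

context rational_irrep
begin

text \<open>Conjugation by \<open>R\<close> preserves traces, so the character values are sums of
  diagonal entries of a realization over L.\<close>

lemma K_subset_realizing_field: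
  assumes L: "subfield L class_ring" and "realizable_over G n V L"
  shows "K \<subseteq> L"
proof -
  obtain \<sigma> where \<sigma>: "is_rep G n \<sigma>" "equivalent_reps G n V \<sigma>" "\<And>g. g \<in> carrier G \<Longrightarrow> elements_mat (\<sigma> g) \<subseteq> L"
    using assms(2) by (auto simp: realizable_over_def)
  obtain R where R: "R \<in> carrier_mat n n" "\<And>g. g \<in> carrier G \<Longrightarrow> R * V g = \<sigma> g * R" "invertible_mat R"
    using \<sigma>(2) by (auto simp: equivalent_reps_def intertwiners_def)
  obtain R' where R': "R' \<in> carrier_mat n n" "R * R' = 1\<^sub>m n" "R' * R = 1\<^sub>m n"
    using invertible_mat_inverse[OF R(1,3)] by metis
  have "\<chi> g \<in> L" if g: "g \<in> carrier G" for g
  proof -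
    have "\<chi> g = mtrace (R' * R * V g)" using V_carrier[OF g] by (simp only: R'(3) left_mult_one_mat character_eq_mtrace)
    also have "R' * R * V g = R' * (\<sigma> g * R)" unfolding R(2)[OF g, symmetric] by (rule assoc_mult_mat[OF R'(1) R(1) V_carrier[OF g]])
    also have "mtrace \<dots> = mtrace (\<sigma> g * R * R')"
      by (rule mtrace_mult_comm[OF R'(1) mult_carrier_mat[OF is_rep_carrier[OF \<sigma>(1) g] R(1)]])
    also have "\<sigma> g * R * R' = \<sigma> g"
      using assoc_mult_mat[OF is_rep_carrier[OF \<sigma>(1) g] R(1) R'(1)] is_rep_carrier[OF \<sigma>(1) g] R'(2) by simp
    finally have "\<chi> g = (\<Sum>i<n. \<sigma> g $$ (i, i))"
      using is_rep_carrier[OF \<sigma>(1) g] by (simp add: mtrace_def)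
    also have "\<dots> \<in> L"
      using \<sigma>(3)[OF g] is_rep_carrier[OF \<sigma>(1) g] by (intro subfield_closed(5)[OF L]) auto
    finally show ?thesis .
  qed
  then show ?thesis
    unfolding K_def character_field_def using L by (intro field.generate_field_min_subfield1[OF class_field]) auto
qed

text \<open>The character field sits inside the splitting field obtained from \<open>W\<close>,
  which has finite degree. From here on \<open>trace_character_inner\<close> is available.\<close>

lemma finite_KB: "finite KB"
proof -
  obtain L B where L: "subfield L class_ring" "realizable_over G n V L" "finite B" "complex_over_rat.span B = L"
    by (rule splitting_field_exists) blast
  have "KB \<subseteq> complex_over_rat.span B"
    using KB_subset K_subset_realizing_field[OF L(1,2)] L(4) by blast
  then show ?thesis
    using complex_over_rat.independent_span_bound[OF L(3) KB(1)] by blast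
qed

lemma K_dimension: "ring.dimension class_ring (card KB) (range of_rat) K"
  using dimension_over_rat[OF finite_KB KB(1)] by (simp add: KB(2))

definition e where "e = rational_idempotent G n V"

lemma e_eq: "g \<in> carrier G \<Longrightarrow> e g = of_nat n / of_nat ord_G * tr (\<chi> (inv g))"
  by (simp add: e_def rational_idempotent_def ord_G_def tr_eq_field_trace chi_in_K)

lemma e_outside: "g \<notin> carrier G \<Longrightarrow> e g = 0"
  by (simp add: e_def rational_idempotent_def)

lemma e_conj: "g \<in> carrier G \<Longrightarrow> h \<in> carrier G \<Longrightarrow> e (g \<otimes> h) = e (h \<otimes> g)"
  using character_conj[OF rep, of "inv h" "inv g"] by (simp add: e_eq inv_mult_group)

text \<open>Conjugating the summation variable by \<open>h\<close> leaves the class function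
  \<open>e\<close> unchanged. The field is left general because both the complex \<open>V\<close>
  and the rational \<open>W\<close> are needed.\<close>

lemma class_function_sum_commutes:
  fixes \<rho> :: "'g \<Rightarrow> 'a::field_char_0 mat"
  assumes \<rho>: "is_rep G k \<rho>" and h: "h \<in> carrier G"
  shows "msum k k (carrier G) (\<lambda>g. of_rat (e g) \<cdot>\<^sub>m \<rho> g) * \<rho> h = \<rho> h * msum k k (carrier G) (\<lambda>g. of_rat (e g) \<cdot>\<^sub>m \<rho> g)"
proof -
  note c = is_rep_carrier[OF \<rho>]
  have "msum k k (carrier G) (\<lambda>g. of_rat (e g) \<cdot>\<^sub>m \<rho> g) * \<rho> h = msum k k (carrier G) (\<lambda>g. (of_rat (e g) \<cdot>\<^sub>m \<rho> g) * \<rho> h)"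
    by (rule msum_mult[OF c[OF h]]) (use c in simp)
  also have "\<dots> = msum k k (carrier G) (\<lambda>g. of_rat (e g) \<cdot>\<^sub>m \<rho> (g \<otimes> h))"
    by (rule msum_cong) (simp add: mult_smult_assoc_mat[OF c c[OF h]] is_rep_mult[OF \<rho> _ h])
  also have "\<dots> = msum k k (carrier G) (\<lambda>g. of_rat (e (h \<otimes> g \<otimes> inv h)) \<cdot>\<^sub>m \<rho> (h \<otimes> g \<otimes> inv h \<otimes> h))"
    by (rule msum_reindex[symmetric, where h = "\<lambda>g. h \<otimes> g \<otimes> inv h" and F = "\<lambda>g. of_rat (e g) \<cdot>\<^sub>m \<rho> (g \<otimes> h)"])
      (use bij_betw_trans[OF bij_mult_left[OF h] bij_mult_right[OF inv_closed[OF h]]] in \<open>simp add: comp_def\<close>)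
  also have "\<dots> = msum k k (carrier G) (\<lambda>g. \<rho> h * (of_rat (e g) \<cdot>\<^sub>m \<rho> g))"
  proof (rule msum_cong)
    fix g assume g: "g \<in> carrier G"
    have "e (h \<otimes> g \<otimes> inv h) = e g" using e_conj[of "h \<otimes> g" "inv h"] g h by (simp add: m_assoc[symmetric])
    moreover have "h \<otimes> g \<otimes> inv h \<otimes> h = h \<otimes> g" using g h by (simp add: m_assoc)
    ultimately show "of_rat (e (h \<otimes> g \<otimes> inv h)) \<cdot>\<^sub>m \<rho> (h \<otimes> g \<otimes> inv h \<otimes> h) = \<rho> h * (of_rat (e g) \<cdot>\<^sub>m \<rho> g)"
      by (simp add: mult_smult_distrib[OF c[OF h] c[OF g]] is_rep_mult[OF \<rho> h g])
  qed
  also have "\<dots> = \<rho> h * msum k k (carrier G) (\<lambda>g. of_rat (e g) \<cdot>\<^sub>m \<rho> g)"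
    by (rule mult_msum[symmetric, OF c[OF h]]) (use c in simp)
  finally show ?thesis .
qed

text \<open>By Schur's lemma \<open>e\<close> acts as a scalar, and
  \<open>trace_character_inner\<close> computes its trace as \<open>n\<close>.\<close>

lemma e_on_V: "msum n n (carrier G) (\<lambda>g. of_rat (e g) \<cdot>\<^sub>m V g) = 1\<^sub>m n"
proof -
  have "mtrace (msum n n (carrier G) (\<lambda>g. of_rat (e g) \<cdot>\<^sub>m V g)) = (\<Sum>g\<in>carrier G. of_rat (e g) * \<chi> g)"
    using V_carrier by (subst mtrace_msum) (auto simp: mtrace_smult[OF V_carrier] character_eq_mtrace intro!: sum.cong)
  also have "\<dots> = of_nat n / of_nat ord_G * (\<Sum>g\<in>carrier G. of_rat (tr (\<chi> (inv g))) * \<chi> g)"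
    by (simp add: e_eq of_rat_mult of_rat_divide sum_distrib_left mult_ac)
  also have "\<dots> = of_nat n" using ord_G_pos by (simp add: trace_character_inner[OF finite_KB])
  finally have "mtrace (msum n n (carrier G) (\<lambda>g. of_rat (e g) \<cdot>\<^sub>m V g)) = of_nat n" .
  then have "msum n n (carrier G) (\<lambda>g. of_rat (e g) \<cdot>\<^sub>m V g) = (of_nat n / of_nat n) \<cdot>\<^sub>m 1\<^sub>m n"
    using scalar_eq_trace[OF msum_carrier class_function_sum_commutes[OF rep]] by simp
  also have "\<dots> = 1\<^sub>m n" using n_pos by (intro eq_matI) auto
  finally show ?thesis .
qed

lemma intertwine_e:
  fixes \<rho> \<sigma> :: "'g \<Rightarrow> 'a::field_char_0 mat"
  assumes \<rho>: "is_rep G k \<rho>" and \<sigma>: "is_rep G l \<sigma>" and X: "X \<in> carrier_mat l k"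
    and comm: "\<And>g. g \<in> carrier G \<Longrightarrow> X * \<rho> g = \<sigma> g * X"
  shows "X * msum k k (carrier G) (\<lambda>g. of_rat (a g) \<cdot>\<^sub>m \<rho> g) = msum l l (carrier G) (\<lambda>g. of_rat (a g) \<cdot>\<^sub>m \<sigma> g) * X"
proof -
  note c = is_rep_carrier[OF \<rho>] is_rep_carrier[OF \<sigma>]
  have "X * msum k k (carrier G) (\<lambda>g. of_rat (a g) \<cdot>\<^sub>m \<rho> g) = msum l k (carrier G) (\<lambda>g. X * (of_rat (a g) \<cdot>\<^sub>m \<rho> g))"
    by (rule mult_msum[OF X]) (use c in simp)
  also have "\<dots> = msum l k (carrier G) (\<lambda>g. (of_rat (a g) \<cdot>\<^sub>m \<sigma> g) * X)"
    by (rule msum_cong) (simp add: mult_smult_distrib[OF X c(1)] mult_smult_assoc_mat[OF c(2) X] comm)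
  also have "\<dots> = msum l l (carrier G) (\<lambda>g. of_rat (a g) \<cdot>\<^sub>m \<sigma> g) * X"
    by (rule msum_mult[symmetric, OF X]) (use c in simp)
  finally show ?thesis .
qed

lemma msum_complexify:
  "msum d d (carrier G) (\<lambda>g. of_rat (a g) \<cdot>\<^sub>m WC g) = cmat (msum d d (carrier G) (\<lambda>g. a g \<cdot>\<^sub>m W g))"
proof (rule eq_matI)
  fix i j assume "i < dim_row (cmat (msum d d (carrier G) (\<lambda>g. a g \<cdot>\<^sub>m W g)))"
    "j < dim_col (cmat (msum d d (carrier G) (\<lambda>g. a g \<cdot>\<^sub>m W g)))"
  then have ij: "i < d" "j < d" by auto
  then show "msum d d (carrier G) (\<lambda>g. of_rat (a g) \<cdot>\<^sub>m WC g) $$ (i, j)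
      = cmat (msum d d (carrier G) (\<lambda>g. a g \<cdot>\<^sub>m W g)) $$ (i, j)"
    using carrier_matD[OF W_carrier] by (simp add: complexify_def of_rat_sum of_rat_mult)
qed auto

text \<open>The operator \<open>W(e) - 1\<close> commutes with \<open>W\<close> and is singular, because it kills the image of \<open>V\<close>.\<close>

lemma e_on_W: "msum d d (carrier G) (\<lambda>g. e g \<cdot>\<^sub>m W g) = 1\<^sub>m d"
proof (rule ccontr)
  define E where "E = msum d d (carrier G) (\<lambda>g. e g \<cdot>\<^sub>m W g)"
  assume "msum d d (carrier G) (\<lambda>g. e g \<cdot>\<^sub>m W g) \<noteq> 1\<^sub>m d"
  then have ne: "E \<noteq> 1\<^sub>m d" by (simp add: E_def)
  have E: "E \<in> carrier_mat d d" by (simp add: E_def)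
  define D where "D = E - 1\<^sub>m d"
  have D: "D \<in> carrier_mat d d" unfolding D_def by (rule minus_carrier_mat) simp
  have D_nonzero: "D \<noteq> 0\<^sub>m d d"
  proof
    assume "D = 0\<^sub>m d d"
    then have "D $$ (i, j) = 0" if "i < d" "j < d" for i j using that by simp
    then have "E = 1\<^sub>m d" using E by (intro eq_matI) (auto simp: D_def)
    then show False using ne by simp
  qed
  have D_comm: "D * W g = W g * D" if g: "g \<in> carrier G" for g
  proof -
    note Wg = W_carrier[OF g]
    have "E * W g = W g * E"
      using class_function_sum_commutes[OF W_rep g] by (simp add: E_def of_rat_eq_id)
    then show ?thesis
      unfolding D_def using minus_mult_distrib_mat[OF E one_carrier_mat Wg] mult_minus_distrib_mat[OF Wg E one_carrier_mat] Wg
      by simp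
  qed
  \<comment> \<open>Irreducibility over Q makes the nonzero commuting \<open>D\<close> invertible;
    the inverse survives complexification, where it contradicts that \<open>D\<close> kills the
    image of \<open>T\<close>.\<close>
  obtain D' where D': "D' \<in> carrier_mat d d" "D' * D = 1\<^sub>m d"
  proof (rule injective_square_mat_inverse[OF D])
    show "v = 0\<^sub>v d" if "v \<in> carrier_vec d" "D *\<^sub>v v = 0\<^sub>v d" for v
      by (rule irreducible_rep_injective[OF W_irr D D_nonzero D_comm W_carrier that])
  qed
  have "cmat E * T = T"
    using intertwine_e[OF rep WC_rep T, of e] T(1) by (simp add: e_on_V msum_complexify E_def)
  then have DT: "cmat D * T = 0\<^sub>m d n"
  proof -
    assume ET: "cmat E * T = T"
    have "cmat D = cmat E - 1\<^sub>m d" using E by (intro eq_matI) (auto simp: D_def of_rat_diff)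
    then have "cmat D * T = cmat E * T - 1\<^sub>m d * T"
      using E T(1) by (simp add: minus_mult_distrib_mat[of _ d d])
    then show ?thesis using ET T(1) by simp
  qed
  have "T = cmat (D' * D) * T" using T(1) by (simp add: D' of_rat_hom.mat_hom_one)
  also have "\<dots> = cmat D' * (cmat D * T)"
    unfolding of_rat_hom.mat_hom_mult[OF D'(1) D] using D D' T(1) by (intro assoc_mult_mat) auto
  also have "\<dots> = 0\<^sub>m d n" unfolding DT using D' by simp
  finally have "T' * T = 0\<^sub>m n n" using T'(1) by simp
  then have "(1\<^sub>m n :: complex mat) $$ (0, 0) = 0" unfolding T'(2) using n_pos by simp
  then show False using n_pos by simp
qed

text \<open>Multiplying \<open>e_on_V\<close> by \<open>V (inv g)\<close> and taking the trace
  expresses \<open>\<chi> (inv g)\<close> as a rational combination of shifted character values.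
  Since \<open>tr\<close> is Q-linear it may be applied to both sides, which yields the convolution
  identity for \<open>e\<close>.\<close>

lemma e_convolution: "g \<in> carrier G \<Longrightarrow> (\<Sum>x\<in>carrier G. e x * e (inv x \<otimes> g)) = e g"
proof -
  assume g: "g \<in> carrier G"
  note c = V_carrier[OF inv_closed[OF g]]
  have "\<chi> (inv g) = mtrace (V (inv g) * msum n n (carrier G) (\<lambda>x. of_rat (e x) \<cdot>\<^sub>m V x))"
    using c by (simp add: e_on_V character_eq_mtrace)
  also have "\<dots> = mtrace (msum n n (carrier G) (\<lambda>x. V (inv g) * (of_rat (e x) \<cdot>\<^sub>m V x)))"
    by (subst mult_msum[OF c]) (use V_carrier in auto)
  also have "\<dots> = (\<Sum>x\<in>carrier G. mtrace (V (inv g) * (of_rat (e x) \<cdot>\<^sub>m V x)))"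
    by (rule mtrace_msum) (use c V_carrier in auto)
  also have "\<dots> = (\<Sum>x\<in>carrier G. of_rat (e x) * \<chi> (inv (inv x \<otimes> g)))"
    using g by (intro sum.cong refl)
      (simp add: mult_smult_distrib[OF c V_carrier] inv_mult_group is_rep_mult[OF rep] character_eq_mtrace
        mtrace_smult[OF mult_carrier_mat[OF c V_carrier]])
  finally have "tr (\<chi> (inv g)) = (\<Sum>x\<in>carrier G. e x * tr (\<chi> (inv (inv x \<otimes> g))))"
    unfolding tr_scale[symmetric] tr_sum[symmetric] by (rule arg_cong)
  then have "of_nat n / of_nat ord_G * tr (\<chi> (inv g)) = (\<Sum>x\<in>carrier G. e x * (of_nat n / of_nat ord_G * tr (\<chi> (inv (inv x \<otimes> g)))))"
    by (simp add: sum_distrib_left mult_ac)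
  then show ?thesis using g by (simp add: e_eq)
qed

end

section \<open>The Schur index\<close>

context rational_irrep
begin

text \<open>Since \<open>e\<close> is a rational combination of matrix coefficients of \<open>W\<close> and acts as the identity on a
  realization \<open>\<sigma>\<close> of \<open>V\<close> over \<open>L\<close>, some average \<open>\<Sum>\<^sub>g \<sigma>(g) E\<^sub>0\<^sub>i W(g\<^sup>-\<^sup>1)\<close> is nonzero; it embeds \<open>W\<close> into \<open>L\<^sup>n\<close>.\<close>

lemma realization_dimension_bound:
  assumes L: "subfield L class_ring" "realizable_over G n V L"
    and B: "finite B" "complex_over_rat.independent B" "complex_over_rat.span B = L"
  shows "d \<le> n * card B"
proof -
  obtain \<sigma> where \<sigma>: "is_rep G n \<sigma>" "equivalent_reps G n V \<sigma>" "\<And>g. g \<in> carrier G \<Longrightarrow> elements_mat (\<sigma> g) \<subseteq> L"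
    using L(2) by (auto simp: realizable_over_def)
  note \<sigma>_car = is_rep_carrier[OF \<sigma>(1)]
  obtain R where R: "R \<in> carrier_mat n n" "\<And>g. g \<in> carrier G \<Longrightarrow> R * V g = \<sigma> g * R" "invertible_mat R"
    using \<sigma>(2) by (auto simp: equivalent_reps_def intertwiners_def)
  obtain R' where R': "R' \<in> carrier_mat n n" "R * R' = 1\<^sub>m n"
    using invertible_mat_inverse[OF R(1,3)] by metis
  define E where "E = msum n n (carrier G) (\<lambda>g. of_rat (e g) \<cdot>\<^sub>m \<sigma> g)"
  have E: "E \<in> carrier_mat n n" by (simp add: E_def)
  have "E * R = R" using intertwine_e[OF rep \<sigma>(1) R(1,2), of e] R(1) by (simp add: e_on_V E_def)
  then have "E * (R * R') = R * R'" using assoc_mult_mat[OF E R(1) R'(1)] by simp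
  then have E1: "E = 1\<^sub>m n" using E by (simp add: R'(2))
  obtain q where q: "\<And>g. g \<in> carrier G \<Longrightarrow> tr (\<chi> g) = (\<Sum>i<d. \<Sum>j<d. q i j * W g $$ (i, j))"
    using tr_character_coefficients by blast
  \<comment> \<open>With the elementary matrix at (0, i), the averaged matrix \<open>S i\<close>
    collects products of column 0 of \<open>\<sigma> g\<close> with row i of
    \<open>W (inv g)\<close>. These are the sums that appear when \<open>e\<close> is expanded in
    entries of \<open>W\<close>.\<close>
  define X :: "nat \<Rightarrow> complex mat" where "X i = mat n d (\<lambda>(a, b). if a = 0 \<and> b = i then 1 else 0)" for i
  have X: "X i \<in> carrier_mat n d" for i by (simp add: X_def)
  define S where "S i = msum n d (carrier G) (\<lambda>g. \<sigma> g * X i * WC (inv g))" for i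
  have S: "S i \<in> carrier_mat n d" for i by (simp add: S_def)
  have S_entry: "S i $$ (k, l) = (\<Sum>g\<in>carrier G. \<sigma> g $$ (k, 0) * of_rat (W (inv g) $$ (i, l)))"
    if "i < d" "k < n" "l < d" for i k l
    using that n_pos carrier_matD[OF W_carrier] unfolding S_def msum_index[OF that(2,3)] X_def
    by (intro sum.cong refl, subst mult_mat_unit_mult[OF \<sigma>_car WC_carrier]) (auto simp: complexify_def)
  have "\<exists>i<d. S i \<noteq> 0\<^sub>m n d"
  proof (rule ccontr)
    assume "\<not> ?thesis"
    then have S0: "S i $$ (0, j) = 0" if "i < d" "j < d" for i j using that n_pos by simp
    \<comment> \<open>If all \<open>S i\<close> vanished, then so would the (0, 0) entry of the
      action of \<open>e\<close> on the realization, which is 1.\<close>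
    have "(1 :: complex) = E $$ (0, 0)" using n_pos by (simp add: E1)
    also have "\<dots> = (\<Sum>g\<in>carrier G. of_rat (e g) * \<sigma> g $$ (0, 0))"
      using n_pos carrier_matD[OF \<sigma>_car] by (simp add: E_def)
    also have "\<dots> = (\<Sum>g\<in>carrier G. \<Sum>i<d. \<Sum>j<d. of_nat n / of_nat ord_G * of_rat (q i j) *
        (\<sigma> g $$ (0, 0) * of_rat (W (inv g) $$ (i, j))))"
      by (intro sum.cong refl)
        (simp add: e_eq q of_rat_mult of_rat_divide of_rat_sum sum_distrib_left sum_distrib_right mult_ac)
    also have "\<dots> = (\<Sum>i<d. \<Sum>j<d. \<Sum>g\<in>carrier G. of_nat n / of_nat ord_G * of_rat (q i j) *
        (\<sigma> g $$ (0, 0) * of_rat (W (inv g) $$ (i, j))))"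
      by (subst sum.swap, rule sum.cong[OF refl], subst sum.swap, rule refl)
    also have "\<dots> = (\<Sum>i<d. \<Sum>j<d. of_nat n / of_nat ord_G * of_rat (q i j) * S i $$ (0, j))"
      using n_pos by (intro sum.cong refl) (simp add: S_entry sum_distrib_left)
    also have "\<dots> = 0" by (simp add: S0)
    finally show False by simp
  qed
  then obtain i where i: "i < d" "S i \<noteq> 0\<^sub>m n d" by blast
  have S_L: "S i $$ (k, l) \<in> L" if "k < n" "l < d" for k l
  proof -
    have "of_rat r \<in> L" for r
      using K_subset_realizing_field[OF L] of_rat_in_K by blast
    moreover have "\<sigma> g $$ (k, 0) \<in> L" if "g \<in> carrier G" for g
      using \<sigma>(3)[OF that] elements_matI[OF \<sigma>_car[OF that] \<open>k < n\<close> n_pos refl] by blast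
    ultimately show ?thesis
      unfolding S_entry[OF i(1) that] by (intro subfield_closed[OF L(1)])
  qed
  have inj: "w = 0\<^sub>v d" if w: "w \<in> carrier_vec d" "rimage (S i) w = 0\<^sub>v n" for w
    by (rule W_dichotomy_mat[OF S i(2) \<sigma>_car _ w])
      (auto simp: S_def intro: average_intertwines[OF WC_rep \<sigma>(1) X])
  obtain bs where bs: "set bs = B" "distinct bs" using finite_distinct_list[OF B(1)] by blast
  define r where "r = length bs"
  have r: "r = card B" using distinct_card[OF bs(2)] bs(1) by (simp add: r_def)
  let ?c = "complex_over_rat.representation B"
  \<comment> \<open>The rational coordinates of the entries of \<open>S i\<close>: row k r + j holds
    the j-th coordinates of row k, so \<open>A\<close> is the map w to S(w) written over Q.\<close>
  define A where "A = mat (n * r) d (\<lambda>(a, l). ?c (S i $$ (a div r, l)) (bs ! (a mod r)))"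
  have A: "A \<in> carrier_mat (n * r) d" by (simp add: A_def)
  have "d \<le> n * r"
  proof (rule injective_mat_dim_le[OF A])
    fix w assume w: "w \<in> carrier_vec d" "A *\<^sub>v w = 0\<^sub>v (n * r)"
    have "rimage (S i) w $ k = 0" if k: "k < n" for k
    proof -
      have x: "rimage (S i) w $ k = (\<Sum>l<d. of_rat (w $ l) * S i $$ (k, l))"
        using w k index_mult_mat_vec_sum[OF S, of "cvec w" k] by (simp add: rimage_def mult.commute del: index_mult_mat_vec)
      have inL: "S i $$ (k, l) \<in> complex_over_rat.span B" if "l < d" for l using S_L[OF k that] B(3) by simp
      have scale: "?c (of_rat q * z) = (\<lambda>b. q * ?c z b)" if "z \<in> complex_over_rat.span B" for q z
        by (rule complex_over_rat.representation_scale[OF B(2) that])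
      have "?c (rimage (S i) w $ k) b = 0" if b: "b \<in> B" for b
      proof -
        obtain j where j: "j < r" "b = bs ! j" using b bs by (metis in_set_conv_nth r_def)
        have a: "k * r + j < n * r"
        proof -
          have "k * r + j < Suc k * r" using j by simp
          also have "\<dots> \<le> n * r" using k by (intro mult_le_mono1) simp
          finally show ?thesis .
        qed
        have "?c (rimage (S i) w $ k) b = (\<Sum>l<d. ?c (of_rat (w $ l) * S i $$ (k, l)) b)"
          unfolding x by (subst complex_over_rat.representation_sum[OF B(2)])
            (use inL in \<open>auto intro: complex_over_rat.span_scale\<close>)
        also have "\<dots> = (\<Sum>l<d. A $$ (k * r + j, l) * w $ l)"
        proof (rule sum.cong[OF refl])
          fix l assume "l \<in> {..<d}"
          then have l: "l < d" by simp
          have "A $$ (k * r + j, l) = ?c (S i $$ (k, l)) b" using a j l by (simp add: A_def)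
          then show "?c (of_rat (w $ l) * S i $$ (k, l)) b = A $$ (k * r + j, l) * w $ l"
            unfolding scale[OF inL[OF l]] by (metis mult.commute)
        qed
        also have "\<dots> = (A *\<^sub>v w) $ (k * r + j)" by (rule index_mult_mat_vec_sum[OF A w(1) a, symmetric])
        also have "\<dots> = 0" using a by (simp add: w(2))
        finally show ?thesis .
      qed
      moreover have "rimage (S i) w $ k \<in> complex_over_rat.span B"
        unfolding x using inL by (auto intro!: complex_over_rat.span_sum complex_over_rat.span_scale)
      ultimately show ?thesis
        using complex_over_rat.sum_representation_eq[OF B(2) _ B(1) subset_refl, of "rimage (S i) w $ k"] by simp
    qed
    then have "rimage (S i) w = 0\<^sub>v n" using S by (intro eq_vecI) auto
    then show "w = 0\<^sub>v d" by (rule inj[OF w(1)])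
  qed
  then show ?thesis by (simp add: r)
qed

lemma rat_basis_of_dimension:
  assumes "ring.dimension class_ring r (range of_rat) L"
  obtains B where "finite B" "complex_over_rat.independent B" "complex_over_rat.span B = L" "card B = r"
proof -
  obtain Vs where Vs: "ring.Span class_ring (range of_rat) Vs = L"
    using ring.exists_base[OF ring_complex rat_subfield assms] by blast
  obtain B where B: "B \<subseteq> set Vs" "complex_over_rat.independent B" "set Vs \<subseteq> complex_over_rat.span B"
    using complex_over_rat.maximal_independent_subset by blast
  have fin: "finite B" using B(1) finite_subset by blast
  have "complex_over_rat.span B = complex_over_rat.span (set Vs)"
    using B complex_over_rat.span_eq complex_over_rat.span_superset by (metis subset_trans)
  then have L: "complex_over_rat.span B = L" using Vs Span_rat_eq_span by simp
  have "card B = r"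
    by (rule ring.dimension_is_inj[OF ring_complex rat_subfield dimension_over_rat[OF fin B(2)] assms[folded L]])
  then show ?thesis using that fin B(2) L by blast
qed

text \<open>The least degree is attained by some field, to which the lower bound applies; the
  splitting field has some degree \<open>s\<close> over K that is at least the least one and
  satisfies the opposite bound. The two inequalities squeeze \<open>d\<close>.\<close>

theorem degree_eq_schur_index: "d = n * schur_index G n V * card KB"
proof -
  let ?P = "\<lambda>m L. subfield L class_ring \<and> K \<subseteq> L \<and> ring.dimension class_ring m K L \<and> realizable_over G n V L"
  have lower: "d \<le> n * m * card KB" if "?P m L" for m L
  proof -
    have "ring.dimension class_ring (card KB * m) (range of_rat) L"
      using that by (intro ring.telescopic_base[OF ring_complex rat_subfield K_subfield K_dimension]) blast
    then obtain B where "finite B" "complex_over_rat.independent B" "complex_over_rat.span B = L" "card B = card KB * m"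
      by (rule rat_basis_of_dimension)
    then show ?thesis using realization_dimension_bound[of L B] that by (simp add: mult_ac)
  qed
  obtain L B where L: "subfield L class_ring" "realizable_over G n V L"
    and B: "finite B" "complex_over_rat.independent B" "complex_over_rat.span B = L" "n * card B \<le> d"
    by (rule splitting_field_exists) blast
  have KL: "K \<subseteq> L" by (rule K_subset_realizing_field[OF L])
  obtain bs where bs: "set bs = B" using finite_list[OF B(1)] by blast
  \<comment> \<open>A rational basis of L also spans it over K. Only the finiteness of the degree is
    taken from this; its value \<open>s\<close> comes from the tower law.\<close>
  have "ring.Span class_ring K bs = L"
  proof
    have "ring.Span class_ring (range of_rat) us \<subseteq> ring.Span class_ring K us" for us
      by (induction us) (use of_rat_in_K in \<open>fastforce simp: ring.Span.simps[OF ring_complex] complex_line_extension_iff\<close>)+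
    then show "L \<subseteq> ring.Span class_ring K bs" using Span_rat_eq_span[of bs] bs B(3) by blast
    have "ring.Span class_ring K us \<subseteq> L" if "set us \<subseteq> L" for us
      using that by (induction us)
        (use KL in \<open>auto simp: ring.Span.simps[OF ring_complex] complex_line_extension_iff intro!: subfield_closed[OF L(1)]\<close>)
    moreover have "set bs \<subseteq> L" using bs B(3) complex_over_rat.span_superset by blast
    ultimately show "ring.Span class_ring K bs \<subseteq> L" by blast
  qed
  then have "ring.finite_dimension class_ring K L"
    using ring.Span_finite_dimension[OF ring_complex K_subfield, of bs] by simp
  then obtain s where s: "ring.dimension class_ring s K L"
    by (auto simp: ring.finite_dimension_def[OF ring_complex])
  have "ring.dimension class_ring (card KB * s) (range of_rat) L"
    by (rule ring.telescopic_base[OF ring_complex rat_subfield K_subfield K_dimension s])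
  then have card_B: "card B = card KB * s"
    using ring.dimension_is_inj[OF ring_complex rat_subfield dimension_over_rat[OF B(1,2)]] B(3) by blast
  have Ps: "?P s L" using L KL s by blast
  have m: "schur_index G n V = (LEAST m. \<exists>L. ?P m L)" by (simp add: schur_index_def K_def)
  have "\<exists>L. ?P (schur_index G n V) L"
    unfolding m by (rule LeastI[of "\<lambda>m. \<exists>L. ?P m L" s]) (use Ps in blast)
  then have le: "d \<le> n * schur_index G n V * card KB" using lower by blast
  have "schur_index G n V \<le> s" unfolding m by (rule Least_le) (use Ps in blast)
  then have "n * schur_index G n V * card KB \<le> n * s * card KB" by simp
  also have "\<dots> \<le> d" using B(4) by (simp add: card_B mult_ac)
  finally show ?thesis using le by simp
qed

end

section \<open>Fixed spaces\<close>

text \<open>The trace of an idempotent is its rank: the coordinates of \<open>P\<close> in a basis of its fixed vectors form a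
  left inverse of that basis.\<close>

lemma idempotent_mat_trace:
  fixes P :: "'a::field_char_0 mat"
  assumes P: "P \<in> carrier_mat n n" and idem: "P * P = P"
  defines "D \<equiv> vectorspace.dim class_ring (module_vec TYPE('a) n\<lparr>carrier := mat_kernel (P - 1\<^sub>m n)\<rparr>)"
  shows "of_nat D = mtrace P" and "D = 0 \<Longrightarrow> P = 0\<^sub>m n n"
proof -
  have Q: "P - 1\<^sub>m n \<in> carrier_mat n n" by (rule minus_carrier_mat) simp
  interpret kernel n n "P - 1\<^sub>m n" by unfold_locales (rule Q)
  have ker: "v \<in> mat_kernel (P - 1\<^sub>m n) \<longleftrightarrow> v \<in> carrier_vec n \<and> P *\<^sub>v v = v" for v
  proof -
    have "(P - 1\<^sub>m n) *\<^sub>v v = P *\<^sub>v v - v" if "v \<in> carrier_vec n"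
      using that by (simp add: minus_mult_distrib_mat_vec[OF P])
    moreover have "P *\<^sub>v v - v = 0\<^sub>v n \<longleftrightarrow> P *\<^sub>v v = v" if "v \<in> carrier_vec n"
    proof
      assume "P *\<^sub>v v - v = 0\<^sub>v n"
      then show "P *\<^sub>v v = v" by (rule vec_eq_if_diff_zero[OF mult_mat_vec_carrier[OF P that] that])
    qed (use that in simp)
    ultimately show ?thesis unfolding mat_kernel[OF Q] by (cases "v \<in> carrier_vec n") (simp_all del: index_mult_mat_vec)
  qed
  obtain B where B: "finite B" "Ker.basis B" using kernel_basis_exists[OF Q] by blast
  have B_ker: "B \<subseteq> mat_kernel (P - 1\<^sub>m n)" and gen: "Ker.span B = mat_kernel (P - 1\<^sub>m n)"
    and li: "\<not> Ker.lin_dep B"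
    using B(2) unfolding Ker.basis_def by blast+
  have D: "D = card B" unfolding D_def using Ker.dim_basis[OF B] by simp
  have indep: "c b = 0" if c: "\<And>i. i < n \<Longrightarrow> (\<Sum>b\<in>B. c b * b $ i) = 0" and b: "b \<in> B" for c b
  proof (rule ccontr)
    assume "c b \<noteq> 0"
    have "Ker.lincomb c B = 0\<^sub>v n"
    proof (rule eq_vecI)
      have "Ker.lincomb c B \<in> mat_kernel (P - 1\<^sub>m n)" using B_ker B(1) by (intro Ker.lincomb_closed) auto
      then show "dim_vec (Ker.lincomb c B) = dim_vec (0\<^sub>v n :: 'a vec)" by (simp add: ker)
    qed (simp add: lincomb_index[OF _ B_ker] c)
    then have "Ker.lin_dep B" using B(1) b \<open>c b \<noteq> 0\<close> unfolding Ker.lin_dep_def by blast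
    then show False using li by simp
  qed
  have "\<exists>a. \<forall>i<n. P $$ (i, j) = (\<Sum>b\<in>B. a b * b $ i)" if j: "j < n" for j
  proof -
    have "P *\<^sub>v (P *\<^sub>v unit_vec n j) = P *\<^sub>v unit_vec n j"
      using assoc_mult_mat_vec[OF P P unit_vec_carrier, of j] by (simp add: idem)
    then have "col P j \<in> Ker.span B"
      unfolding gen ker using P j by (simp add: col_mult_unit_vec[OF P j])
    then obtain a where a: "col P j = Ker.lincomb a B" using Ker.finite_span[OF B(1)] B_ker by auto
    have "P $$ (i, j) = (\<Sum>b\<in>B. a b * b $ i)" if "i < n" for i
    proof -
      have "P $$ (i, j) = col P j $ i" using P j that by simp
      then show ?thesis unfolding a by (simp add: lincomb_index[OF that B_ker])
    qed
    then show ?thesis by blast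
  qed
  then obtain a where a: "\<And>i j. i < n \<Longrightarrow> j < n \<Longrightarrow> P $$ (i, j) = (\<Sum>b\<in>B. a j b * b $ i)" by metis
  \<comment> \<open>Expanding the fixed vector b = P b by means of the columns of \<open>P\<close>
    and comparing with the trivial expansion of b identifies the coordinates by independence of
    \<open>B\<close>.\<close>
  have dual: "(\<Sum>j<n. b $ j * a j b) = 1" if b: "b \<in> B" for b
  proof -
    have bc: "b \<in> carrier_vec n" "P *\<^sub>v b = b" using b B_ker ker by auto
    define c where "c b' = (\<Sum>j<n. b $ j * a j b') - (if b' = b then 1 else 0)" for b'
    have "(\<Sum>b'\<in>B. c b' * b' $ i) = 0" if i: "i < n" for i
    proof -
      have "b $ i = (P *\<^sub>v b) $ i" by (simp add: bc)
      also have "\<dots> = (\<Sum>j<n. P $$ (i, j) * b $ j)" by (rule index_mult_mat_vec_sum[OF P bc(1) i])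
      also have "\<dots> = (\<Sum>j<n. \<Sum>b'\<in>B. b $ j * a j b' * b' $ i)"
        using i by (simp add: a sum_distrib_left mult_ac)
      also have "\<dots> = (\<Sum>b'\<in>B. (\<Sum>j<n. b $ j * a j b') * b' $ i)"
        by (subst sum.swap) (simp add: sum_distrib_right)
      finally have "(\<Sum>b'\<in>B. (\<Sum>j<n. b $ j * a j b') * b' $ i) = b $ i" by simp
      then show ?thesis
        using b B(1) by (simp add: c_def left_diff_distrib sum_subtractf if_distrib[of "\<lambda>x. x * _"] cong: if_cong)
    qed
    then have "c b = 0" using indep b by blast
    then show ?thesis by (simp add: c_def)
  qed
  have "mtrace P = (\<Sum>j<n. \<Sum>b\<in>B. b $ j * a j b)" using P by (simp add: mtrace_def a mult.commute)
  also have "\<dots> = (\<Sum>b\<in>B. \<Sum>j<n. b $ j * a j b)" by (rule sum.swap)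
  also have "\<dots> = of_nat (card B)" by (simp add: dual)
  finally show "of_nat D = mtrace P" by (simp add: D)
  show "P = 0\<^sub>m n n" if "D = 0"
  proof -
    have "B = {}" using that D B(1) by simp
    then show ?thesis using P a by (intro eq_matI) auto
  qed
qed

context finite_group
begin

lemma finite_subgroup: "subgroup H G \<Longrightarrow> finite H"
  using finite_subset[OF subgroup.subset fin] .

lemma card_subgroup_nonzero: "subgroup H G \<Longrightarrow> of_nat (card H) \<noteq> (0 :: 'a::field_char_0)"
  using finite_subgroup subgroup.one_closed by fastforce

text \<open>The action of the subgroup average: the projection onto the vectors fixed by
  \<open>H\<close>.\<close>

definition fix_proj :: "'g set \<Rightarrow> nat \<Rightarrow> ('g \<Rightarrow> 'a::field_char_0 mat) \<Rightarrow> 'a mat" where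
  "fix_proj H k \<rho> = msum k k H (\<lambda>h. (1 / of_nat (card H)) \<cdot>\<^sub>m \<rho> h)"

context
  fixes H :: "'g set" and k :: nat and \<rho> :: "'g \<Rightarrow> 'a::field_char_0 mat"
  assumes H: "subgroup H G" and \<rho>: "is_rep G k \<rho>"
begin

private lemma bij_H: "h \<in> H \<Longrightarrow> bij_betw (\<lambda>g. h \<otimes> g) H H"
  using H subgroup.mem_carrier[OF H] by (intro bij_betw_byWitness[of _ "\<lambda>g. inv h \<otimes> g"])
    (auto simp: m_assoc[symmetric] subgroup.m_closed subgroup.m_inv_closed)

private lemma car: "h \<in> H \<Longrightarrow> (1 / of_nat (card H)) \<cdot>\<^sub>m \<rho> h \<in> carrier_mat k k"
  using is_rep_carrier[OF \<rho> subgroup.mem_carrier[OF H]] by simp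

lemma fix_proj_carrier: "fix_proj H k \<rho> \<in> carrier_mat k k"
  by (simp add: fix_proj_def)

lemma rep_fix_proj: "h \<in> H \<Longrightarrow> \<rho> h * fix_proj H k \<rho> = fix_proj H k \<rho>"
proof -
  assume h: "h \<in> H"
  note \<rho>h = is_rep_carrier[OF \<rho> subgroup.mem_carrier[OF H h]]
  have "\<rho> h * fix_proj H k \<rho> = msum k k H (\<lambda>g. \<rho> h * ((1 / of_nat (card H)) \<cdot>\<^sub>m \<rho> g))"
    unfolding fix_proj_def by (rule mult_msum[OF \<rho>h car])
  also have "\<dots> = msum k k H (\<lambda>g. (1 / of_nat (card H)) \<cdot>\<^sub>m \<rho> (h \<otimes> g))"
    by (rule msum_cong) (simp add: mult_smult_distrib[OF \<rho>h is_rep_carrier[OF \<rho> subgroup.mem_carrier[OF H]]] is_rep_mult[OF \<rho> subgroup.mem_carrier[OF H h] subgroup.mem_carrier[OF H]])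
  also have "\<dots> = fix_proj H k \<rho>"
    unfolding fix_proj_def by (rule msum_reindex[OF bij_H[OF h], where F = "\<lambda>g. (1 / of_nat (card H)) \<cdot>\<^sub>m \<rho> g"])
  finally show ?thesis .
qed

lemma fix_proj_vec:
  assumes v: "v \<in> carrier_vec k" "\<And>h. h \<in> H \<Longrightarrow> \<rho> h *\<^sub>v v = v"
  shows "fix_proj H k \<rho> *\<^sub>v v = v"
proof (rule eq_vecI)
  fix i assume "i < dim_vec v"
  then have i: "i < k" using v by simp
  have "(fix_proj H k \<rho> *\<^sub>v v) $ i = (\<Sum>j<k. \<Sum>h\<in>H. 1 / of_nat (card H) * (\<rho> h $$ (i, j) * v $ j))"
    unfolding index_mult_mat_vec_sum[OF fix_proj_carrier v(1) i] unfolding fix_proj_def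
    using i carrier_matD[OF is_rep_carrier[OF \<rho> subgroup.mem_carrier[OF H]]] by (simp add: sum_distrib_right sum_divide_distrib)
  also have "\<dots> = (\<Sum>h\<in>H. 1 / of_nat (card H) * (\<rho> h *\<^sub>v v) $ i)"
    using i v(1) by (subst sum.swap) (simp add: index_mult_mat_vec_sum[OF is_rep_carrier[OF \<rho> subgroup.mem_carrier[OF H]]] sum_distrib_left sum_divide_distrib del: index_mult_mat_vec)
  also have "\<dots> = v $ i" using card_subgroup_nonzero[OF H] by (simp add: v(2))
  finally show "(fix_proj H k \<rho> *\<^sub>v v) $ i = v $ i" .
qed (use v fix_proj_carrier in auto)

lemma fix_proj_idem: "fix_proj H k \<rho> * fix_proj H k \<rho> = fix_proj H k \<rho>"
proof (rule mat_eq_if_agree[of _ k k])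
  fix v :: "'a vec" assume v: "v \<in> carrier_vec k"
  have Pv: "fix_proj H k \<rho> *\<^sub>v v \<in> carrier_vec k" by (rule mult_mat_vec_carrier[OF fix_proj_carrier v])
  have "fix_proj H k \<rho> *\<^sub>v (fix_proj H k \<rho> *\<^sub>v v) = fix_proj H k \<rho> *\<^sub>v v"
    by (rule fix_proj_vec[OF Pv])
      (simp add: assoc_mult_mat_vec[symmetric, OF is_rep_carrier[OF \<rho> subgroup.mem_carrier[OF H]] fix_proj_carrier v] rep_fix_proj)
  then show "fix_proj H k \<rho> * fix_proj H k \<rho> *\<^sub>v v = fix_proj H k \<rho> *\<^sub>v v"
    by (simp only: assoc_mult_mat_vec[OF fix_proj_carrier fix_proj_carrier v])
qed (intro mult_carrier_mat[of _ k k] fix_proj_carrier)+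

text \<open>In this form the dimension of the fixed space is the one computed by
  \<open>idempotent_mat_trace\<close>.\<close>

lemma fixed_space_eq_kernel: "fixed_space H k \<rho> = mat_kernel (fix_proj H k \<rho> - 1\<^sub>m k)"
proof (intro equalityI subsetI)
  let ?P = "fix_proj H k \<rho>"
  have Q: "?P - 1\<^sub>m k \<in> carrier_mat k k" by (rule minus_carrier_mat) simp
  have Pv: "(?P - 1\<^sub>m k) *\<^sub>v v = ?P *\<^sub>v v - v" if "v \<in> carrier_vec k" for v
    using that by (simp add: minus_mult_distrib_mat_vec[OF fix_proj_carrier])
  show "v \<in> mat_kernel (?P - 1\<^sub>m k)" if "v \<in> fixed_space H k \<rho>" for v
  proof -
    have v: "v \<in> carrier_vec k" and "\<And>h. h \<in> H \<Longrightarrow> \<rho> h *\<^sub>v v = v"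
      using that by (auto simp: fixed_space_def)
    then have "?P *\<^sub>v v = v" by (rule fix_proj_vec)
    then show ?thesis using v Pv[OF v] by (intro mat_kernelI[OF Q]) auto
  qed
  show "v \<in> fixed_space H k \<rho>" if "v \<in> mat_kernel (?P - 1\<^sub>m k)" for v
  proof -
    have v: "v \<in> carrier_vec k" and 0: "?P *\<^sub>v v - v = 0\<^sub>v k"
      using mat_kernelD[OF Q that] Pv by auto
    have fixed: "?P *\<^sub>v v = v"
      by (rule vec_eq_if_diff_zero[OF mult_mat_vec_carrier[OF fix_proj_carrier v] v 0])
    have "\<rho> h *\<^sub>v v = v" if "h \<in> H" for h
      using assoc_mult_mat_vec[OF is_rep_carrier[OF \<rho> subgroup.mem_carrier[OF H that]] fix_proj_carrier v]
      unfolding rep_fix_proj[OF that] fixed by simp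
    then show ?thesis using v by (simp add: fixed_space_def)
  qed
qed

lemma fixed_dim_eq_mtrace: "of_nat (fixed_dim H k \<rho>) = mtrace (fix_proj H k \<rho>)"
  unfolding fixed_dim_def fixed_space_eq_kernel by (rule idempotent_mat_trace[OF fix_proj_carrier fix_proj_idem])

text \<open>The rank of the averaging projection is its trace. Over C the formula for
  \<open>V\<close> gives the coefficient of \<open>f\<close> at the identity; over Q the formula for
  \<open>W\<close> gives the link with the induced character.\<close>

lemma fixed_dim_eq_trace: "of_nat (fixed_dim H k \<rho>) = (\<Sum>h\<in>H. character \<rho> h) / of_nat (card H)"
proof -
  have "of_nat (fixed_dim H k \<rho>) = (\<Sum>h\<in>H. mtrace ((1 / of_nat (card H)) \<cdot>\<^sub>m \<rho> h))"
    unfolding fixed_dim_eq_mtrace unfolding fix_proj_def by (rule mtrace_msum[OF car])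
  also have "\<dots> = (\<Sum>h\<in>H. character \<rho> h) / of_nat (card H)"
    by (simp add: mtrace_smult[OF is_rep_carrier[OF \<rho> subgroup.mem_carrier[OF H]]] character_eq_mtrace sum_divide_distrib)
  finally show ?thesis .
qed

lemma fixed_dim_zero_imp_fix_proj_zero: "fixed_dim H k \<rho> = 0 \<Longrightarrow> fix_proj H k \<rho> = 0\<^sub>m k k"
  unfolding fixed_dim_def fixed_space_eq_kernel by (rule idempotent_mat_trace(2)[OF fix_proj_carrier fix_proj_idem])

end

end

section \<open>The group algebra\<close>

context finite_group
begin

abbreviation QG :: "('g \<Rightarrow> rat) ring" where "QG \<equiv> group_algebra G"

lemma QG_carrier: "a \<in> carrier QG \<longleftrightarrow> (\<forall>g. g \<notin> carrier G \<longrightarrow> a g = 0)"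
  by (simp add: group_algebra_def)

lemma QG_mult: "(a \<otimes>\<^bsub>QG\<^esub> b) g = (if g \<in> carrier G then \<Sum>x\<in>carrier G. a x * b (inv x \<otimes> g) else 0)"
  by (simp add: group_algebra_def)

lemma QG_zero: "\<zero>\<^bsub>QG\<^esub> = (\<lambda>_. 0)" and QG_add: "a \<oplus>\<^bsub>QG\<^esub> b = (\<lambda>g. a g + b g)"
  by (simp_all add: group_algebra_def)

lemma QG_mult_closed: "a \<otimes>\<^bsub>QG\<^esub> b \<in> carrier QG"
  by (simp add: QG_carrier QG_mult)

lemma QG_mult_assoc: "(a \<otimes>\<^bsub>QG\<^esub> b) \<otimes>\<^bsub>QG\<^esub> c = a \<otimes>\<^bsub>QG\<^esub> (b \<otimes>\<^bsub>QG\<^esub> c)"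
proof
  fix g
  show "((a \<otimes>\<^bsub>QG\<^esub> b) \<otimes>\<^bsub>QG\<^esub> c) g = (a \<otimes>\<^bsub>QG\<^esub> (b \<otimes>\<^bsub>QG\<^esub> c)) g"
  proof (cases "g \<in> carrier G")
    case g: True
    have "((a \<otimes>\<^bsub>QG\<^esub> b) \<otimes>\<^bsub>QG\<^esub> c) g = (\<Sum>y\<in>carrier G. \<Sum>x\<in>carrier G. a x * (b (inv x \<otimes> y) * c (inv y \<otimes> g)))"
      using g by (simp add: QG_mult sum_distrib_right mult.assoc)
    also have "\<dots> = (\<Sum>x\<in>carrier G. \<Sum>y\<in>carrier G. a x * (b (inv x \<otimes> y) * c (inv y \<otimes> g)))"
      by (rule sum.swap)
    also have "\<dots> = (\<Sum>x\<in>carrier G. \<Sum>y\<in>carrier G. a x * (b y * c (inv y \<otimes> (inv x \<otimes> g))))"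
    proof (rule sum.cong[OF refl])
      fix x assume x: "x \<in> carrier G"
      have "(\<Sum>y\<in>carrier G. a x * (b (inv x \<otimes> y) * c (inv y \<otimes> g)))
          = (\<Sum>y\<in>carrier G. a x * (b (inv x \<otimes> (x \<otimes> y)) * c (inv (x \<otimes> y) \<otimes> g)))"
        by (rule sum_mult_left[OF x, symmetric])
      also have "\<dots> = (\<Sum>y\<in>carrier G. a x * (b y * c (inv y \<otimes> (inv x \<otimes> g))))"
        using x g by (intro sum.cong refl) (simp add: m_assoc[symmetric] inv_mult_group)
      finally show "(\<Sum>y\<in>carrier G. a x * (b (inv x \<otimes> y) * c (inv y \<otimes> g)))
          = (\<Sum>y\<in>carrier G. a x * (b y * c (inv y \<otimes> (inv x \<otimes> g))))" .
    qed
    also have "\<dots> = (a \<otimes>\<^bsub>QG\<^esub> (b \<otimes>\<^bsub>QG\<^esub> c)) g"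
      using g by (simp add: QG_mult sum_distrib_left)
    finally show ?thesis .
  qed (simp add: QG_mult)
qed

lemma group_elem_carrier: "h \<in> carrier G \<Longrightarrow> group_elem h \<in> carrier QG"
  by (auto simp: QG_carrier group_elem_def)

lemma group_elem_mult: "h \<in> carrier G \<Longrightarrow> g \<in> carrier G \<Longrightarrow> (group_elem h \<otimes>\<^bsub>QG\<^esub> a) g = a (inv h \<otimes> g)"
  by (simp add: QG_mult group_elem_def if_distrib[of "\<lambda>x. x * _"] cong: if_cong)

lemma mult_group_elem:
  assumes "h \<in> carrier G" "g \<in> carrier G"
  shows "(a \<otimes>\<^bsub>QG\<^esub> group_elem h) g = a (g \<otimes> inv h)"
proof -
  have "inv x \<otimes> g = h \<longleftrightarrow> x = g \<otimes> inv h" if "x \<in> carrier G" for x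
    using that assms by (metis inv_closed inv_inv inv_mult_group inv_solve_left' m_closed)
  then have "(a \<otimes>\<^bsub>QG\<^esub> group_elem h) g = (\<Sum>x\<in>carrier G. if x = g \<otimes> inv h then a x else 0)"
    using assms by (simp add: QG_mult group_elem_def if_distrib[of "\<lambda>x. _ * x"] cong: sum.cong if_cong)
  then show ?thesis using assms by simp
qed

context
  fixes H :: "'g set"
  assumes H: "subgroup H G"
begin

abbreviation (input) avg :: "'g \<Rightarrow> rat" where "avg \<equiv> subgroup_average H"

lemma avg_carrier: "avg \<in> carrier QG"
  using subgroup.mem_carrier[OF H] by (auto simp: QG_carrier subgroup_average_def)

lemma avg_mult_sum: "g \<in> carrier G \<Longrightarrow> (avg \<otimes>\<^bsub>QG\<^esub> a) g = (\<Sum>h\<in>H. a (inv h \<otimes> g)) / of_nat (card H)"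
proof -
  assume g: "g \<in> carrier G"
  have "(avg \<otimes>\<^bsub>QG\<^esub> a) g = (\<Sum>h\<in>H. avg h * a (inv h \<otimes> g))"
    using g subgroup.subset[OF H] by (simp add: QG_mult, intro sum.mono_neutral_right) (auto simp: subgroup_average_def)
  also have "\<dots> = (\<Sum>h\<in>H. a (inv h \<otimes> g)) / of_nat (card H)"
    by (simp add: subgroup_average_def sum_divide_distrib)
  finally show ?thesis .
qed

lemma subgroup_left_mem: "h \<in> H \<Longrightarrow> g \<in> carrier G \<Longrightarrow> inv h \<otimes> g \<in> H \<longleftrightarrow> g \<in> H"
proof
  assume h: "h \<in> H" and g: "g \<in> carrier G"
  then have hc: "h \<in> carrier G" using subgroup.mem_carrier[OF H] by simp
  show "g \<in> H" if "inv h \<otimes> g \<in> H"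
  proof -
    have "h \<otimes> (inv h \<otimes> g) \<in> H" using subgroup.m_closed[OF H h that] .
    then show ?thesis using hc g by (simp add: m_assoc[symmetric])
  qed
  show "inv h \<otimes> g \<in> H" if "g \<in> H"
    using that h H by (simp add: subgroup.m_closed subgroup.m_inv_closed)
qed

lemma subgroup_right_mem: "h \<in> H \<Longrightarrow> g \<in> carrier G \<Longrightarrow> g \<otimes> inv h \<in> H \<longleftrightarrow> g \<in> H"
proof
  assume h: "h \<in> H" and g: "g \<in> carrier G"
  then have hc: "h \<in> carrier G" using subgroup.mem_carrier[OF H] by simp
  show "g \<in> H" if "g \<otimes> inv h \<in> H"
  proof -
    have "g \<otimes> inv h \<otimes> h \<in> H" using subgroup.m_closed[OF H that h] .
    then show ?thesis using hc g by (simp add: m_assoc)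
  qed
  show "g \<otimes> inv h \<in> H" if "g \<in> H"
    using that h H by (simp add: subgroup.m_closed subgroup.m_inv_closed)
qed

lemma avg_idem: "avg \<otimes>\<^bsub>QG\<^esub> avg = avg"
proof
  fix g
  have "card H > 0" using finite_subgroup[OF H] subgroup.one_closed[OF H] by (auto simp: card_gt_0_iff)
  then show "(avg \<otimes>\<^bsub>QG\<^esub> avg) g = avg g"
    using avg_carrier
    by (cases "g \<in> carrier G") (simp add: avg_mult_sum subgroup_average_def subgroup_left_mem, simp add: QG_carrier QG_mult)
qed

lemma group_elem_avg: "h \<in> H \<Longrightarrow> group_elem h \<otimes>\<^bsub>QG\<^esub> avg = avg"
proof
  fix g assume h: "h \<in> H"
  then show "(group_elem h \<otimes>\<^bsub>QG\<^esub> avg) g = avg g"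
    using avg_carrier subgroup.mem_carrier[OF H h]
    by (cases "g \<in> carrier G") (simp add: group_elem_mult subgroup_average_def subgroup_left_mem, simp add: QG_carrier QG_mult)
qed

lemma avg_group_elem: "h \<in> H \<Longrightarrow> avg \<otimes>\<^bsub>QG\<^esub> group_elem h = avg"
proof
  fix g assume h: "h \<in> H"
  then show "(avg \<otimes>\<^bsub>QG\<^esub> group_elem h) g = avg g"
    using avg_carrier subgroup.mem_carrier[OF H h]
    by (cases "g \<in> carrier G") (simp add: mult_group_elem subgroup_average_def subgroup_right_mem, simp add: QG_carrier QG_mult)
qed

end

end

section \<open>Homomorphisms from \<open>W\<close> into the rational group algebra\<close>

context rational_irrep
begin

lemma e_idem: "e \<otimes>\<^bsub>QG\<^esub> e = e"
  by (rule ext) (simp add: QG_mult e_convolution e_outside)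

lemma e_central: "e \<otimes>\<^bsub>QG\<^esub> a = a \<otimes>\<^bsub>QG\<^esub> e"
proof
  fix g
  show "(e \<otimes>\<^bsub>QG\<^esub> a) g = (a \<otimes>\<^bsub>QG\<^esub> e) g"
  proof (cases "g \<in> carrier G")
    case g: True
    have "(e \<otimes>\<^bsub>QG\<^esub> a) g = (\<Sum>x\<in>carrier G. e (inv x) * a (x \<otimes> g))"
      using g sum_inv[of "\<lambda>x. e x * a (inv x \<otimes> g)"] by (simp add: QG_mult)
    also have "\<dots> = (\<Sum>x\<in>carrier G. e (inv (x \<otimes> inv g)) * a (x \<otimes> inv g \<otimes> g))"
      using g by (subst sum_mult_right[of "inv g" "\<lambda>x. e (inv x) * a (x \<otimes> g)"]) auto
    also have "\<dots> = (\<Sum>x\<in>carrier G. a x * e (inv x \<otimes> g))"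
      using g by (intro sum.cong refl) (simp add: inv_mult_group m_assoc e_conj[of g] mult.commute)
    finally show ?thesis using g by (simp add: QG_mult)
  qed (simp add: QG_mult)
qed

text \<open>This is the scalar multiplication of \<open>rep_module G d W\<close>.\<close>

definition act :: "('g \<Rightarrow> rat) \<Rightarrow> rat vec \<Rightarrow> rat vec" where
  "act a w = vec d (\<lambda>i. \<Sum>g\<in>carrier G. a g * (W g *\<^sub>v w) $ i)"

lemma act_carrier: "act a w \<in> carrier_vec d"
  by (simp add: act_def)

definition ghom :: "(rat vec \<Rightarrow> 'g \<Rightarrow> rat) \<Rightarrow> bool" where
  "ghom t \<longleftrightarrow> (\<forall>u\<in>carrier_vec d. \<forall>v\<in>carrier_vec d. t (u + v) = (\<lambda>x. t u x + t v x)) \<and>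
    (\<forall>u\<in>carrier_vec d. \<forall>a\<in>carrier QG. t (act a u) = a \<otimes>\<^bsub>QG\<^esub> t u) \<and>
    (\<forall>u\<in>carrier_vec d. t u \<in> carrier QG)"

text \<open>Rational scalars sit in the group algebra as multiples of its identity, so homogeneity
  is a case of equivariance.\<close>

lemma ghom_smult:
  assumes "ghom t" "u \<in> carrier_vec d"
  shows "t (c \<cdot>\<^sub>v u) x = c * t u x"
proof -
  define a :: "'g \<Rightarrow> rat" where "a g = (if g = \<one> then c else 0)" for g
  have a: "a \<in> carrier QG" by (auto simp: QG_carrier a_def)
  have "act a u = c \<cdot>\<^sub>v u"
    using assms(2) W_carrier[OF one_closed]
    by (intro eq_vecI) (auto simp: act_def a_def is_rep_one[OF W_rep] if_distrib[of "\<lambda>x. x * _"] cong: if_cong)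
  then have "t (c \<cdot>\<^sub>v u) x = (a \<otimes>\<^bsub>QG\<^esub> t u) x" using assms a by (auto simp: ghom_def dest!: bspec)
  also have "\<dots> = c * t u x"
    using assms by (cases "x \<in> carrier G")
      (auto simp: QG_mult a_def ghom_def QG_carrier if_distrib[of "\<lambda>x. x * _"] cong: if_cong)
  finally show ?thesis .
qed

lemma ghom_add: "ghom t \<Longrightarrow> u \<in> carrier_vec d \<Longrightarrow> v \<in> carrier_vec d \<Longrightarrow> t (u + v) x = t u x + t v x"
  by (simp add: ghom_def)

lemma ghom_zero: "ghom t \<Longrightarrow> t (0\<^sub>v d) x = 0"
proof -
  assume t: "ghom t"
  have "0 \<cdot>\<^sub>v 0\<^sub>v d = (0\<^sub>v d :: rat vec)" by (intro eq_vecI) auto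
  then show ?thesis using ghom_smult[OF t, of "0\<^sub>v d" 0 x] by simp
qed

lemma ghom_expand:
  assumes t: "ghom t" and w: "w \<in> carrier_vec d"
  shows "t w x = (\<Sum>j<d. w $ j * t (unit_vec d j) x)"
proof -
  define w' where "w' m = vec d (\<lambda>j. if j < m then w $ j else 0)" for m
  have "t (w' m) x = (\<Sum>j<m. w $ j * t (unit_vec d j) x)" if "m \<le> d" for m
    using that
  proof (induction m)
    case 0
    have "w' 0 = 0\<^sub>v d" by (intro eq_vecI) (auto simp: w'_def)
    then show ?case by (simp add: ghom_zero[OF t])
  next
    case (Suc m)
    have "w' (Suc m) = w' m + w $ m \<cdot>\<^sub>v unit_vec d m"
      by (intro eq_vecI) (auto simp: w'_def unit_vec_def less_Suc_eq)
    then show ?case using Suc by (simp add: ghom_add[OF t] ghom_smult[OF t] w'_def)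
  qed
  moreover have "w' d = w" using w by (intro eq_vecI) (auto simp: w'_def)
  ultimately show ?thesis by force
qed

text \<open>Matrix coefficients of \<open>W\<close> as functions on the group; the inverse makes the
  map equivariant for left multiplication.\<close>

definition coeff_hom :: "nat \<Rightarrow> rat vec \<Rightarrow> 'g \<Rightarrow> rat" where
  "coeff_hom i w = (\<lambda>g. if g \<in> carrier G then (W (inv g) *\<^sub>v w) $ i else 0)"

lemma coeff_hom:
  assumes i: "i < d"
  shows "ghom (coeff_hom i)"
  unfolding ghom_def
proof (intro conjI ballI)
  fix u v :: "rat vec" assume u: "u \<in> carrier_vec d" and v: "v \<in> carrier_vec d"
  show "coeff_hom i (u + v) = (\<lambda>x. coeff_hom i u x + coeff_hom i v x)"
    using i u v W_carrier[OF inv_closed]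
    by (intro ext) (auto simp: coeff_hom_def mult_add_distrib_mat_vec[OF W_carrier[OF inv_closed] u v] carrier_matD(1)[OF W_carrier[OF inv_closed]] simp del: index_mult_mat_vec)
next
  fix u :: "rat vec" and a assume u: "u \<in> carrier_vec d" and a: "a \<in> carrier QG"
  show "coeff_hom i (act a u) = a \<otimes>\<^bsub>QG\<^esub> coeff_hom i u"
  proof
    fix g
    show "coeff_hom i (act a u) g = (a \<otimes>\<^bsub>QG\<^esub> coeff_hom i u) g"
    proof (cases "g \<in> carrier G")
      case g: True
      note Wg = W_carrier[OF inv_closed[OF g]]
      have "coeff_hom i (act a u) g = (\<Sum>j<d. \<Sum>h\<in>carrier G. W (inv g) $$ (i, j) * (a h * (W h *\<^sub>v u) $ j))"
      proof -
        have "act a u $ j = (\<Sum>h\<in>carrier G. a h * (W h *\<^sub>v u) $ j)" if "j < d" for j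
          using that by (simp add: act_def)
        then show ?thesis using g unfolding coeff_hom_def
          by (simp add: index_mult_mat_vec_sum[OF Wg act_carrier i] sum_distrib_left del: index_mult_mat_vec)
      qed
      also have "\<dots> = (\<Sum>h\<in>carrier G. a h * (W (inv g) *\<^sub>v (W h *\<^sub>v u)) $ i)"
        by (subst sum.swap, intro sum.cong refl)
          (simp add: index_mult_mat_vec_sum[OF Wg mult_mat_vec_carrier[OF W_carrier u] i] sum_distrib_left mult_ac del: index_mult_mat_vec)
      also have "\<dots> = (\<Sum>h\<in>carrier G. a h * coeff_hom i u (inv h \<otimes> g))"
        using g by (intro sum.cong refl)
          (simp add: coeff_hom_def inv_mult_group is_rep_mult[OF W_rep] assoc_mult_mat_vec[OF Wg W_carrier u] del: index_mult_mat_vec)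
      finally show ?thesis using g by (simp add: QG_mult)
    qed (simp add: coeff_hom_def QG_mult)
  qed
qed (simp add: coeff_hom_def QG_carrier)

lemma ghom_mult_right:
  assumes t: "ghom t"
  shows "ghom (\<lambda>w. t w \<otimes>\<^bsub>QG\<^esub> m)"
  unfolding ghom_def
proof (intro conjI ballI)
  fix u v :: "rat vec" assume u: "u \<in> carrier_vec d" and v: "v \<in> carrier_vec d"
  show "t (u + v) \<otimes>\<^bsub>QG\<^esub> m = (\<lambda>x. (t u \<otimes>\<^bsub>QG\<^esub> m) x + (t v \<otimes>\<^bsub>QG\<^esub> m) x)"
    by (rule ext) (simp add: QG_mult ghom_add[OF t u v] distrib_right sum.distrib)
next
  fix u :: "rat vec" and a assume "u \<in> carrier_vec d" "a \<in> carrier QG"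
  then have "t (act a u) = a \<otimes>\<^bsub>QG\<^esub> t u" using t by (simp add: ghom_def)
  then show "t (act a u) \<otimes>\<^bsub>QG\<^esub> m = a \<otimes>\<^bsub>QG\<^esub> (t u \<otimes>\<^bsub>QG\<^esub> m)" by (simp add: QG_mult_assoc)
qed (rule QG_mult_closed)

text \<open>The inverse in the definition of \<open>e\<close> matches that of
  \<open>coeff_hom\<close>, so \<open>tr_character_coefficients\<close> places \<open>e\<close> in
  the sum of the images of homomorphisms from \<open>W\<close>.\<close>

lemma e_expand:
  obtains q where "\<And>g. e g = (\<Sum>i<d. \<Sum>j<d. q i j * coeff_hom i (unit_vec d j) g)"
proof -
  obtain q where q: "\<And>g. g \<in> carrier G \<Longrightarrow> tr (\<chi> g) = (\<Sum>i<d. \<Sum>j<d. q i j * W g $$ (i, j))"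
    using tr_character_coefficients by blast
  show ?thesis
  proof
    fix g
    show "e g = (\<Sum>i<d. \<Sum>j<d. (of_nat n / of_nat ord_G * q i j) * coeff_hom i (unit_vec d j) g)"
    proof (cases "g \<in> carrier G")
      case g: True
      note Wg = W_carrier[OF inv_closed[OF g]]
      have "coeff_hom i (unit_vec d j) g = W (inv g) $$ (i, j)" if "i < d" "j < d" for i j
        using g that Wg by (simp add: coeff_hom_def col_mult_unit_vec[OF Wg])
      then show ?thesis using g by (simp add: e_eq q sum_distrib_left mult.assoc)
    qed (simp add: e_outside coeff_hom_def)
  qed
qed

lemma mult_as_combination:
  fixes t :: "nat \<Rightarrow> nat \<Rightarrow> 'g \<Rightarrow> rat"
  assumes "\<And>g. a g = (\<Sum>i<r. \<Sum>j<s. q i j * t i j g)"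
  shows "(a \<otimes>\<^bsub>QG\<^esub> b) x = (\<Sum>i<r. \<Sum>j<s. q i j * (t i j \<otimes>\<^bsub>QG\<^esub> b) x)"
proof (cases "x \<in> carrier G")
  case True
  then have "(a \<otimes>\<^bsub>QG\<^esub> b) x = (\<Sum>g\<in>carrier G. \<Sum>i<r. \<Sum>j<s. q i j * (t i j g * b (inv g \<otimes> x)))"
    by (simp add: QG_mult assms sum_distrib_right mult.assoc)
  also have "\<dots> = (\<Sum>i<r. \<Sum>j<s. \<Sum>g\<in>carrier G. q i j * (t i j g * b (inv g \<otimes> x)))"
    by (subst sum.swap, rule sum.cong[OF refl], subst sum.swap, rule refl)
  finally show ?thesis using True by (simp add: QG_mult sum_distrib_left)
qed (simp add: QG_mult)

text \<open>An embedding of the direct sum of \<open>k\<close> copies of \<open>W\<close> into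
  \<open>M\<close>, given by its components.\<close>

definition hom_family :: "('g \<Rightarrow> rat) set \<Rightarrow> nat \<Rightarrow> (nat \<Rightarrow> rat vec \<Rightarrow> 'g \<Rightarrow> rat) \<Rightarrow> bool" where
  "hom_family M k t \<longleftrightarrow> (\<forall>i<k. ghom (t i) \<and> (\<forall>w\<in>carrier_vec d. t i w \<in> M)) \<and>
    (\<forall>u. (\<forall>i<k. u i \<in> carrier_vec d) \<longrightarrow> (\<forall>x. (\<Sum>i<k. t i (u i) x) = 0) \<longrightarrow> (\<forall>i<k. u i = 0\<^sub>v d))"

lemma hom_familyD:
  assumes "hom_family M k t"
  shows "i < k \<Longrightarrow> ghom (t i)" "i < k \<Longrightarrow> w \<in> carrier_vec d \<Longrightarrow> t i w \<in> M"
    "(\<And>i. i < k \<Longrightarrow> u i \<in> carrier_vec d) \<Longrightarrow> (\<And>x. (\<Sum>i<k. t i (u i) x) = 0) \<Longrightarrow> i < k \<Longrightarrow> u i = 0\<^sub>v d"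
  using assms unfolding hom_family_def by blast+

text \<open>The embedded copies of \<open>W\<close> have total rational dimension
  \<open>k * d\<close> inside a space of dimension \<open>ord_G\<close>; this is what makes a
  maximal family exist.\<close>

lemma hom_family_bound:
  assumes t: "hom_family M k t"
  shows "k * d \<le> ord_G"
proof -
  obtain gs where gs: "set gs = carrier G" "distinct gs" using finite_distinct_list[OF fin] by blast
  have len: "length gs = ord_G" using distinct_card[OF gs(2)] gs(1) by (simp add: ord_G_def)
  define A where "A = mat ord_G (k * d) (\<lambda>(r, a). t (a div d) (unit_vec d (a mod d)) (gs ! r))"
  have A: "A \<in> carrier_mat ord_G (k * d)" by (simp add: A_def)
  show ?thesis
  proof (rule injective_mat_dim_le[OF A])
    fix v assume v: "v \<in> carrier_vec (k * d)" "A *\<^sub>v v = 0\<^sub>v ord_G"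
    define u where "u i = vec d (\<lambda>j. v $ (i * d + j))" for i
    have u: "u i \<in> carrier_vec d" for i by (simp add: u_def)
    have "(\<Sum>i<k. t i (u i) x) = 0" for x
    proof (cases "x \<in> carrier G")
      case True
      then obtain r where r: "r < ord_G" "gs ! r = x" using gs len by (metis in_set_conv_nth)
      have "0 = (A *\<^sub>v v) $ r" using r by (simp add: v(2))
      also have "\<dots> = (\<Sum>a<k * d. A $$ (r, a) * v $ a)" by (rule index_mult_mat_vec_sum[OF A v(1) r(1)])
      also have "\<dots> = (\<Sum>a<k * d. t (a div d) (unit_vec d (a mod d)) x * v $ a)"
        using r by (simp add: A_def)
      also have "\<dots> = (\<Sum>i<k. \<Sum>j<d. u i $ j * t i (unit_vec d j) x)"
        unfolding sum_nat_pairs by (intro sum.cong refl) (simp add: u_def mult.commute)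
      also have "\<dots> = (\<Sum>i<k. t i (u i) x)"
        by (intro sum.cong refl) (simp add: ghom_expand[OF hom_familyD(1)[OF t] u])
      finally show ?thesis by simp
    next
      case False
      then have "t i (u i) x = 0" if "i < k" for i
        using hom_familyD(1)[OF t that] u unfolding ghom_def QG_carrier by blast
      then show ?thesis by simp
    qed
    then have u0: "u i = 0\<^sub>v d" if "i < k" for i using hom_familyD(3)[OF t, of u] u that by blast
    have "v $ a = 0" if a: "a < k * d" for a
    proof -
      have "a div d < k" using a by (rule less_mult_imp_div_less)
      then have "u (a div d) $ (a mod d) = 0" using u0 d_pos by simp
      then show ?thesis using d_pos by (simp add: u_def div_mult_mod_eq)
    qed
    then show "v = 0\<^sub>v (k * d)" using v by (intro eq_vecI) auto
  qed
qed

text \<open>A left ideal on which \<open>e\<close> acts as the identity is the sum of the images of the homomorphisms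
  \<open>w \<mapsto> coeff_hom i w \<cdot> m\<close>, so a maximal independent family of homomorphisms from \<open>W\<close> spans it.\<close>

lemma left_ideal_hom_family:
  assumes M: "M \<subseteq> carrier QG" and closed: "\<And>a m. m \<in> M \<Longrightarrow> a \<in> carrier QG \<Longrightarrow> a \<otimes>\<^bsub>QG\<^esub> m \<in> M"
    and id: "\<And>m. m \<in> M \<Longrightarrow> e \<otimes>\<^bsub>QG\<^esub> m = m"
  obtains k t where "hom_family M k t"
    "\<And>m. m \<in> M \<Longrightarrow> \<exists>u. (\<forall>i<k. u i \<in> carrier_vec d) \<and> (\<forall>x. m x = (\<Sum>i<k. t i (u i) x))"
proof -
  have "hom_family M 0 (\<lambda>_ _ _. 0)" by (simp add: hom_family_def)
  moreover have "k \<le> ord_G" if "hom_family M k t" for k t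
  proof -
    have "k \<le> k * d" using d_pos by (cases d) auto
    then show ?thesis using hom_family_bound[OF that] by linarith
  qed
  ultimately obtain k where k: "\<exists>t. hom_family M k t" "\<And>k'. \<exists>t. hom_family M k' t \<Longrightarrow> k' \<le> k"
    using ex_has_greatest_nat[of "\<lambda>k. \<exists>t. hom_family M k t" 0 "\<lambda>k. k" "Suc ord_G"] by (auto simp: less_Suc_eq_le)
  then obtain t where t: "hom_family M k t" by blast
  note th = hom_familyD(1)[OF t]
  define N where "N = {m. \<exists>u. (\<forall>i<k. u i \<in> carrier_vec d) \<and> (\<forall>x. m x = (\<Sum>i<k. t i (u i) x))}"
  have N_add: "(\<lambda>x. m x + m' x) \<in> N" if mm: "m \<in> N" "m' \<in> N" for m m'
  proof -
    obtain u u' where u: "\<forall>i<k. u i \<in> carrier_vec d" "\<forall>x. m x = (\<Sum>i<k. t i (u i) x)"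
      and u': "\<forall>i<k. u' i \<in> carrier_vec d" "\<forall>x. m' x = (\<Sum>i<k. t i (u' i) x)"
      using mm unfolding N_def by blast
    show ?thesis unfolding N_def
      using u u' by (intro CollectI exI[of _ "\<lambda>i. u i + u' i"]) (simp add: ghom_add[OF th] sum.distrib)
  qed
  have N_smult: "(\<lambda>x. c * m x) \<in> N" if m: "m \<in> N" for c m
  proof -
    obtain u where u: "\<forall>i<k. u i \<in> carrier_vec d" "\<forall>x. m x = (\<Sum>i<k. t i (u i) x)"
      using m unfolding N_def by blast
    show ?thesis unfolding N_def
      using u by (intro CollectI exI[of _ "\<lambda>i. c \<cdot>\<^sub>v u i"]) (simp add: ghom_smult[OF th] sum_distrib_left)
  qed
  have N_zero: "(\<lambda>x. 0) \<in> N"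
    unfolding N_def by (intro CollectI exI[of _ "\<lambda>i. 0\<^sub>v d"]) (simp add: ghom_zero[OF th])
  have N_sum: "(\<lambda>x. \<Sum>i\<in>I. F i x) \<in> N" if "finite I" "\<And>i. i \<in> I \<Longrightarrow> F i \<in> N" for F :: "nat \<Rightarrow> 'g \<Rightarrow> rat" and I
    using that by (induction I rule: finite_induct) (auto intro: N_zero N_add)
  have N_mult: "a \<otimes>\<^bsub>QG\<^esub> m \<in> N" if m: "m \<in> N" and a: "a \<in> carrier QG" for a m
  proof -
    obtain u where u: "\<forall>i<k. u i \<in> carrier_vec d" "\<forall>x. m x = (\<Sum>i<k. t i (u i) x)"
      using m unfolding N_def by blast
    have "(a \<otimes>\<^bsub>QG\<^esub> m) x = (\<Sum>i<k. t i (act a (u i)) x)" for x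
    proof -
      have "t i (act a (u i)) = a \<otimes>\<^bsub>QG\<^esub> t i (u i)" if "i < k" for i
        using th[OF that] u(1) a that by (simp add: ghom_def)
      then have "(\<Sum>i<k. t i (act a (u i)) x) = (\<Sum>i<k. (a \<otimes>\<^bsub>QG\<^esub> t i (u i)) x)" by simp
      also have "\<dots> = (a \<otimes>\<^bsub>QG\<^esub> m) x"
      proof (cases "x \<in> carrier G")
        case True
        then show ?thesis using u(2) by (simp add: QG_mult sum_distrib_left) (rule sum.swap)
      qed (simp add: QG_mult)
      finally show ?thesis by simp
    qed
    then show ?thesis unfolding N_def by (intro CollectI exI[of _ "\<lambda>i. act a (u i)"]) (simp add: act_carrier)
  qed
  have image: "s w \<in> N" if s: "ghom s" "\<And>w. w \<in> carrier_vec d \<Longrightarrow> s w \<in> M" and w: "w \<in> carrier_vec d" for s w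
  proof -
    define U where "U = {w \<in> carrier_vec d. s w \<in> N}"
    have "U = {0\<^sub>v d} \<or> U = carrier_vec d"
    proof (rule irreducible_rep_dichotomy[OF W_irr])
      have "s (0\<^sub>v d) = (\<lambda>x. 0)" using ghom_zero[OF s(1)] by blast
      then show "0\<^sub>v d \<in> U" using N_zero by (simp add: U_def)
    next
      fix u v assume uv: "u \<in> U" "v \<in> U"
      then have "s (u + v) = (\<lambda>x. s u x + s v x)" using s(1) by (simp add: U_def ghom_def)
      then show "u + v \<in> U" using uv N_add by (simp add: U_def)
    next
      fix c u assume u: "u \<in> U"
      then have "s (c \<cdot>\<^sub>v u) = (\<lambda>x. c * s u x)" using ghom_smult[OF s(1)] by (auto simp: U_def)
      then show "c \<cdot>\<^sub>v u \<in> U" using u N_smult by (simp add: U_def)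
    next
      fix g u assume g: "g \<in> carrier G" and u: "u \<in> U"
      then have uc: "u \<in> carrier_vec d" by (simp add: U_def)
      have "act (group_elem g) u = W g *\<^sub>v u"
        using g W_carrier[OF g] by (intro eq_vecI)
          (auto simp: act_def group_elem_def if_distrib[of "\<lambda>x. x * _"] simp del: index_mult_mat_vec cong: if_cong)
      then have "s (W g *\<^sub>v u) = group_elem g \<otimes>\<^bsub>QG\<^esub> s u"
        using s(1) uc group_elem_carrier[OF g] unfolding ghom_def by metis
      then show "W g *\<^sub>v u \<in> U"
        using u N_mult group_elem_carrier[OF g] mult_mat_vec_carrier[OF W_carrier[OF g] uc] by (simp add: U_def)
    qed (auto simp: U_def)
    \<comment> \<open>A homomorphism whose image meets N only in 0 could be adjoined to the family,
      against the maximality of \<open>k\<close>.\<close>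
    moreover have "U \<noteq> {0\<^sub>v d}"
    proof
      assume U0: "U = {0\<^sub>v d}"
      have "hom_family M (Suc k) (t(k := s))"
        unfolding hom_family_def
      proof (rule conjI; intro allI impI)
        fix i assume "i < Suc k"
        then show "ghom ((t(k := s)) i) \<and> (\<forall>w\<in>carrier_vec d. (t(k := s)) i w \<in> M)"
          using s th hom_familyD(2)[OF t] by (cases "i = k") (simp_all add: less_Suc_eq)
      next
        fix u i assume u: "\<forall>i<Suc k. u i \<in> carrier_vec d" and 0: "\<forall>x. (\<Sum>i<Suc k. (t(k := s)) i (u i) x) = 0" and i: "i < Suc k"
        have rel: "(\<Sum>i<k. t i (u i) x) + s (u k) x = 0" for x using 0 by simp
        have sum_N: "(\<lambda>x. \<Sum>i<k. t i (u i) x) \<in> N" unfolding N_def by (intro CollectI exI[of _ u]) (use u in simp)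
        have "s (u k) = (\<lambda>x. -1 * (\<Sum>i<k. t i (u i) x))"
          using rel by (simp add: fun_eq_iff eq_neg_iff_add_eq_0 add.commute)
        then have "u k \<in> U" using N_smult[OF sum_N, of "-1"] u by (simp add: U_def)
        then have uk: "u k = 0\<^sub>v d" using U0 by simp
        have rel0: "(\<Sum>i<k. t i (u i) x) = 0" for x using rel[of x] ghom_zero[OF s(1), of x] by (simp add: uk)
        have "u i = 0\<^sub>v d" if "i < k" for i
          by (rule hom_familyD(3)[OF t _ rel0 that]) (use u in simp)
        then show "u i = 0\<^sub>v d" using i uk by (auto simp: less_Suc_eq)
      qed
      then show False using k(2)[of "Suc k"] by auto
    qed
    ultimately show ?thesis using w by (auto simp: U_def)
  qed
  obtain q where q: "\<And>g. e g = (\<Sum>i<d. \<Sum>j<d. q i j * coeff_hom i (unit_vec d j) g)"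
    using e_expand by blast
  have M_N: "m \<in> N" if m: "m \<in> M" for m
  proof -
    have "m = (\<lambda>x. \<Sum>i<d. \<Sum>j<d. q i j * (coeff_hom i (unit_vec d j) \<otimes>\<^bsub>QG\<^esub> m) x)"
    proof
      fix x
      show "m x = (\<Sum>i<d. \<Sum>j<d. q i j * (coeff_hom i (unit_vec d j) \<otimes>\<^bsub>QG\<^esub> m) x)"
        using mult_as_combination[where a = e and t = "\<lambda>i j. coeff_hom i (unit_vec d j)" and b = m and x = x, OF q] unfolding id[OF m] .
    qed
    also have "\<dots> \<in> N"
    proof (intro N_sum N_smult finite_lessThan)
      fix i j assume "i \<in> {..<d}" "j \<in> {..<d}"
      then show "coeff_hom i (unit_vec d j) \<otimes>\<^bsub>QG\<^esub> m \<in> N"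
        using m by (intro image[of "\<lambda>w. coeff_hom i w \<otimes>\<^bsub>QG\<^esub> m"] ghom_mult_right coeff_hom closed)
          (auto simp: QG_carrier coeff_hom_def)
    qed
    finally show ?thesis .
  qed
  show ?thesis
  proof (rule that[OF t])
    fix m assume "m \<in> M"
    then show "\<exists>u. (\<forall>i<k. u i \<in> carrier_vec d) \<and> (\<forall>x. m x = (\<Sum>i<k. t i (u i) x))"
      using M_N unfolding N_def by simp
  qed
qed

end

section \<open>The left ideal generated by the idempotent\<close>

context rational_irrep
begin

definition family_map :: "nat \<Rightarrow> (nat \<Rightarrow> rat vec \<Rightarrow> 'g \<Rightarrow> rat) \<Rightarrow> (nat \<Rightarrow> rat vec) \<Rightarrow> 'g \<Rightarrow> rat" where
  "family_map k t u = (\<lambda>x. \<Sum>i<k. t i (u i) x)"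

lemma family_map_inj:
  assumes t: "hom_family M k t"
  shows "inj_on (family_map k t) ({..<k} \<rightarrow>\<^sub>E carrier_vec d)"
proof (rule inj_onI)
  fix u v assume u: "u \<in> {..<k} \<rightarrow>\<^sub>E carrier_vec d" and v: "v \<in> {..<k} \<rightarrow>\<^sub>E carrier_vec d"
    and eq: "family_map k t u = family_map k t v"
  have uv: "u i \<in> carrier_vec d" "v i \<in> carrier_vec d" if "i < k" for i using u v that by (auto simp: PiE_iff)
  note th = hom_familyD(1)[OF t]
  define w where "w i = u i + (-1) \<cdot>\<^sub>v v i" for i
  have w: "w i \<in> carrier_vec d" if "i < k" for i using uv[OF that] by (simp add: w_def)
  have sum0: "(\<Sum>i<k. t i (w i) x) = 0" for x
  proof -
    have "(\<Sum>i<k. t i (w i) x) = (\<Sum>i<k. t i (u i) x - t i (v i) x)"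
      by (intro sum.cong refl) (simp add: w_def ghom_add[OF th] ghom_smult[OF th] uv)
    then show ?thesis using fun_cong[OF eq, of x] by (simp add: family_map_def sum_subtractf)
  qed
  have w0: "w i = 0\<^sub>v d" if "i < k" for i by (rule hom_familyD(3)[OF t w sum0 that])
  have uv_eq: "u i = v i" if i: "i < k" for i
  proof (rule eq_vecI)
    fix j assume "j < dim_vec (v i)"
    then have j: "j < d" using uv[OF i] by simp
    have "w i $ j = 0" using w0[OF i] j by simp
    then show "u i $ j = v i $ j" using uv[OF i] j by (simp add: w_def)
  qed (use uv[OF i] in simp)
  show "u = v"
    by (rule PiE_ext[OF u v]) (simp add: uv_eq)
qed

text \<open>With \<open>A\<close> the coordinates of the projection \<open>a \<mapsto> a f\<close> and \<open>B\<close> those of the isomorphism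
  \<open>W\<^sup>k \<cong> \<rat>[G] f\<close>, the identity \<open>tr (A B) = tr (B A)\<close> compares \<open>k d\<close> with the trace of right
  multiplication by \<open>f\<close>.\<close>

lemma idempotent_ideal_rank:
  assumes f: "f \<otimes>\<^bsub>QG\<^esub> f = f"
    and t: "hom_family (left_ideal QG f) k t"
    and onto: "\<And>m. m \<in> left_ideal QG f \<Longrightarrow> \<exists>u. (\<forall>i<k. u i \<in> carrier_vec d) \<and> (\<forall>x. m x = (\<Sum>i<k. t i (u i) x))"
  shows "of_nat (k * d) = of_nat ord_G * f \<one>"
proof -
  note th = hom_familyD(1)[OF t]
  have ideal_f: "m \<otimes>\<^bsub>QG\<^esub> f = m" if "m \<in> left_ideal QG f" for m
    using that f by (auto simp: left_ideal_def QG_mult_assoc)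
  have "\<exists>u. g \<in> carrier G \<longrightarrow> (\<forall>i<k. u i \<in> carrier_vec d) \<and> (\<forall>x. (group_elem g \<otimes>\<^bsub>QG\<^esub> f) x = (\<Sum>i<k. t i (u i) x))" for g
    using onto[of "group_elem g \<otimes>\<^bsub>QG\<^esub> f"] group_elem_carrier[of g] by (auto simp: left_ideal_def)
  then obtain u where u: "\<And>g i. g \<in> carrier G \<Longrightarrow> i < k \<Longrightarrow> u g i \<in> carrier_vec d"
    and uf: "\<And>g x. g \<in> carrier G \<Longrightarrow> (group_elem g \<otimes>\<^bsub>QG\<^esub> f) x = (\<Sum>i<k. t i (u g i) x)"
    by metis
  \<comment> \<open>These are diagonal entries of the product of the two coordinate matrices in the
    order that gives the identity of W^k: an element of the ideal is unchanged by right
    multiplication with \<open>f\<close>.\<close>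
  have diag: "(\<Sum>g\<in>carrier G. t i0 (unit_vec d j0) g * u g i0 $ j0) = 1" if i0: "i0 < k" and j0: "j0 < d" for i0 j0
  proof -
    define b where "b = t i0 (unit_vec d j0)"
    have b_mem: "b \<in> left_ideal QG f" unfolding b_def by (rule hom_familyD(2)[OF t i0]) simp
    \<comment> \<open>The coordinates of b f, obtained by expanding b over the group and using
      \<open>u\<close>, minus the coordinates of b itself. As b f = b, they represent 0.\<close>
    define w where "w i = vec d (\<lambda>j. (\<Sum>g\<in>carrier G. b g * u g i $ j) - (if i = i0 \<and> j = j0 then 1 else 0))" for i
    have w: "w i \<in> carrier_vec d" for i by (simp add: w_def)
    have sum0: "(\<Sum>i<k. t i (w i) x) = 0" for x
    proof (cases "x \<in> carrier G")
      case x: True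
      have tw: "t i (w i) x = (\<Sum>g\<in>carrier G. b g * t i (u g i) x) - (if i = i0 then b x else 0)" if i: "i < k" for i
      proof -
        have "t i (w i) x = (\<Sum>j<d. (\<Sum>g\<in>carrier G. b g * u g i $ j) * t i (unit_vec d j) x)
            - (\<Sum>j<d. (if i = i0 \<and> j = j0 then 1 else 0) * t i (unit_vec d j) x)"
          unfolding ghom_expand[OF th[OF i] w] sum_subtractf[symmetric]
          by (intro sum.cong refl) (simp add: w_def left_diff_distrib)
        also have "(\<Sum>j<d. (if i = i0 \<and> j = j0 then 1 else 0) * t i (unit_vec d j) x) = (if i = i0 then b x else 0)"
          using j0 by (auto simp: b_def if_distrib[of "\<lambda>x. x * _"] cong: if_cong)
        also have "(\<Sum>j<d. (\<Sum>g\<in>carrier G. b g * u g i $ j) * t i (unit_vec d j) x)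
            = (\<Sum>g\<in>carrier G. b g * (\<Sum>j<d. u g i $ j * t i (unit_vec d j) x))"
          by (simp add: sum_distrib_left sum_distrib_right mult.assoc) (rule sum.swap)
        also have "\<dots> = (\<Sum>g\<in>carrier G. b g * t i (u g i) x)"
          using u i by (intro sum.cong refl) (simp add: ghom_expand[OF th[OF i], symmetric])
        finally show ?thesis .
      qed
      have "(\<Sum>i<k. t i (w i) x) = (\<Sum>i<k. (\<Sum>g\<in>carrier G. b g * t i (u g i) x) - (if i = i0 then b x else 0))"
        by (intro sum.cong refl) (simp add: tw)
      also have "\<dots> = (\<Sum>i<k. \<Sum>g\<in>carrier G. b g * t i (u g i) x) - b x"
        using i0 by (simp add: sum_subtractf)
      also have "(\<Sum>i<k. \<Sum>g\<in>carrier G. b g * t i (u g i) x) = (\<Sum>g\<in>carrier G. b g * (\<Sum>i<k. t i (u g i) x))"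
        by (subst sum.swap) (simp add: sum_distrib_left)
      also have "\<dots> = (\<Sum>g\<in>carrier G. b g * f (inv g \<otimes> x))"
        using x by (intro sum.cong refl) (simp add: uf[symmetric] group_elem_mult)
      also have "\<dots> = (b \<otimes>\<^bsub>QG\<^esub> f) x" using x by (simp add: QG_mult)
      finally show ?thesis by (simp add: ideal_f[OF b_mem])
    next
      case False
      then have "t i (w i) x = 0" if "i < k" for i
        using th[OF that] w unfolding ghom_def QG_carrier by blast
      then show ?thesis by simp
    qed
    have "w i0 = 0\<^sub>v d" by (rule hom_familyD(3)[OF t w sum0 i0])
    then have "w i0 $ j0 = 0" using j0 by simp
    then show ?thesis using j0 by (simp add: w_def b_def)
  qed
  have "of_nat (k * d) = (\<Sum>i<k. \<Sum>j<d. (1::rat))" by simp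
  also have "\<dots> = (\<Sum>i<k. \<Sum>j<d. \<Sum>g\<in>carrier G. t i (unit_vec d j) g * u g i $ j)"
    by (intro sum.cong refl) (simp add: diag)
  also have "\<dots> = (\<Sum>i<k. \<Sum>g\<in>carrier G. t i (u g i) g)"
  proof (intro sum.cong refl)
    fix i assume "i \<in> {..<k}"
    then have i: "i < k" by simp
    have "(\<Sum>j<d. \<Sum>g\<in>carrier G. t i (unit_vec d j) g * u g i $ j)
        = (\<Sum>g\<in>carrier G. \<Sum>j<d. u g i $ j * t i (unit_vec d j) g)"
      by (subst sum.swap) (simp add: mult.commute)
    also have "\<dots> = (\<Sum>g\<in>carrier G. t i (u g i) g)"
      using u i by (intro sum.cong refl) (simp add: ghom_expand[OF th[OF i], symmetric])
    finally show "(\<Sum>j<d. \<Sum>g\<in>carrier G. t i (unit_vec d j) g * u g i $ j) = (\<Sum>g\<in>carrier G. t i (u g i) g)" .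
  qed
  also have "\<dots> = (\<Sum>g\<in>carrier G. \<Sum>i<k. t i (u g i) g)" by (rule sum.swap)
  \<comment> \<open>The coefficient at g of g f is the coefficient of \<open>f\<close> at the
    identity, the same for every g.\<close>
  also have "\<dots> = (\<Sum>g\<in>carrier G. f \<one>)"
    by (intro sum.cong refl) (simp add: uf[symmetric] group_elem_mult)
  finally show ?thesis by (simp add: ord_G_def)
qed

lemma left_ideal_isomorphic:
  assumes f: "f \<in> carrier QG"
    and t: "hom_family (left_ideal QG f) k t"
    and onto: "\<And>m. m \<in> left_ideal QG f \<Longrightarrow> \<exists>u. (\<forall>i<k. u i \<in> carrier_vec d) \<and> (\<forall>x. m x = (\<Sum>i<k. t i (u i) x))"
  shows "isomorphic_modules QG (left_ideal_module QG f) (module_power k (rep_module G d W))"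
proof -
  note th = hom_familyD(1)[OF t]
  let ?P = "{..<k} \<rightarrow>\<^sub>E carrier_vec d" and ?I = "left_ideal QG f" and ?\<Phi> = "family_map k t"
  have add_closed: "(\<lambda>x. m x + m' x) \<in> ?I" if mm: "m \<in> ?I" "m' \<in> ?I" for m m'
  proof -
    obtain a a' where a: "a \<in> carrier QG" "m = a \<otimes>\<^bsub>QG\<^esub> f" and a': "a' \<in> carrier QG" "m' = a' \<otimes>\<^bsub>QG\<^esub> f"
      using mm by (auto simp: left_ideal_def)
    have "(\<lambda>x. m x + m' x) = (\<lambda>x. a x + a' x) \<otimes>\<^bsub>QG\<^esub> f"
      unfolding a(2) a'(2) by (rule ext) (simp add: QG_mult distrib_right sum.distrib)
    moreover have "(\<lambda>x. a x + a' x) \<in> carrier QG" using a(1) a'(1) by (simp add: QG_carrier)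
    ultimately show ?thesis unfolding left_ideal_def by blast
  qed
  have zero_mem: "(\<lambda>x. 0) \<in> ?I"
  proof -
    have "(\<lambda>x. 0) = (\<lambda>x. 0) \<otimes>\<^bsub>QG\<^esub> f" by (rule ext) (simp add: QG_mult)
    then show ?thesis unfolding left_ideal_def by (auto simp: QG_carrier)
  qed
  have \<Phi>_mem: "?\<Phi> u \<in> ?I" if u: "u \<in> ?P" for u
  proof -
    have "(\<lambda>x. \<Sum>i<m. t i (u i) x) \<in> ?I" if "m \<le> k" for m
      using that
    proof (induction m)
      case (Suc m)
      then have m: "m < k" by simp
      have "u m \<in> carrier_vec d" using u m by (simp add: PiE_iff)
      then have "t m (u m) \<in> ?I" by (rule hom_familyD(2)[OF t m])
      moreover have "(\<lambda>x. \<Sum>i<m. t i (u i) x) \<in> ?I" using Suc by simp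
      ultimately show ?case using add_closed[of "\<lambda>x. \<Sum>i<m. t i (u i) x" "t m (u m)"] by simp
    qed (simp add: zero_mem)
    then show ?thesis by (simp add: family_map_def)
  qed
  have bij: "bij_betw ?\<Phi> ?P ?I"
    unfolding bij_betw_def
  proof (intro conjI family_map_inj[OF t] equalityI subsetI)
    fix m assume "m \<in> ?I"
    then obtain u where u: "\<forall>i<k. u i \<in> carrier_vec d" "\<forall>x. m x = (\<Sum>i<k. t i (u i) x)" using onto by blast
    have "restrict u {..<k} \<in> ?P" using u(1) by auto
    moreover have "m = ?\<Phi> (restrict u {..<k})" using u(2) by (simp add: family_map_def fun_eq_iff)
    ultimately show "m \<in> ?\<Phi> ` ?P" by blast
  qed (use \<Phi>_mem in blast)
  \<comment> \<open>The isomorphism has to start from the ideal, so the family map is inverted;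
    additivity and equivariance of the inverse are obtained by comparing images under the family
    map.\<close>
  define \<psi> where "\<psi> = the_inv_into ?P ?\<Phi>"
  have \<psi>_bij: "bij_betw \<psi> ?I ?P" unfolding \<psi>_def by (rule bij_betw_the_inv_into[OF bij])
  have \<psi>_mem: "\<psi> m \<in> ?P" if "m \<in> ?I" for m using \<psi>_bij that by (auto simp: bij_betw_def)
  have \<Phi>\<psi>: "?\<Phi> (\<psi> m) = m" if "m \<in> ?I" for m
    unfolding \<psi>_def by (rule f_the_inv_into_f_bij_betw[OF bij]) (use that in simp)
  have \<psi>_eq: "\<psi> (?\<Phi> u) = u" if "u \<in> ?P" for u
    unfolding \<psi>_def by (rule the_inv_into_f_f[OF bij_betw_imp_inj_on[OF bij] that])
  have \<psi>_car: "\<psi> m i \<in> carrier_vec d" if "m \<in> ?I" "i < k" for m i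
    using \<psi>_mem[OF that(1)] that(2) by (auto simp: PiE_iff)
  have "\<psi> \<in> LinearCombinations.module_hom QG (left_ideal_module QG f) (module_power k (rep_module G d W))"
    unfolding LinearCombinations.module_hom_def left_ideal_module_def module_power_def rep_module_def
  proof (simp only: partial_object.select_convs ring.select_convs module.select_convs, intro CollectI conjI allI impI)
    show "\<psi> \<in> ?I \<rightarrow> ?P" using \<psi>_mem by blast
  next
    fix m1 m2 assume m: "m1 \<in> ?I \<and> m2 \<in> ?I"
    let ?u = "\<lambda>i\<in>{..<k}. \<psi> m1 i + \<psi> m2 i"
    have "?u \<in> ?P" using \<psi>_car m by auto
    moreover have "?\<Phi> ?u = m1 \<oplus>\<^bsub>QG\<^esub> m2"
    proof
      fix x
      have "?\<Phi> ?u x = ?\<Phi> (\<psi> m1) x + ?\<Phi> (\<psi> m2) x"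
        using m \<psi>_car by (simp add: family_map_def ghom_add[OF th] sum.distrib)
      then show "?\<Phi> ?u x = (m1 \<oplus>\<^bsub>QG\<^esub> m2) x" using m by (simp add: \<Phi>\<psi> QG_add)
    qed
    ultimately show "\<psi> (m1 \<oplus>\<^bsub>QG\<^esub> m2) = ?u" using \<psi>_eq by metis
  next
    fix a m assume am: "a \<in> carrier QG \<and> m \<in> ?I"
    let ?u = "\<lambda>i\<in>{..<k}. act a (\<psi> m i)"
    have "?u \<in> ?P" by (auto simp: act_carrier)
    moreover have "?\<Phi> ?u = a \<otimes>\<^bsub>QG\<^esub> m"
    proof
      fix x
      have tact: "t i (act a (\<psi> m i)) = a \<otimes>\<^bsub>QG\<^esub> t i (\<psi> m i)" if "i < k" for i
        using th[OF that] \<psi>_car[OF _ that] am by (simp add: ghom_def)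
      have "?\<Phi> ?u x = (\<Sum>i<k. (a \<otimes>\<^bsub>QG\<^esub> t i (\<psi> m i)) x)" by (simp add: family_map_def tact)
      also have "\<dots> = (a \<otimes>\<^bsub>QG\<^esub> ?\<Phi> (\<psi> m)) x"
      proof (cases "x \<in> carrier G")
        case True
        then show ?thesis by (simp add: QG_mult family_map_def sum_distrib_left) (rule sum.swap)
      qed (simp add: QG_mult)
      finally show "?\<Phi> ?u x = (a \<otimes>\<^bsub>QG\<^esub> m) x" using am by (simp add: \<Phi>\<psi>)
    qed
    ultimately show "\<psi> (a \<otimes>\<^bsub>QG\<^esub> m) = (\<lambda>i\<in>{..<k}. vec d (\<lambda>ia. \<Sum>g\<in>carrier G. a g * (W g *\<^sub>v \<psi> m i) $ ia))"
      unfolding act_def[symmetric] using \<psi>_eq by metis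
  qed
  then show ?thesis
    unfolding isomorphic_modules_def using \<psi>_bij
    by (intro bexI[of _ \<psi>]) (simp_all add: left_ideal_module_def module_power_def rep_module_def)
qed

end

section \<open>Induction of the trivial representation and Frobenius reciprocity\<close>

context finite_group
begin

text \<open>It ensures that the choice of a transversal in \<open>induced_rep\<close> is a genuine
  one.\<close>

lemma transversal_exists:
  assumes H: "subgroup H G"
  shows "\<exists>ts. left_transversal G H ts"
proof -
  have "finite (lcosets H)" by (simp add: LCOSETS_def)
  then obtain cs where cs: "set cs = lcosets H" "distinct cs" using finite_distinct_list by blast
  define r where "r C = (SOME x. x \<in> carrier G \<and> x <# H = C)" for C
  have r: "r C \<in> carrier G \<and> r C <# H = C" if C: "C \<in> lcosets H" for C
    unfolding r_def
  proof (rule someI_ex)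
    obtain a where "a \<in> carrier G" "C = a <# H"
      using C unfolding LCOSETS_def by blast
    then show "\<exists>x. x \<in> carrier G \<and> x <# H = C" by (intro exI[of _ a] conjI) simp_all
  qed
  define ts where "ts = map r cs"
  have nth: "ts ! i <# H = cs ! i" if i: "i < length cs" for i
  proof -
    have "cs ! i \<in> lcosets H" using cs(1) i nth_mem by blast
    then show ?thesis using r i by (simp add: ts_def)
  qed
  have "set ts \<subseteq> carrier G" using r cs(1) by (auto simp: ts_def)
  moreover have "bij_betw (\<lambda>i. ts ! i <# H) {..<length ts} (lcosets H)"
  proof -
    have len: "length ts = length cs" by (simp add: ts_def)
    have "bij_betw (\<lambda>i. ts ! i <# H) {..<length cs} (lcosets H) = bij_betw (\<lambda>i. cs ! i) {..<length cs} (lcosets H)"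
      by (rule bij_betw_cong) (simp add: nth)
    then show ?thesis
      unfolding len using bij_betw_nth[OF cs(2) refl cs(1)[symmetric]] by (simp only:)
  qed
  ultimately show ?thesis unfolding left_transversal_def by blast
qed

text \<open>Conjugation by a representative turns its contribution to the induced character into a
  sum over \<open>H\<close>, the same for all representatives. The inner product is therefore the
  sum over \<open>H\<close> times the positive factor \<open>k\<close> divided by the group
  order.\<close>

lemma frobenius_trivial:
  fixes \<psi> :: "'g \<Rightarrow> complex"
  assumes H: "subgroup H G"
    and conj: "\<And>g h. g \<in> carrier G \<Longrightarrow> h \<in> carrier G \<Longrightarrow> \<psi> (g \<otimes> h) = \<psi> (h \<otimes> g)"
  shows "char_inner G (character (induced_rep G H 1 trivial_rep)) \<psi> = 0 \<longleftrightarrow> (\<Sum>h\<in>H. cnj (\<psi> h)) = 0"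
proof -
  define ts where "ts = (SOME ts. left_transversal G H ts)"
  have ts: "left_transversal G H ts" unfolding ts_def by (rule someI_ex[OF transversal_exists[OF H]])
  define k where "k = length ts"
  have t: "ts ! i \<in> carrier G" if "i < k" for i using ts that by (auto simp: left_transversal_def k_def)
  have "carrier G \<noteq> {}" by auto
  then have "lcosets H \<noteq> {}" by (simp add: LCOSETS_def)
  then have "k > 0" using ts by (auto simp: left_transversal_def k_def bij_betw_def)
  have char: "character (induced_rep G H 1 trivial_rep) g = (\<Sum>i<k. if inv (ts ! i) \<otimes> g \<otimes> ts ! i \<in> H then 1 else 0 :: complex)" for g
    by (simp add: character_def induced_rep_def ts_def[symmetric] Let_def k_def) (intro sum.cong refl, simp add: Let_def)
  have inner: "(\<Sum>g\<in>carrier G. (if inv (ts ! i) \<otimes> g \<otimes> ts ! i \<in> H then 1 else 0) * cnj (\<psi> g)) = (\<Sum>h\<in>H. cnj (\<psi> h))"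
    if i: "i < k" for i
  proof -
    define s where "s = ts ! i"
    have s: "s \<in> carrier G" using t[OF i] by (simp add: s_def)
    have "(\<Sum>g\<in>carrier G. (if inv s \<otimes> g \<otimes> s \<in> H then 1 else 0) * cnj (\<psi> g))
        = (\<Sum>g\<in>carrier G. (if inv s \<otimes> (s \<otimes> g \<otimes> inv s) \<otimes> s \<in> H then 1 else 0) * cnj (\<psi> (s \<otimes> g \<otimes> inv s)))"
      using bij_betw_trans[OF bij_mult_left[OF s] bij_mult_right[OF inv_closed[OF s]]]
      by (intro sum.reindex_bij_betw[symmetric, of "\<lambda>g. s \<otimes> g \<otimes> inv s"]) (simp add: comp_def)
    also have "\<dots> = (\<Sum>g\<in>carrier G. if g \<in> H then cnj (\<psi> g) else 0)"
    proof (rule sum.cong[OF refl])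
      fix g assume g: "g \<in> carrier G"
      have "inv s \<otimes> (s \<otimes> g \<otimes> inv s) \<otimes> s = g" using s g by (simp add: m_assoc) (simp add: m_assoc[symmetric])
      moreover have "\<psi> (s \<otimes> g \<otimes> inv s) = \<psi> g" using conj[of "s \<otimes> g" "inv s"] s g by (simp add: m_assoc[symmetric])
      ultimately show "(if inv s \<otimes> (s \<otimes> g \<otimes> inv s) \<otimes> s \<in> H then 1 else 0) * cnj (\<psi> (s \<otimes> g \<otimes> inv s)) = (if g \<in> H then cnj (\<psi> g) else 0)"
        by simp
    qed
    also have "\<dots> = (\<Sum>g\<in>carrier G \<inter> H. cnj (\<psi> g))" by (simp add: sum.inter_restrict)
    also have "carrier G \<inter> H = H" using subgroup.subset[OF H] by blast
    finally show ?thesis by (simp add: s_def)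
  qed
  have "(\<Sum>g\<in>carrier G. character (induced_rep G H 1 trivial_rep) g * cnj (\<psi> g))
      = (\<Sum>i<k. \<Sum>g\<in>carrier G. (if inv (ts ! i) \<otimes> g \<otimes> ts ! i \<in> H then 1 else 0) * cnj (\<psi> g))"
    unfolding char sum_distrib_right by (rule sum.swap)
  also have "\<dots> = of_nat k * (\<Sum>h\<in>H. cnj (\<psi> h))" by (simp add: inner)
  finally show ?thesis
    using \<open>k > 0\<close> \<open>carrier G \<noteq> {}\<close> by (simp add: char_inner_def)
qed

end

section \<open>The element \<open>f\<close>: its coefficient at the identity, its vanishing and its
  left ideal\<close>

context rational_irrep
begin

context
  fixes H :: "'g set"
  assumes H: "subgroup H G"
begin

definition f where "f = avg H \<otimes>\<^bsub>QG\<^esub> e"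

lemma f_carrier: "f \<in> carrier QG"
  unfolding f_def by (rule QG_mult_closed)

lemma f_eq: "f = e \<otimes>\<^bsub>QG\<^esub> avg H"
  unfolding f_def by (rule e_central[symmetric])

lemma e_f: "e \<otimes>\<^bsub>QG\<^esub> f = f"
  unfolding f_eq QG_mult_assoc[symmetric] e_idem ..

lemma f_idem: "f \<otimes>\<^bsub>QG\<^esub> f = f"
proof -
  have "f \<otimes>\<^bsub>QG\<^esub> f = avg H \<otimes>\<^bsub>QG\<^esub> (e \<otimes>\<^bsub>QG\<^esub> f)" by (simp add: f_def QG_mult_assoc)
  also have "\<dots> = (avg H \<otimes>\<^bsub>QG\<^esub> avg H) \<otimes>\<^bsub>QG\<^esub> e" unfolding e_f by (simp add: f_def QG_mult_assoc)
  finally show ?thesis by (simp add: avg_idem[OF H] f_def)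
qed

lemma group_elem_f: "h \<in> H \<Longrightarrow> group_elem h \<otimes>\<^bsub>QG\<^esub> f = f"
  by (simp add: f_def QG_mult_assoc[symmetric] group_elem_avg[OF H])

lemma f_group_elem: "h \<in> H \<Longrightarrow> f \<otimes>\<^bsub>QG\<^esub> group_elem h = f"
  by (simp add: f_eq QG_mult_assoc avg_group_elem[OF H])

text \<open>The sum of the character over \<open>H\<close> is the rational number |H| dim V^H, so
  \<open>tr\<close> merely multiplies it by \<open>tr 1\<close>, the degree of K over Q.\<close>

lemma f_one: "of_nat ord_G * f \<one> = of_nat (n * card KB * fixed_dim H n V)"
proof -
  have "f \<one> = (\<Sum>h\<in>H. e (inv h)) / of_nat (card H)"
    using subgroup.mem_carrier[OF H] by (simp add: f_def avg_mult_sum[OF H])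
  also have "(\<Sum>h\<in>H. e (inv h)) = of_nat n / of_nat ord_G * tr (\<Sum>h\<in>H. \<chi> h)"
    using subgroup.mem_carrier[OF H] by (simp add: e_eq tr_sum sum_distrib_left)
  also have "(\<Sum>h\<in>H. \<chi> h) = of_rat (of_nat (card H) * of_nat (fixed_dim H n V)) * 1"
    using fixed_dim_eq_trace[OF H rep] card_subgroup_nonzero[OF H] by (simp add: of_rat_mult)
  also have "tr \<dots> = of_nat (card H) * of_nat (fixed_dim H n V) * of_nat (card KB)"
    unfolding tr_scale tr_one[OF finite_KB] ..
  finally show ?thesis using ord_G_pos card_subgroup_nonzero[OF H, where 'a = rat] by (simp add: mult_ac)
qed

text \<open>Comparing \<open>k * d\<close> from \<open>idempotent_ideal_rank\<close> with
  \<open>f_one\<close> and substituting the degree formula for \<open>d\<close>, the common factor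
  \<open>n * card KB\<close> cancels. It is positive because \<open>d\<close> is.\<close>

lemma f_ideal:
  obtains k t where "hom_family (left_ideal QG f) k t"
    "\<And>m. m \<in> left_ideal QG f \<Longrightarrow> \<exists>u. (\<forall>i<k. u i \<in> carrier_vec d) \<and> (\<forall>x. m x = (\<Sum>i<k. t i (u i) x))"
    "fixed_dim H n V = k * schur_index G n V"
proof (rule left_ideal_hom_family)
  show "left_ideal QG f \<subseteq> carrier QG" by (auto simp: left_ideal_def QG_mult_closed simp del: QG_mult)
  show "a \<otimes>\<^bsub>QG\<^esub> m \<in> left_ideal QG f" if "m \<in> left_ideal QG f" "a \<in> carrier QG" for a m
    using that by (auto simp: left_ideal_def QG_mult_assoc[symmetric] intro: QG_mult_closed)
  show "e \<otimes>\<^bsub>QG\<^esub> m = m" if m: "m \<in> left_ideal QG f" for m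
  proof -
    obtain a where a: "m = a \<otimes>\<^bsub>QG\<^esub> f" using m by (auto simp: left_ideal_def)
    have "e \<otimes>\<^bsub>QG\<^esub> m = (e \<otimes>\<^bsub>QG\<^esub> a) \<otimes>\<^bsub>QG\<^esub> f" by (simp add: a QG_mult_assoc)
    also have "\<dots> = a \<otimes>\<^bsub>QG\<^esub> (e \<otimes>\<^bsub>QG\<^esub> f)" by (simp add: e_central QG_mult_assoc)
    finally show ?thesis by (simp add: e_f a)
  qed
  fix k t assume t: "hom_family (left_ideal QG f) k t"
    and onto: "\<And>m. m \<in> left_ideal QG f \<Longrightarrow> \<exists>u. (\<forall>i<k. u i \<in> carrier_vec d) \<and> (\<forall>x. m x = (\<Sum>i<k. t i (u i) x))"
  have "of_nat (k * d) = (of_nat (n * card KB * fixed_dim H n V) :: rat)"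
    using idempotent_ideal_rank[OF f_idem t onto] f_one by simp
  then have "k * d = n * card KB * fixed_dim H n V" by (simp only: of_nat_eq_iff)
  then have "n * card KB * (k * schur_index G n V) = n * card KB * fixed_dim H n V"
    unfolding degree_eq_schur_index by (simp add: mult_ac)
  moreover have "n * card KB > 0" using d_pos degree_eq_schur_index by (metis mult_is_0 neq0_conv)
  ultimately have "fixed_dim H n V = k * schur_index G n V" by simp
  then show ?thesis using that[OF t onto] by blast
qed

lemma act_avg_fix_proj:
  "msum d d (carrier G) (\<lambda>g. avg H g \<cdot>\<^sub>m W g) = fix_proj H d W"
proof (rule eq_matI)
  fix i j assume "i < dim_row (fix_proj H d W)" "j < dim_col (fix_proj H d W)"
  then have ij: "i < d" "j < d" by (auto simp: fix_proj_def)
  have "(\<Sum>g\<in>carrier G. avg H g * W g $$ (i, j)) = (\<Sum>g\<in>H. avg H g * W g $$ (i, j))"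
    using subgroup.subset[OF H] by (intro sum.mono_neutral_right) (auto simp: subgroup_average_def)
  then show "msum d d (carrier G) (\<lambda>g. avg H g \<cdot>\<^sub>m W g) $$ (i, j) = fix_proj H d W $$ (i, j)"
    using ij carrier_matD[OF W_carrier] carrier_matD[OF W_carrier[OF subgroup.mem_carrier[OF H]]]
    by (simp add: fix_proj_def subgroup_average_def)
qed (simp_all add: fix_proj_def)

text \<open>Extending \<open>W\<close> linearly gives an algebra homomorphism, so \<open>f\<close>
  acts on \<open>W\<close> as the product of the actions of its two factors.\<close>

lemma msum_conv:
  "msum d d (carrier G) (\<lambda>g. (a \<otimes>\<^bsub>QG\<^esub> b) g \<cdot>\<^sub>m W g)
    = msum d d (carrier G) (\<lambda>g. a g \<cdot>\<^sub>m W g) * msum d d (carrier G) (\<lambda>g. b g \<cdot>\<^sub>m W g)"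
proof -
  have Wc: "c \<cdot>\<^sub>m W g \<in> carrier_mat d d" if "g \<in> carrier G" for c g using W_carrier[OF that] by simp
  have "msum d d (carrier G) (\<lambda>g. a g \<cdot>\<^sub>m W g) * msum d d (carrier G) (\<lambda>g. b g \<cdot>\<^sub>m W g)
      = msum d d (carrier G) (\<lambda>x. (a x \<cdot>\<^sub>m W x) * msum d d (carrier G) (\<lambda>g. b g \<cdot>\<^sub>m W g))"
    by (rule msum_mult[OF msum_carrier Wc])
  also have "\<dots> = msum d d (carrier G) (\<lambda>g. (a \<otimes>\<^bsub>QG\<^esub> b) g \<cdot>\<^sub>m W g)"
  proof (rule eq_matI)
    fix i j assume "i < dim_row (msum d d (carrier G) (\<lambda>g. (a \<otimes>\<^bsub>QG\<^esub> b) g \<cdot>\<^sub>m W g))"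
      "j < dim_col (msum d d (carrier G) (\<lambda>g. (a \<otimes>\<^bsub>QG\<^esub> b) g \<cdot>\<^sub>m W g))"
    then have ij: "i < d" "j < d" by auto
    note idx = index_smult_mat(1) carrier_matD[OF W_carrier]
    have "((a x \<cdot>\<^sub>m W x) * msum d d (carrier G) (\<lambda>g. b g \<cdot>\<^sub>m W g)) $$ (i, j)
        = (\<Sum>g\<in>carrier G. a x * b (inv x \<otimes> g) * W g $$ (i, j))" if x: "x \<in> carrier G" for x
    proof -
      have "(a x \<cdot>\<^sub>m W x) * msum d d (carrier G) (\<lambda>g. b g \<cdot>\<^sub>m W g)
          = msum d d (carrier G) (\<lambda>g. (a x \<cdot>\<^sub>m W x) * (b g \<cdot>\<^sub>m W g))"
        by (rule mult_msum[OF Wc[OF x] Wc])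
      also have "\<dots> $$ (i, j) = (\<Sum>g\<in>carrier G. a x * b g * W (x \<otimes> g) $$ (i, j))"
        using ij x
        by (simp add: mult_smult_distrib[OF Wc[OF x] W_carrier] mult_smult_assoc_mat[OF W_carrier[OF x] W_carrier]
            is_rep_mult[OF W_rep x, symmetric] idx mult_ac del: index_mult_mat(1))
      also have "\<dots> = (\<Sum>g\<in>carrier G. a x * b (inv x \<otimes> (x \<otimes> g)) * W (x \<otimes> g) $$ (i, j))"
        using x by (intro sum.cong refl) (simp add: m_assoc[symmetric])
      also have "\<dots> = (\<Sum>g\<in>carrier G. a x * b (inv x \<otimes> g) * W g $$ (i, j))"
        by (rule sum_mult_left[OF x])
      finally show ?thesis .
    qed
    then have "msum d d (carrier G) (\<lambda>x. (a x \<cdot>\<^sub>m W x) * msum d d (carrier G) (\<lambda>g. b g \<cdot>\<^sub>m W g)) $$ (i, j)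
        = (\<Sum>x\<in>carrier G. \<Sum>g\<in>carrier G. a x * b (inv x \<otimes> g) * W g $$ (i, j))"
      using ij by (simp del: index_mult_mat(1))
    also have "\<dots> = (\<Sum>g\<in>carrier G. (a \<otimes>\<^bsub>QG\<^esub> b) g * W g $$ (i, j))"
      by (subst sum.swap) (simp add: QG_mult sum_distrib_right)
    finally show "msum d d (carrier G) (\<lambda>x. (a x \<cdot>\<^sub>m W x) * msum d d (carrier G) (\<lambda>g. b g \<cdot>\<^sub>m W g)) $$ (i, j)
        = msum d d (carrier G) (\<lambda>g. (a \<otimes>\<^bsub>QG\<^esub> b) g \<cdot>\<^sub>m W g) $$ (i, j)"
      using ij by (simp add: idx)
  qed auto
  finally show ?thesis by simp
qed

text \<open>On \<open>W\<close> the idempotent \<open>e\<close> acts as the identity, so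
  \<open>f\<close> acts there as the averaging projection alone.\<close>

lemma f_zero_imp_fix_proj: "f = \<zero>\<^bsub>QG\<^esub> \<Longrightarrow> fix_proj H d W = 0\<^sub>m d d"
proof -
  assume f0: "f = \<zero>\<^bsub>QG\<^esub>"
  have "fix_proj H d W = fix_proj H d W * 1\<^sub>m d" using fix_proj_carrier[OF H W_rep] by simp
  also have "\<dots> = msum d d (carrier G) (\<lambda>g. f g \<cdot>\<^sub>m W g)"
    by (simp add: e_on_W[symmetric] act_avg_fix_proj[symmetric] msum_conv[symmetric] f_def)
  also have "\<dots> = 0\<^sub>m d d" using carrier_matD[OF W_carrier] by (intro eq_matI) (auto simp: f0 QG_zero)
  finally show ?thesis .
qed

text \<open>The embedding \<open>T\<close> commutes with averaging over \<open>H\<close>, so the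
  vanishing of the projection on \<open>W\<close> passes to \<open>V\<close>.\<close>

lemma cmat_fix_proj: "cmat (fix_proj H d W) * T = T * fix_proj H n V"
proof -
  have "cmat (fix_proj H d W) = fix_proj H d WC"
    using carrier_matD[OF W_carrier[OF subgroup.mem_carrier[OF H]]]
    by (intro eq_matI) (auto simp: fix_proj_def complexify_def of_rat_sum of_rat_divide sum_divide_distrib)
  note c = V_carrier[OF subgroup.mem_carrier[OF H]] WC_carrier[OF subgroup.mem_carrier[OF H]]
  have "T * fix_proj H n V = msum d n H (\<lambda>h. T * ((1 / of_nat (card H)) \<cdot>\<^sub>m V h))"
    unfolding fix_proj_def by (rule mult_msum[OF T(1)]) (use c in simp)
  also have "\<dots> = msum d n H (\<lambda>h. ((1 / of_nat (card H)) \<cdot>\<^sub>m WC h) * T)"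
    by (rule msum_cong) (simp add: mult_smult_distrib[OF T(1) c(1)] mult_smult_assoc_mat[OF c(2) T(1)] T(2) subgroup.mem_carrier[OF H])
  also have "\<dots> = fix_proj H d WC * T"
    unfolding fix_proj_def by (rule msum_mult[symmetric, OF T(1)]) (use c in simp)
  finally show ?thesis using \<open>cmat (fix_proj H d W) = fix_proj H d WC\<close> by simp
qed

text \<open>The complexified character has rational values, so complex conjugation drops out and the
  sum over \<open>H\<close> is |H| times the dimension of the fixed space of
  \<open>W\<close>.\<close>

lemma inner_zero_iff: 
  "char_inner G (character (induced_rep G H 1 trivial_rep)) (character WC) = 0 \<longleftrightarrow> fixed_dim H d W = 0"
proof -
  have char: "character WC h = of_rat (character W h)" if "h \<in> carrier G" for h
    using carrier_matD[OF W_carrier[OF that]] by (simp add: character_def complexify_def of_rat_sum)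
  have "cnj (of_rat q) = of_rat q" for q
    by (cases q) (simp add: of_rat_rat)
  then have "(\<Sum>h\<in>H. cnj (character WC h)) = of_rat (\<Sum>h\<in>H. character W h)"
    using subgroup.mem_carrier[OF H] by (simp add: char of_rat_sum)
  then have "char_inner G (character (induced_rep G H 1 trivial_rep)) (character WC) = 0
      \<longleftrightarrow> (\<Sum>h\<in>H. character W h) = 0"
    using frobenius_trivial[OF H, of "character WC"] character_conj[OF WC_rep] by simp
  also have "\<dots> \<longleftrightarrow> fixed_dim H d W = 0"
    using fixed_dim_eq_trace[OF H W_rep] card_subgroup_nonzero[OF H, where 'a = rat] by (metis divide_eq_0_iff of_nat_eq_0_iff)
  finally show ?thesis .
qed

text \<open>The implications form a cycle: from \<open>f = 0\<close> to no \<open>H\<close>-fixed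
  vectors in \<open>W\<close>, from there to none in \<open>V\<close> through \<open>T\<close>, and
  back to \<open>f = 0\<close>.\<close>

lemma vanishing_conditions:
  shows "f = \<zero>\<^bsub>QG\<^esub> \<longleftrightarrow> char_inner G (character (induced_rep G H 1 trivial_rep)) (character WC) = 0"
    and "char_inner G (character (induced_rep G H 1 trivial_rep)) (character WC) = 0 \<longleftrightarrow> fixed_dim H n V = 0"
proof -
  have 1: "fixed_dim H d W = 0" if "f = \<zero>\<^bsub>QG\<^esub>"
    using fixed_dim_eq_mtrace[OF H W_rep] f_zero_imp_fix_proj[OF that] by (simp add: mtrace_def)
  have 2: "fixed_dim H n V = 0" if "fixed_dim H d W = 0"
  proof -
    have "cmat (fix_proj H d W) = 0\<^sub>m d d"
      unfolding fixed_dim_zero_imp_fix_proj_zero[OF H W_rep that] by (intro eq_matI) auto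
    then have TP: "T * fix_proj H n V = 0\<^sub>m d n" using cmat_fix_proj T(1) by simp
    have "fix_proj H n V = T' * T * fix_proj H n V" using fix_proj_carrier[OF H rep] by (simp add: T'(2))
    also have "\<dots> = T' * (T * fix_proj H n V)"
      by (rule assoc_mult_mat[OF T'(1) T(1) fix_proj_carrier[OF H rep]])
    also have "\<dots> = 0\<^sub>m n n" unfolding TP using T'(1) by simp
    finally have P0: "fix_proj H n V = 0\<^sub>m n n" .
    then show ?thesis using fixed_dim_eq_mtrace[OF H rep] by (simp add: mtrace_def)
  qed
  \<comment> \<open>Without fixed vectors the number of copies \<open>k\<close> is 0, so the left
    ideal is zero; it contains \<open>f\<close> because \<open>f\<close> is idempotent.\<close>
  have 3: "f = \<zero>\<^bsub>QG\<^esub>" if 0: "fixed_dim H n V = 0"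
  proof -
    obtain k t where t: "hom_family (left_ideal QG f) k t"
      and onto: "\<And>m. m \<in> left_ideal QG f \<Longrightarrow> \<exists>u. (\<forall>i<k. u i \<in> carrier_vec d) \<and> (\<forall>x. m x = (\<Sum>i<k. t i (u i) x))"
      and k: "fixed_dim H n V = k * schur_index G n V"
      by (rule f_ideal) (rule that)
    have "schur_index G n V \<noteq> 0" using degree_eq_schur_index d_pos by (intro notI) simp
    then have "k = 0" using k 0 by simp
    moreover have "f \<in> left_ideal QG f" using f_idem f_carrier unfolding left_ideal_def by (metis (mono_tags, lifting) mem_Collect_eq)
    ultimately show ?thesis using onto[of f] by (simp add: QG_zero fun_eq_iff)
  qed
  show "f = \<zero>\<^bsub>QG\<^esub> \<longleftrightarrow> char_inner G (character (induced_rep G H 1 trivial_rep)) (character WC) = 0"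
    "char_inner G (character (induced_rep G H 1 trivial_rep)) (character WC) = 0 \<longleftrightarrow> fixed_dim H n V = 0"
    unfolding inner_zero_iff using 1 2 3 by blast+
qed

text \<open>Divisibility is stated together with the isomorphism so that \<open>div\<close> denotes
  the exact quotient; the Schur index is nonzero since \<open>d\<close> is.\<close>

lemma f_left_ideal_isomorphic:
  "schur_index G n V dvd fixed_dim H n V \<and>
   isomorphic_modules QG (left_ideal_module QG f)
     (module_power (fixed_dim H n V div schur_index G n V) (rep_module G d W))"
proof -
  obtain k t where t: "hom_family (left_ideal QG f) k t"
    and onto: "\<And>m. m \<in> left_ideal QG f \<Longrightarrow> \<exists>u. (\<forall>i<k. u i \<in> carrier_vec d) \<and> (\<forall>x. m x = (\<Sum>i<k. t i (u i) x))"
    and k: "fixed_dim H n V = k * schur_index G n V"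
    by (rule f_ideal) (rule that)
  have "schur_index G n V \<noteq> 0" using degree_eq_schur_index d_pos by (intro notI) simp
  then have "fixed_dim H n V div schur_index G n V = k" by (simp add: k)
  then show ?thesis using left_ideal_isomorphic[OF f_carrier t onto] by (simp add: k)
qed

end

end

theorem theorem4p4:
  fixes G :: "('g, 'b) monoid_scheme" and H :: "'g set"
    and W :: "'g \<Rightarrow> rat mat" and d :: nat
    and V :: "'g \<Rightarrow> complex mat" and n :: nat
    and QG :: "('g \<Rightarrow> rat) ring"
    and p e f :: "'g \<Rightarrow> rat" and m :: nat
  assumes "group G" and "finite (carrier G)"
    and "irreducible_rep G d W"
    and "irreducible_rep G n V"
    and "appears_in G n V d (complexify W)"
    and "subgroup H G"
  defines "QG \<equiv> group_algebra G"
    and "m \<equiv> schur_index G n V"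
    and "e \<equiv> rational_idempotent G n V"
    and "p \<equiv> subgroup_average H"
    and "f \<equiv> p \<otimes>\<^bsub>QG\<^esub> e"
  shows "f = e \<otimes>\<^bsub>QG\<^esub> p \<and>
    f \<in> left_ideal QG e \<and>
    f \<otimes>\<^bsub>QG\<^esub> f = f \<and>
    (\<forall>h\<in>H. group_elem h \<otimes>\<^bsub>QG\<^esub> f = f \<and> f = f \<otimes>\<^bsub>QG\<^esub> group_elem h) \<and>
    (f = \<zero>\<^bsub>QG\<^esub> \<longleftrightarrow>
      char_inner G (character (induced_rep G H 1 trivial_rep)) (character (complexify W)) = 0) \<and>
    (char_inner G (character (induced_rep G H 1 trivial_rep)) (character (complexify W)) = 0 \<longleftrightarrow>
      fixed_dim H n V = 0) \<and>
    (f \<noteq> \<zero>\<^bsub>QG\<^esub> \<longrightarrow>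
      m dvd fixed_dim H n V \<and>
      isomorphic_modules QG (left_ideal_module QG f)
        (module_power (fixed_dim H n V div m) (rep_module G d W)))"
proof -
  interpret group G by fact
  interpret R: rational_irrep G n V d W
    by unfold_locales (fact assms)+
  note H = \<open>subgroup H G\<close>
  have e: "e = R.e" and f: "f = R.f H"
    by (simp_all add: e_def f_def p_def QG_def R.e_def R.f_def[OF H])
  have "f \<in> left_ideal QG e"
    unfolding f_def QG_def p_def left_ideal_def using R.avg_carrier[OF H] by blast
  then show ?thesis
    unfolding QG_def m_def p_def
    using R.f_eq[OF H] R.f_idem[OF H] R.group_elem_f[OF H] R.f_group_elem[OF H]
      R.vanishing_conditions[OF H] R.f_left_ideal_isomorphic[OF H]
    unfolding e f by simp
qed

end
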